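(* Suppose that for some $\bar p>0$ there exist a symmetric positive-definite matrix $Q\in\mathbb R^{n\times n}$ (the same for all states) and constants $\alpha_i\in\mathbb R$, $i\in\mathbb S$, such that for each $i\in\mathbb S$ $$\limsup_{|x|\to\infty}\frac{(1+x^TQx)\psi(x,i)-(2-\bar p)|x^TQg(x,i)|^2}{(x^TQx)^2}\le\alpha_i,$$ where $\psi(x,i):=2x^TQf(x,i)+\mathrm{trace}[g^T(x,i)Qg(x,i)]$, and that $\pi\alpha:=\sum_{i\in\mathbb S}\pi_i\alpha_i<0$, with $\alpha=(\alpha_1,\dots,\alpha_m)^T$. Suppose the function $h$ of the truncated Euler–Maruyama scheme satisfies in addition $\Delta^{1/2-\theta}h(\Delta)\le K$ for all $\Delta\in(0,1]$, for some $0<\theta<\frac12$. Then for any $p\in(0,p^*_\alpha)\cap(0,\bar p]$ there is a constant $\Delta^*\in(0,1]$ such that the scheme satisfies $$\sup_{0<\Delta\le\Delta^*}\ \sup_{k\ge0}\mathbb E|Y_k|^p\le C,$$ where $C$ is independent of $k$ and $\Delta$.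
   Context: Notation: $|\cdot|$ is the Euclidean norm on $\mathbb R^n$ and the trace norm $|A|=\sqrt{\mathrm{trace}(A^TA)}$ on matrices; $a\vee b=\max\{a,b\}$, $a\wedge b=\min\{a,b\}$; for a family $(c_i)_{i\in\mathbb S}$, $\check c=\max_i c_i$; $\mathbb R_+=[0,\infty)$. System: $(\Omega,\mathcal F,\mathbb P)$ is a complete probability space with a filtration $\{\mathcal F_t\}_{t\ge0}$ satisfying the usual conditions; $B(t)$ is a $d$-dimensional Brownian motion and $r(t)$ is a right-continuous Markov chain with finite state space $\mathbb S=\{1,\dots,m\}$ and generator $\Gamma=(\gamma_{ij})_{m\times m}$ ($\gamma_{ij}\ge0$ for $i\ne j$, $\gamma_{ii}=-\sum_{j\ne i}\gamma_{ij}$), independent of $B$; both are adapted to (and are a Brownian motion, resp. a Markov chain, relative to) $\{\mathcal F_t\}$. The chain is irreducible, i.e. $\pi\Gamma=0$, $\sum_i\pi_i=1$ has a unique solution $\pi=(\pi_1,\dots,\pi_m)$, with all $\pi_i>0$. The switching diffusion system is $dX(t)=f(X(t),r(t))dt+g(X(t),r(t))dB(t)$, $(X(0),r(0))=(x_0,\ell)\in\mathbb R^n\times\mathbb S$, where $f:\mathbb R^n\times\mathbb S\to\mathbb R^n$, $g:\mathbb R^n\times\mathbb S\to\mathbb R^{n\times d}$ are locally Lipschitz in $x$ for each $i$. The number $p^*_u$: for $u=(u_1,\dots,u_m)^T$ with $\pi u<0$ and $p>0$ let $\Gamma_{p,u}=\Gamma+\frac p2\mathrm{diag}(u_1,\dots,u_m)$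 and $\eta_{p,u}=-\max_{\nu\in\mathrm{spec}(\Gamma_{p,u})}\mathrm{Re}(\nu)$. If $\check u\le0$, $p^*_u=+\infty$; if $\check u>0$, $p^*_u$ is a number in $(0,\min_{i:u_i>0}\{-2\gamma_{ii}/u_i\})$ such that $\eta_{p,u}>0$ for all $p\in(0,p^*_u)$ (such a number exists; and $\eta_{p,u}>0$ for all $p>0$ in the first case). Truncated Euler–Maruyama scheme: for each $i\in\mathbb S$ choose a strictly increasing continuous $\varphi_i:[1,\infty)\to\mathbb R_+$ with $\varphi_i(u)\to\infty$ as $u\to\infty$ and $\sup_{|x|\le u}\big(\frac{|f(x,i)|}{1+|x|}\vee\frac{|g(x,i)|^2}{(1+|x|)^2}\big)\le\varphi_i(u)$ for $u\ge1$; $\varphi_i^{-1}:[\varphi_i(1),\infty)\to\mathbb R_+$ is its inverse. (If for a state $i$ one has $|f(x,i)|\le C(1+|x|)$ and $|g(x,i)|^2\le C(1+|x|)^2$ for all $x$, one may instead take $\varphi_i\equiv C$, $\varphi_i^{-1}\equiv+\infty$ on $[C,\infty)$.) Choose a strictly decreasing $h:(0,1]\to[\check\varphi(|x_0|\vee1),\infty)$ with $\lim_{\Delta\to0}h(\Delta)=\infty$ and $\Delta^{1/2}h(\Delta)\le K$ for all $\Delta\in(0,1]$, $K>0$ a constant. Set $\pi_\Delta^i(x)=(|x|\wedge\varphi_i^{-1}(h(\Delta)))\frac{x}{|x|}$, with $\frac{x}{|x|}=\mathbf 0$ if $x=\mathbf 0$. With $t_k=k\Delta$, $r_k=r(t_k)$,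 $\Delta B_k=B(t_{k+1})-B(t_k)$, define $\tilde Y_0=x_0$, $r_0=\ell$, and for $k\ge0$: $Y_k=\pi_\Delta^{r_k}(\tilde Y_k)$, $\tilde Y_{k+1}=Y_k+f(Y_k,r_k)\Delta+g(Y_k,r_k)\Delta B_k$. *)

theory Defs
  imports "HOL-Probability.Probability"
begin

section \<open>Brownian motion and Markov chain relative to a filtration\<close>

text \<open>Processes and filtrations are indexed by type \<^typ>\<open>real\<close>; only times \<open>t \<ge> 0\<close> matter.\<close>

definition usual_filtration :: "'w measure \<Rightarrow> (real \<Rightarrow> 'w measure) \<Rightarrow> bool" where
  "usual_filtration M F \<longleftrightarrow>
     (\<forall>t\<ge>0. subalgebra M (F t)) \<and>
     (\<forall>s\<ge>0. \<forall>t\<ge>s. sets (F s) \<subseteq> sets (F t)) \<and>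
     (\<forall>t\<ge>0. sets (F t) = (\<Inter>s\<in>{t<..}. sets (F s))) \<and>
     null_sets M \<subseteq> sets (F 0)"

definition (in prob_space) brownian_motion ::
    "(real \<Rightarrow> 'a measure) \<Rightarrow> (real \<Rightarrow> 'a \<Rightarrow> real ^ 'd) \<Rightarrow> bool" where
  "brownian_motion F B \<longleftrightarrow>
     (\<forall>t\<ge>0. B t \<in> borel_measurable (F t)) \<and>
     (AE \<omega> in M. B 0 \<omega> = 0) \<and>
     (AE \<omega> in M. continuous_on {0..} (\<lambda>t. B t \<omega>)) \<and>
     (\<forall>s\<ge>0. \<forall>t>s.
        indep_set (sets (F s)) (sets (vimage_algebra (space M) (\<lambda>\<omega>. B t \<omega> - B s \<omega>) borel)) \<and>
        indep_vars (\<lambda>_. borel) (\<lambda>l \<omega>. (B t \<omega> - B s \<omega>) $ l) UNIV \<and>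
        (\<forall>l. distributed M lborel (\<lambda>\<omega>. (B t \<omega> - B s \<omega>) $ l)
               (\<lambda>x. ennreal (normal_density 0 (sqrt (t - s)) x))))"

definition generator_matrix :: "real ^ 's ^ 's \<Rightarrow> bool" where
  "generator_matrix \<Gamma> \<longleftrightarrow>
     (\<forall>i j. i \<noteq> j \<longrightarrow> 0 \<le> \<Gamma> $ i $ j) \<and> (\<forall>i. \<Gamma> $ i $ i = - (\<Sum>j\<in>UNIV - {i}. \<Gamma> $ i $ j))"

text \<open>Irreducibility, in the form: \<open>\<pi>\<Gamma> = 0\<close>, \<open>\<Sum>\<^sub>i \<pi>\<^sub>i = 1\<close> has \<open>\<pi>\<close> as its unique solution, and \<open>\<pi>\<close>
  is positive.\<close>

definition irreducible_stationary :: "real ^ 's ^ 's \<Rightarrow> real ^ 's \<Rightarrow> bool" where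
  "irreducible_stationary \<Gamma> \<pi> \<longleftrightarrow>
     (\<forall>q. q v* \<Gamma> = 0 \<and> (\<Sum>i\<in>UNIV. q $ i) = 1 \<longleftrightarrow> q = \<pi>) \<and> (\<forall>i. 0 < \<pi> $ i)"

text \<open>A transition semigroup \<open>P\<close> with generator \<open>\<Gamma>\<close>: the one-sided derivative at \<open>0\<close> says
  \<open>P(t) = I + t\<Gamma> + o(t)\<close> as \<open>t \<down> 0\<close>.\<close>

definition transition_semigroup :: "real ^ 's ^ 's \<Rightarrow> (real \<Rightarrow> real ^ 's ^ 's) \<Rightarrow> bool" where
  "transition_semigroup \<Gamma> P \<longleftrightarrow>
     (\<forall>t\<ge>0. (\<forall>i j. 0 \<le> P t $ i $ j) \<and> (\<forall>i. (\<Sum>j\<in>UNIV. P t $ i $ j) = 1)) \<and>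
     P 0 = mat 1 \<and>
     (\<forall>s\<ge>0. \<forall>t\<ge>0. P (s + t) = P s ** P t) \<and>
     (P has_vector_derivative \<Gamma>) (at 0 within {0..})"

definition (in prob_space) markov_chain ::
    "(real \<Rightarrow> 'a measure) \<Rightarrow> real ^ 's ^ 's \<Rightarrow> (real \<Rightarrow> 'a \<Rightarrow> 's) \<Rightarrow> bool" where
  "markov_chain F \<Gamma> r \<longleftrightarrow>
     (\<forall>t\<ge>0. r t \<in> F t \<rightarrow>\<^sub>M count_space UNIV) \<and>
     (AE \<omega> in M. \<forall>t\<ge>0. \<forall>\<^sub>F s in at_right t. r s \<omega> = r t \<omega>) \<and>
     (\<exists>P. transition_semigroup \<Gamma> P \<and>
        (\<forall>s\<ge>0. \<forall>t\<ge>0. \<forall>j. AE \<omega> in M.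
           real_cond_exp M (F s) (indicator {\<omega>\<in>space M. r (s + t) \<omega> = j}) \<omega> = P t $ r s \<omega> $ j))"

locale switching_noise = prob_space M + complete_measure M
  for M :: "'w measure" +
  fixes F :: "real \<Rightarrow> 'w measure"
    and B :: "real \<Rightarrow> 'w \<Rightarrow> real ^ 'd"
    and r :: "real \<Rightarrow> 'w \<Rightarrow> 's::finite"
    and \<Gamma> :: "real ^ 's ^ 's"
    and \<pi> :: "real ^ 's"
    and i0 :: 's
  assumes usual: "usual_filtration M F"
    and brownian: "brownian_motion F B"
    and generator: "generator_matrix \<Gamma>"
    and irreducible: "irreducible_stationary \<Gamma> \<pi>"
    and markov: "markov_chain F \<Gamma> r"
    and initial_state: "AE \<omega> in M. r 0 \<omega> = i0"
    and indep_noise: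
      "indep_set
         (sets (vimage_algebra (space M) (\<lambda>\<omega>. \<lambda>t\<in>{0..}. B t \<omega>) (\<Pi>\<^sub>M t\<in>{0..}. borel)))
         (sets (vimage_algebra (space M) (\<lambda>\<omega>. \<lambda>t\<in>{0..}. r t \<omega>) (\<Pi>\<^sub>M t\<in>{0..}. count_space UNIV)))"


section \<open>The number \<open>p\<^sup>*\<^sub>u\<close>\<close>

definition cspec :: "real ^ 's ^ 's \<Rightarrow> complex set" where
  "cspec A = {\<nu>. \<exists>v. v \<noteq> 0 \<and> map_matrix complex_of_real A *v v = \<nu> *s v}"

definition \<Gamma>\<^sub>p :: "real ^ 's ^ 's \<Rightarrow> real \<Rightarrow> real ^ 's \<Rightarrow> real ^ 's ^ 's" where
  "\<Gamma>\<^sub>p \<Gamma> p u = \<Gamma> + (p / 2) *\<^sub>R (\<chi> i j. if i = j then u $ i else 0)"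

definition eta :: "real ^ 's ^ 's \<Rightarrow> real \<Rightarrow> real ^ 's \<Rightarrow> real" where
  "eta \<Gamma> p u = - Max (Re ` cspec (\<Gamma>\<^sub>p \<Gamma> p u))"

text \<open>When \<open>u\<close> has a positive entry, \<open>p\<^sup>*\<^sub>u\<close> is not uniquely determined: any number with the stated
  property is admitted. Hence a predicate.\<close>

definition is_p_star :: "real ^ 's ^ 's \<Rightarrow> real ^ 's \<Rightarrow> ereal \<Rightarrow> bool" where
  "is_p_star \<Gamma> u ps \<longleftrightarrow>
     (if Max (range (\<lambda>i. u $ i)) \<le> 0 then ps = \<infinity>
      else 0 < ps \<and> ps < ereal (Min {- 2 * \<Gamma> $ i $ i / u $ i | i. 0 < u $ i}) \<and>
           (\<forall>p>0. ereal p < ps \<longrightarrow> 0 < eta \<Gamma> p u))"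


section \<open>Coefficients\<close>

text \<open>The library norm on \<^typ>\<open>real ^ 'd ^ 'n\<close> is the trace norm.\<close>

lemma norm_matrix_eq_trace: "norm A = sqrt (trace (transpose A ** A))"
  for A :: "real ^ 'd ^ 'n"
proof -
  have "trace (transpose A ** A) = (\<Sum>j\<in>UNIV. \<Sum>i\<in>UNIV. (A $ i $ j)\<^sup>2)"
    by (simp add: trace_def matrix_matrix_mult_def transpose_def power2_eq_square)
  also have "\<dots> = (\<Sum>i\<in>UNIV. \<Sum>j\<in>UNIV. (A $ i $ j)\<^sup>2)"
    by (rule sum.swap)
  finally show ?thesis
    by (simp add: norm_vec_def L2_set_def sum_nonneg)
qed

definition locally_lipschitz :: "(real ^ 'n \<Rightarrow> 'b::metric_space) \<Rightarrow> bool" where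
  "locally_lipschitz F \<longleftrightarrow> (\<forall>R>0. \<exists>L. L-lipschitz_on (cball 0 R) F)"

definition sym_pos_def :: "real ^ 'n ^ 'n \<Rightarrow> bool" where
  "sym_pos_def Q \<longleftrightarrow> transpose Q = Q \<and> (\<forall>x. x \<noteq> 0 \<longrightarrow> 0 < x \<bullet> (Q *v x))"

definition psi :: "real ^ 'n ^ 'n \<Rightarrow> (real ^ 'n \<Rightarrow> 's \<Rightarrow> real ^ 'n) \<Rightarrow>
    (real ^ 'n \<Rightarrow> 's \<Rightarrow> real ^ 'd ^ 'n) \<Rightarrow> real ^ 'n \<Rightarrow> 's \<Rightarrow> real" where
  "psi Q f g x i = 2 * (x \<bullet> (Q *v f x i)) + trace (transpose (g x i) ** Q ** g x i)"


section \<open>The truncated Euler--Maruyama scheme\<close>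

text \<open>\<open>\<phi>\<close> is a growth function for the drift \<open>a\<close> and the diffusion coefficient \<open>b\<close> of one state,
  and \<open>\<psi>\<close> is its inverse on \<open>[\<phi>(1), \<infinity>)\<close>, which under the first disjunct is the image of \<open>[1, \<infinity>)\<close>.
  The second disjunct is the option, under linear growth, of a constant \<open>\<phi>\<close> with inverse \<open>+\<infinity>\<close>.\<close>

definition growth_fun :: "(real ^ 'n \<Rightarrow> real ^ 'n) \<Rightarrow> (real ^ 'n \<Rightarrow> real ^ 'd ^ 'n) \<Rightarrow>
    (real \<Rightarrow> real) \<Rightarrow> (real \<Rightarrow> ereal) \<Rightarrow> bool" where
  "growth_fun a b \<phi> \<psi> \<longleftrightarrow>
     strict_mono_on {1..} \<phi> \<and> continuous_on {1..} \<phi> \<and> \<phi> ` {1..} \<subseteq> {0..} \<and>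
     filterlim \<phi> at_top at_top \<and>
     (\<forall>u\<ge>1. \<forall>x. norm x \<le> u \<longrightarrow>
        max (norm (a x) / (1 + norm x)) ((norm (b x))\<^sup>2 / (1 + norm x)\<^sup>2) \<le> \<phi> u) \<and>
     (\<forall>u\<ge>1. \<psi> (\<phi> u) = ereal u)
   \<or> (\<exists>C. (\<forall>x. norm (a x) \<le> C * (1 + norm x) \<and> (norm (b x))\<^sup>2 \<le> C * (1 + norm x)\<^sup>2) \<and>
        (\<forall>u\<ge>1. \<phi> u = C) \<and> (\<forall>v\<ge>C. \<psi> v = \<infinity>))"

definition step_fun :: "('s::finite \<Rightarrow> real \<Rightarrow> real) \<Rightarrow> real ^ 'n \<Rightarrow> real \<Rightarrow> (real \<Rightarrow> real) \<Rightarrow> bool" where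
  "step_fun \<phi> x0 K h \<longleftrightarrow>
     strict_antimono_on {0<..1} h \<and>
     (\<forall>\<Delta>\<in>{0<..1}. Max (range (\<lambda>i. \<phi> i (max (norm x0) 1))) \<le> h \<Delta>) \<and>
     filterlim h at_top (at_right 0) \<and>
     0 < K \<and> (\<forall>\<Delta>\<in>{0<..1}. \<Delta> powr (1/2) * h \<Delta> \<le> K)"

text \<open>The factor \<open>x / |x|\<close>, with value \<open>0\<close> at \<open>x = 0\<close>, is \<^term>\<open>sgn x\<close>.\<close>

definition trunc :: "('s \<Rightarrow> real \<Rightarrow> ereal) \<Rightarrow> (real \<Rightarrow> real) \<Rightarrow> real \<Rightarrow> 's \<Rightarrow> real ^ 'n \<Rightarrow> real ^ 'n" where
  "trunc \<phi>inv h \<Delta> i x = real_of_ereal (min (ereal (norm x)) (\<phi>inv i (h \<Delta>))) *\<^sub>R sgn x"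

primrec tem_pre :: "(real ^ 'n \<Rightarrow> 's \<Rightarrow> real ^ 'n) \<Rightarrow> (real ^ 'n \<Rightarrow> 's \<Rightarrow> real ^ 'd ^ 'n) \<Rightarrow>
    ('s \<Rightarrow> real \<Rightarrow> ereal) \<Rightarrow> (real \<Rightarrow> real) \<Rightarrow> (real \<Rightarrow> 'w \<Rightarrow> real ^ 'd) \<Rightarrow> (real \<Rightarrow> 'w \<Rightarrow> 's) \<Rightarrow>
    real ^ 'n \<Rightarrow> real \<Rightarrow> nat \<Rightarrow> 'w \<Rightarrow> real ^ 'n" where
  "tem_pre f g \<phi>inv h B r x0 \<Delta> 0 \<omega> = x0"
| "tem_pre f g \<phi>inv h B r x0 \<Delta> (Suc k) \<omega> =
     (let i = r (real k * \<Delta>) \<omega>;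
          y = trunc \<phi>inv h \<Delta> i (tem_pre f g \<phi>inv h B r x0 \<Delta> k \<omega>)
      in y + \<Delta> *\<^sub>R f y i + g y i *v (B (real (Suc k) * \<Delta>) \<omega> - B (real k * \<Delta>) \<omega>))"

definition tem :: "(real ^ 'n \<Rightarrow> 's \<Rightarrow> real ^ 'n) \<Rightarrow> (real ^ 'n \<Rightarrow> 's \<Rightarrow> real ^ 'd ^ 'n) \<Rightarrow>
    ('s \<Rightarrow> real \<Rightarrow> ereal) \<Rightarrow> (real \<Rightarrow> real) \<Rightarrow> (real \<Rightarrow> 'w \<Rightarrow> real ^ 'd) \<Rightarrow> (real \<Rightarrow> 'w \<Rightarrow> 's) \<Rightarrow>
    real ^ 'n \<Rightarrow> real \<Rightarrow> nat \<Rightarrow> 'w \<Rightarrow> real ^ 'n" where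
  "tem f g \<phi>inv h B r x0 \<Delta> k \<omega> =
     trunc \<phi>inv h \<Delta> (r (real k * \<Delta>) \<omega>) (tem_pre f g \<phi>inv h B r x0 \<Delta> k \<omega>)"

end

theory Submission
  imports Defs
begin

text \<open>
The proof finds a Lyapunov function for the discrete chain \<open>(Y\<^sub>k, r\<^sub>k)\<close>: with \<open>u(x) = 1 + x\<^sup>TQx\<close>,
\<open>q = p/2\<close> and positive weights \<open>\<xi>\<^sub>i\<close> put \<open>V(x,i) = \<xi>\<^sub>i u(x)\<^sup>q\<close>. The claim is that
\<open>E V(Y\<^sub>k\<^sub>+\<^sub>1, r\<^sub>k\<^sub>+\<^sub>1) \<le> (1 - c\<Delta>) E V(Y\<^sub>k, r\<^sub>k) + C\<Delta>\<close> with \<open>c > 0\<close> and \<open>C\<close> independent of \<open>k\<close> and of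
all small \<open>\<Delta>\<close>. Such a recursion keeps \<open>E V\<close> below the larger of a bound for its initial value and \<open>C/c\<close>, and
\<open>V\<close> dominates a multiple of \<open>|x|\<^sup>p\<close>.

\<^emph>\<open>Weights.\<close> To first order in \<open>\<Delta>\<close> the growth of \<open>V\<close> in state \<open>i\<close> is governed by
\<open>(\<Gamma>\<xi>)\<^sub>i + q\<alpha>\<^sub>i\<xi>\<^sub>i\<close>, so \<open>\<xi> > 0\<close> must satisfy \<open>(\<Gamma> + q diag \<alpha>)\<xi> < 0\<close>. This matrix has nonnegative off-diagonal
entries. For such a matrix a solution exists as soon as no real \<open>s \<ge> 0\<close> is an eigenvalue: for large
\<open>s\<close> the constant vector works for the matrix minus \<open>s\<close>, and one can follow solutions down to
\<open>s = 0\<close> (\<open>metzler_strict_subsolution\<close>). When some \<open>\<alpha>\<^sub>i\<close> is positive, \<open>p < p\<^sup>*\<close> excludes these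
eigenvalues through \<open>\<eta> > 0\<close>; when none is, irreducibility and \<open>\<pi>\<alpha> < 0\<close> exclude them for every \<open>p\<close>
(\<open>exists_lyapunov_weights\<close>).

\<^emph>\<open>One Euler step.\<close> The truncation guarantees \<open>|f| \<le> h(1 + |y|)\<close> and \<open>|g|\<^sup>2 \<le> h(1 + |y|)\<^sup>2\<close> with
\<open>h = h(\<Delta>)\<close>. The relative increment of \<open>u\<close> is then of order \<open>(h\<Delta>)\<^sup>1\<^sup>/\<^sup>2\<close>, and since \<open>h\<Delta>\<close> is only known to be
\<open>O(\<Delta>\<^sup>1\<^sup>/\<^sup>2\<^sup>+\<^sup>\<theta>)\<close>, its cube need not be \<open>o(\<Delta>)\<close>. A third-order expansion of the power, averaged over the
noise and its reflection, cancels everything odd and leaves an error of order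
\<open>(h\<Delta>)\<^sup>2 \<le> K\<^sup>2\<Delta>\<^sup>1\<^sup>+\<^sup>2\<^sup>\<theta>\<close>, which is \<open>o(\<Delta>)\<close>. This is where \<open>\<theta> > 0\<close> enters
(\<open>symmetrised_step_bound\<close>, \<open>gaussian_step_bound\<close>). The surviving terms form the quotient of the
limsup hypothesis with \<open>p\<close> for \<open>pbar\<close> and \<open>u\<close> for \<open>x\<^sup>TQx\<close> in the denominator; they amount to at most
\<open>q\<Delta>((\<alpha>\<^sub>i + \<epsilon>)u\<^sup>q + const)\<close> (\<open>khasminskii_drift_bound\<close>).

\<^emph>\<open>Switching.\<close> The weight is evaluated at \<open>r\<^sub>k\<^sub>+\<^sub>1\<close>, which enters together with the Brownian increment.
Because the increment is independent of the Brownian past and the Brownian path is independent of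
the chain, the increment can be integrated out with the past and \<open>r\<^sub>k\<^sub>+\<^sub>1\<close> frozen; only then is the
Markov property used, and it turns \<open>\<xi>(r\<^sub>k\<^sub>+\<^sub>1)\<close> into \<open>(P(\<Delta>)\<xi>)(r\<^sub>k) = \<xi> + \<Delta>\<Gamma>\<xi> + o(\<Delta>)\<close>
(\<open>scheme_transition\<close>, \<open>semigroup_drift\<close>). Truncation is a radial contraction, so it only lowers \<open>V\<close>.
\<close>

section \<open>Positive weights for a Metzler matrix\<close>

text \<open>Only off-diagonal entries of row \<open>i\<close> meet a nonzero component of \<open>w\<close>. This is the maximum principle
behind all sign arguments below.\<close>

lemma metzler_nonneg_at_zero:
  fixes A :: "real ^ 's::finite ^ 's"
  assumes metzler: "\<And>i j. i \<noteq> j \<Longrightarrow> 0 \<le> A $ i $ j"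
    and nn: "\<And>j. 0 \<le> w $ j" and z: "w $ i = 0"
  shows "0 \<le> (A *v w) $ i"
  unfolding matrix_vector_mult_def
proof (simp, rule sum_nonneg)
  fix j show "0 \<le> A $ i $ j * w $ j"
    using metzler[of i j] nn[of j] z by (cases "i = j") auto
qed

text \<open>Comparison principle for \<open>A - s\<close>. Subtracting from \<open>\<eta>\<close> the largest multiple \<open>m\<xi>\<close> that stays below it
produces a nonnegative vector with a zero component; a negative \<open>m\<close> would contradict the
maximum principle there.\<close>

lemma metzler_inverse_positive:
  fixes A :: "real ^ 's::finite ^ 's"
  assumes metzler: "\<And>i j. i \<noteq> j \<Longrightarrow> 0 \<le> A $ i $ j"
    and pos: "\<And>i. 0 < \<xi> $ i" and sub: "\<And>i. (A *v \<xi>) $ i < s * \<xi> $ i"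
    and le: "\<And>i. (A *v \<eta>) $ i \<le> s * \<eta> $ i"
  shows "0 \<le> \<eta> $ i"
proof -
  define m where "m = Min (range (\<lambda>i. \<eta> $ i / \<xi> $ i))"
  have "m \<in> range (\<lambda>i. \<eta> $ i / \<xi> $ i)" unfolding m_def by (rule Min_in) auto
  then obtain k where k: "m = \<eta> $ k / \<xi> $ k" by auto
  have ml: "m \<le> \<eta> $ j / \<xi> $ j" for j unfolding m_def by (rule Min_le) auto
  have "0 \<le> m"
  proof (rule ccontr)
    assume neg: "\<not> 0 \<le> m"
    define w where "w = \<eta> - m *\<^sub>R \<xi>"
    have w0: "w $ k = 0" using k pos[of k] by (simp add: w_def)
    have wn: "0 \<le> w $ j" for j using ml[of j] pos[of j] by (simp add: w_def field_simps)
    have "0 \<le> (A *v w) $ k" by (rule metzler_nonneg_at_zero[OF metzler wn w0])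
    also have "\<dots> = (A *v \<eta>) $ k - m * (A *v \<xi>) $ k"
      by (simp add: w_def matrix_vector_mult_diff_distrib matrix_vector_mult_scaleR)
    also have "\<dots> < s * \<eta> $ k - m * (s * \<xi> $ k)"
      using le[of k] mult_strict_left_mono_neg[OF sub[of k], of m] neg by linarith
    also have "\<dots> = s * w $ k" by (simp add: w_def algebra_simps)
    finally show False using w0 by simp
  qed
  then have "0 \<le> \<eta> $ i / \<xi> $ i" using ml[of i] by simp
  then show ?thesis using pos[of i] by (simp add: zero_le_divide_iff)
qed

text \<open>Continuation in the spectral parameter. The set \<open>S\<close> of shifts \<open>s \<ge> 0\<close> for which \<open>A - s\<close> has a strictly positive
strict subsolution contains all large \<open>s\<close>. At its infimum the equation
\<open>(A - s)\<eta> = -1\<close> is solvable by injectivity, the comparison principle at a nearby member of \<open>S\<close> makes \<open>\<eta>\<close>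
nonnegative, the maximum principle makes it positive, and then \<open>\<eta>\<close> still works for slightly smaller shifts; so the infimum is \<open>0\<close> and is attained.\<close>

lemma metzler_strict_subsolution:
  fixes A :: "real ^ 's::finite ^ 's"
  assumes metzler: "\<And>i j. i \<noteq> j \<Longrightarrow> 0 \<le> A $ i $ j"
    and inj: "\<And>s v. 0 \<le> s \<Longrightarrow> A *v v = s *\<^sub>R v \<Longrightarrow> v = 0"
  shows "\<exists>\<xi>. (\<forall>i. 0 < \<xi> $ i) \<and> (\<forall>i. (A *v \<xi>) $ i < 0)"
proof -
  define S where "S = {s. 0 \<le> s \<and> (\<exists>\<xi>. (\<forall>i. 0 < \<xi> $ i) \<and> (\<forall>i. (A *v \<xi>) $ i < s * \<xi> $ i))}"
  have bdd: "bdd_below S" by (rule bdd_belowI[of _ 0]) (auto simp: S_def)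
  have ne: "S \<noteq> {}"
  proof -
    define s where "s = (\<Sum>i\<in>UNIV. \<bar>(A *v 1) $ i\<bar>) + 1"
    have "(A *v 1) $ i < s" for i
      using member_le_sum[of i UNIV "\<lambda>i. \<bar>(A *v 1) $ i\<bar>"] by (simp add: s_def)
    moreover have "0 \<le> s" unfolding s_def by (intro add_nonneg_nonneg sum_nonneg) auto
    ultimately have "s \<in> S" unfolding S_def by (auto intro!: exI[of _ 1])
    then show ?thesis by auto
  qed
  define s0 where "s0 = Inf S"
  have s0: "0 \<le> s0" unfolding s0_def by (rule cInf_greatest[OF ne]) (auto simp: S_def)
  have "inj ((*v) (A - s0 *\<^sub>R mat 1))"
    unfolding Real_Vector_Spaces.linear_injective_0[OF matrix_vector_mul_linear]
    using inj[OF s0] by (auto simp: matrix_vector_mult_diff_rdistrib scaleR_matrix_vector_assoc[symmetric])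
  then have "surj ((*v) (A - s0 *\<^sub>R mat 1))"
    using linear_injective_imp_surjective[OF matrix_vector_mul_linear, of "A - s0 *\<^sub>R mat 1"] by simp
  then obtain \<eta> where "(A - s0 *\<^sub>R mat 1) *v \<eta> = - 1" by (metis surjD)
  then have "A *v \<eta> = s0 *\<^sub>R \<eta> - 1"
    by (simp add: matrix_vector_mult_diff_rdistrib scaleR_matrix_vector_assoc[symmetric] algebra_simps)
  then have \<eta>: "(A *v \<eta>) $ i = s0 * \<eta> $ i - 1" for i by simp
  define N where "N = (\<Sum>i\<in>UNIV. \<bar>\<eta> $ i\<bar>)"
  have N: "0 \<le> N" unfolding N_def by (rule sum_nonneg) auto
  have \<eta>N: "\<bar>\<eta> $ i\<bar> \<le> N" for i unfolding N_def by (rule member_le_sum) auto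
  \<comment> \<open>A change of the shift by at most \<open>t\<close> changes each component by less than the right-hand side \<open>1\<close>.\<close>
  define t where "t = 1 / (N + 1)"
  have t: "0 < t" using N by (simp add: t_def)
  have small: "a * \<bar>\<eta> $ i\<bar> < 1" if "a \<le> t" for a i
  proof -
    have "a * \<bar>\<eta> $ i\<bar> \<le> t * N"
      using that t \<eta>N by (intro mult_mono) auto
    also have "\<dots> < 1" using N by (simp add: t_def)
    finally show ?thesis .
  qed
  have "\<exists>s\<in>S. s < s0 + t"
    using t ne bdd unfolding s0_def by (meson cInf_lessD less_add_same_cancel1)
  then obtain s \<xi> where s: "s < s0 + t" "s \<in> S" and pos: "\<And>i. 0 < \<xi> $ i"
    and sub: "\<And>i. (A *v \<xi>) $ i < s * \<xi> $ i"
    unfolding S_def by auto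
  have ss: "s0 \<le> s" unfolding s0_def by (rule cInf_lower[OF s(2) bdd])
  have \<eta>nn: "0 \<le> \<eta> $ i" for i
  proof (rule metzler_inverse_positive[OF metzler pos sub])
    fix i
    have "- ((s - s0) * \<eta> $ i) \<le> (s - s0) * \<bar>\<eta> $ i\<bar>"
      using ss mult_left_mono[of "- \<eta> $ i" "\<bar>\<eta> $ i\<bar>" "s - s0"] by simp
    then show "(A *v \<eta>) $ i \<le> s * \<eta> $ i"
      using small[of "s - s0" i] s(1) unfolding \<eta> by (simp add: algebra_simps)
  qed
  have \<eta>pos: "0 < \<eta> $ i" for i
  proof (rule ccontr)
    assume "\<not> 0 < \<eta> $ i"
    then have "\<eta> $ i = 0" using \<eta>nn[of i] by simp
    from metzler_nonneg_at_zero[OF metzler \<eta>nn this] show False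
      using \<open>\<eta> $ i = 0\<close> unfolding \<eta> by simp
  qed
  have "s0 = 0"
  proof (rule ccontr)
    assume "s0 \<noteq> 0"
    define s' where "s' = max 0 (s0 - t)"
    have "(A *v \<eta>) $ i < s' * \<eta> $ i" for i
      using small[of "s0 - s'" i] \<eta>nn[of i] unfolding \<eta> by (simp add: algebra_simps s'_def)
    then have "s' \<in> S" unfolding S_def using \<eta>pos by (auto simp: s'_def)
    from cInf_lower[OF this bdd] show False
      using t s0 \<open>s0 \<noteq> 0\<close> by (auto simp: s0_def[symmetric] s'_def)
  qed
  with \<eta> \<eta>pos show ?thesis by (intro exI[of _ \<eta>]) simp
qed

text \<open>The maximum in the definition of \<open>eta\<close> is meaningful only for a finite set. The eigenvalues are the roots of the
characteristic polynomial, realised here as the determinant of a matrix of polynomials; it is not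
zero because no number above the operator bound is an eigenvalue.\<close>

lemma finite_cspec:
  fixes A :: "real ^ 's::finite ^ 's"
  shows "finite (cspec A)"
proof -
  define C :: "complex poly ^ 's ^ 's"
    where "C = (\<chi> i j. [: complex_of_real (A $ i $ j), if i = j then -1 else 0 :])"
  define D where "D x = map_matrix complex_of_real A - mat x" for x :: complex
  have Dv: "D x *v v = map_matrix complex_of_real A *v v - x *s v" for x v
    unfolding D_def matrix_vector_mult_diff_rdistrib
    by (simp add: vec_eq_iff matrix_vector_mult_def mat_def if_distrib if_distribR cong: if_cong)
  have pd: "poly (det C) x = det (D x)" for x
    unfolding det_def poly_sum poly_mult poly_prod
    by (intro sum.cong arg_cong2[where f = "(*)"] prod.cong) (auto simp: C_def D_def mat_def)
  have ker: "det (D x) = 0 \<longleftrightarrow> x \<in> cspec A" for x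
  proof -
    have "det (D x) \<noteq> 0 \<longleftrightarrow> (\<forall>v. D x *v v = 0 \<longrightarrow> v = 0)"
      by (simp add: invertible_det_nz[symmetric] invertible_left_inverse matrix_left_invertible_ker)
    then show ?thesis unfolding cspec_def Dv by auto
  qed
  obtain b where b: "\<And>v. norm (map_matrix complex_of_real A *v v) \<le> norm v * b"
    using bounded_linear.bounded[of "(*v) (map_matrix complex_of_real A)"]
    by (metis linear_conv_bounded_linear matrix_vector_mul_linear)
  have "complex_of_real (\<bar>b\<bar> + 1) \<notin> cspec A"
  proof
    assume "complex_of_real (\<bar>b\<bar> + 1) \<in> cspec A"
    then obtain v where v: "v \<noteq> 0" "map_matrix complex_of_real A *v v = complex_of_real (\<bar>b\<bar> + 1) *s v"
      unfolding cspec_def by auto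
    have "norm (complex_of_real (\<bar>b\<bar> + 1) *s v) = (\<bar>b\<bar> + 1) * norm v"
      by (simp add: norm_vec_def L2_set_right_distrib[symmetric] norm_mult del: of_real_add)
    then show False using b[of v] v by (simp add: algebra_simps) (smt (verit) mult_right_mono norm_ge_zero zero_less_norm_iff)
  qed
  then have "poly (det C) (complex_of_real (\<bar>b\<bar> + 1)) \<noteq> 0" by (simp only: pd ker not_False_eq_True)
  then have "det C \<noteq> 0" by (metis poly_0)
  then have "finite {x. poly (det C) x = 0}" by (rule poly_roots_finite)
  then show ?thesis by (simp add: pd ker)
qed

lemma real_eigenvalue_in_cspec:
  fixes A :: "real ^ 's::finite ^ 's"
  assumes "A *v v = s *\<^sub>R v" "v \<noteq> 0"
  shows "complex_of_real s \<in> cspec A"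
proof -
  define V where "V = (\<chi> i. complex_of_real (v $ i))"
  have "(\<Sum>j\<in>UNIV. A $ i $ j * v $ j) = s * v $ i" for i
    using arg_cong[OF assms(1), of "\<lambda>x. x $ i"] by (simp add: matrix_vector_mult_def)
  then have "(\<Sum>j\<in>UNIV. complex_of_real (A $ i $ j) * complex_of_real (v $ j)) = complex_of_real (s * v $ i)" for i
    by (metis (no_types, lifting) of_real_mult of_real_sum sum.cong)
  then have "map_matrix complex_of_real A *v V = complex_of_real s *s V"
    by (simp add: vec_eq_iff V_def matrix_vector_mult_def map_matrix_def)
  moreover have "V \<noteq> 0" using assms(2) by (auto simp: vec_eq_iff V_def)
  ultimately show ?thesis unfolding cspec_def by auto
qed

text \<open>From \<open>\<Gamma>w = 0\<close> the carre du champ \<open>\<Sum>\<^sub>j \<gamma>\<^sub>i\<^sub>j(w\<^sub>j - w\<^sub>i)\<^sup>2\<close> equals \<open>(\<Gamma>w\<^sup>2)\<^sub>i\<close>, whose \<open>\<pi>\<close>-average vanishes.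
Hence \<open>w\<close> is constant along every transition. If \<open>w\<close> is not zero, \<open>\<pi>\<^sub>iw\<^sub>i\<close> can be normalised to a stationary
distribution, and uniqueness of \<open>\<pi>\<close> forces \<open>w\<close> to be constant.\<close>

lemma irreducible_kernel:
  fixes \<Gamma> :: "real ^ 's::finite ^ 's"
  assumes gen: "generator_matrix \<Gamma>" and irr: "irreducible_stationary \<Gamma> \<pi>"
    and w: "\<Gamma> *v w = 0" and nn: "\<And>i. 0 \<le> w $ i"
  shows "w $ i = w $ j"
proof -
  have pos: "0 < \<pi> $ i" for i using irr unfolding irreducible_stationary_def by blast
  have \<pi>: "\<pi> v* \<Gamma> = 0" using irr unfolding irreducible_stationary_def by blast
  have \<pi>': "(\<Sum>i\<in>UNIV. \<pi> $ i * \<Gamma> $ i $ j) = 0" for j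
    using arg_cong[OF \<pi>, of "\<lambda>x. x $ j"] by (simp add: vector_matrix_mult_def mult.commute)
  have off: "0 \<le> \<Gamma> $ i $ j" if "i \<noteq> j" for i j using gen that unfolding generator_matrix_def by blast
  have row: "(\<Sum>j\<in>UNIV. \<Gamma> $ i $ j) = 0" for i
    using gen by (subst sum.remove[of _ i]) (auto simp: generator_matrix_def)
  have w': "(\<Sum>j\<in>UNIV. \<Gamma> $ i $ j * w $ j) = 0" for i
    using arg_cong[OF w, of "\<lambda>x. x $ i"] by (simp add: matrix_vector_mult_def)
  define D where "D i j = \<Gamma> $ i $ j * (w $ j - w $ i)\<^sup>2" for i j
  have D0: "0 \<le> D i j" for i j
    unfolding D_def using off[of i j] by (cases "i = j") auto
  have Dsum: "(\<Sum>j\<in>UNIV. D i j) = (\<Sum>j\<in>UNIV. \<Gamma> $ i $ j * (w $ j)\<^sup>2)" for i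
  proof -
    have "(\<Sum>j\<in>UNIV. D i j) = (\<Sum>j\<in>UNIV. \<Gamma> $ i $ j * (w $ j)\<^sup>2)
        - 2 * w $ i * (\<Sum>j\<in>UNIV. \<Gamma> $ i $ j * w $ j) + (w $ i)\<^sup>2 * (\<Sum>j\<in>UNIV. \<Gamma> $ i $ j)"
      unfolding D_def sum_distrib_left sum_subtractf[symmetric] sum.distrib[symmetric]
      by (rule sum.cong) (auto simp: power2_eq_square algebra_simps)
    then show ?thesis using w' row by simp
  qed
  have "(\<Sum>i\<in>UNIV. \<pi> $ i * (\<Sum>j\<in>UNIV. D i j)) = (\<Sum>i\<in>UNIV. \<Sum>j\<in>UNIV. \<pi> $ i * \<Gamma> $ i $ j * (w $ j)\<^sup>2)"
    unfolding Dsum by (simp add: sum_distrib_left mult.assoc)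
  also have "\<dots> = (\<Sum>j\<in>UNIV. (\<Sum>i\<in>UNIV. \<pi> $ i * \<Gamma> $ i $ j) * (w $ j)\<^sup>2)"
    by (subst sum.swap) (simp add: sum_distrib_right)
  also have "\<dots> = 0" unfolding \<pi>' by simp
  finally have "\<forall>i\<in>UNIV. \<pi> $ i * (\<Sum>j\<in>UNIV. D i j) = 0"
    by (subst (asm) sum_nonneg_eq_0_iff)
      (auto intro!: mult_nonneg_nonneg sum_nonneg D0 less_imp_le[OF pos])
  then have "(\<Sum>j\<in>UNIV. D i j) = 0" for i
    by (metis UNIV_I less_irrefl mult_eq_0_iff pos)
  then have "\<forall>j\<in>UNIV. D i j = 0" for i
    by (subst (asm) sum_nonneg_eq_0_iff) (auto intro: D0)
  then have "D i j = 0" for i j by blast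
  then have eq: "\<Gamma> $ i $ j * w $ i = \<Gamma> $ i $ j * w $ j" for i j
    unfolding D_def by (metis eq_iff_diff_eq_0 mult_eq_0_iff zero_eq_power2)
  show ?thesis
  proof (cases "\<forall>i. w $ i = 0")
    case True then show ?thesis by simp
  next
    case False
    then obtain k where k: "0 < w $ k" using nn by (metis order_le_less)
    define c where "c = (\<Sum>i\<in>UNIV. \<pi> $ i * w $ i)"
    have c: "0 < c"
      unfolding c_def by (rule sum_pos2[of _ k]) (auto intro!: mult_nonneg_nonneg nn less_imp_le[OF pos] mult_pos_pos k pos)
    define q where "q = (\<chi> i. \<pi> $ i * w $ i / c)"
    have "(q v* \<Gamma>) $ j = 0" for j
    proof -
      have "(q v* \<Gamma>) $ j = (\<Sum>i\<in>UNIV. \<pi> $ i * (\<Gamma> $ i $ j * w $ i)) / c"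
        by (simp add: vector_matrix_mult_def q_def sum_divide_distrib algebra_simps)
      also have "\<dots> = (\<Sum>i\<in>UNIV. \<pi> $ i * (\<Gamma> $ i $ j * w $ j)) / c"
        by (intro arg_cong2[where f = "(/)"] sum.cong refl arg_cong2[where f = "(*)"] eq)
      also have "\<dots> = (\<Sum>i\<in>UNIV. \<pi> $ i * \<Gamma> $ i $ j) * w $ j / c"
        by (simp add: sum_distrib_right mult.assoc)
      finally show ?thesis unfolding \<pi>' by simp
    qed
    then have "q v* \<Gamma> = 0" by (simp add: vec_eq_iff)
    moreover have "(\<Sum>i\<in>UNIV. q $ i) = 1"
      using c by (simp add: q_def sum_divide_distrib[symmetric] c_def[symmetric])
    ultimately have "q = \<pi>" using irr unfolding irreducible_stationary_def by blast
    then have pw: "\<pi> $ i * w $ i / c = \<pi> $ i" for i by (metis q_def vec_lambda_beta)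
    have "w $ i = c" for i using pw[of i] c pos[of i] by (auto simp: field_simps)
    then show ?thesis by simp
  qed
qed

text \<open>The positive part \<open>w\<close> of \<open>v\<close> satisfies \<open>\<Gamma>w \<ge> -cw \<ge> 0\<close>; averaging against \<open>\<pi>\<close> turns both into
equalities, so \<open>w\<close> is constant and vanishes at \<open>k\<close>.\<close>

lemma nonpos_potential_kernel:
  fixes \<Gamma> :: "real ^ 's::finite ^ 's"
  assumes gen: "generator_matrix \<Gamma>" and irr: "irreducible_stationary \<Gamma> \<pi>"
    and c: "\<And>i. c i \<le> 0" and ck: "c k < 0"
    and v: "\<And>i. (\<Gamma> *v v) $ i + c i * v $ i = 0"
  shows "v $ i \<le> 0"
proof -
  define w where "w = (\<chi> i. max 0 (v $ i))"
  have pos: "0 < \<pi> $ i" for i using irr unfolding irreducible_stationary_def by blast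
  have \<pi>: "\<pi> v* \<Gamma> = 0" using irr unfolding irreducible_stationary_def by blast
  have off: "0 \<le> \<Gamma> $ i $ j" if "i \<noteq> j" for i j using gen that unfolding generator_matrix_def by blast
  have nn: "0 \<le> w $ i" for i by (simp add: w_def)
  have dom: "- c i * w $ i \<le> (\<Gamma> *v w) $ i" for i
  proof (cases "0 \<le> v $ i")
    case True
    have "0 \<le> (\<Gamma> *v (w - v)) $ i"
      by (rule metzler_nonneg_at_zero[OF off]) (use True in \<open>auto simp: w_def\<close>)
    then show ?thesis using True v[of i] by (simp add: matrix_vector_mult_diff_distrib w_def algebra_simps)
  next
    case False
    have "0 \<le> (\<Gamma> *v w) $ i"
      by (rule metzler_nonneg_at_zero[OF off nn]) (use False in \<open>auto simp: w_def\<close>)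
    then show ?thesis using False by (simp add: w_def)
  qed
  have ge: "0 \<le> - c i * w $ i" for i using c[of i] nn[of i] by (simp add: mult_nonpos_nonneg)
  have "(\<Sum>i\<in>UNIV. \<pi> $ i * (\<Gamma> *v w) $ i) = (\<pi> v* \<Gamma>) \<bullet> w"
    unfolding dot_lmul_matrix by (simp add: inner_vec_def)
  also have "\<dots> = 0" unfolding \<pi> by simp
  finally have "\<forall>i\<in>UNIV. \<pi> $ i * (\<Gamma> *v w) $ i = 0"
    by (subst (asm) sum_nonneg_eq_0_iff)
      (auto intro!: mult_nonneg_nonneg less_imp_le[OF pos] order_trans[OF ge dom])
  then have Gw: "(\<Gamma> *v w) $ i = 0" for i
    by (metis UNIV_I less_irrefl mult_eq_0_iff pos)
  then have "c k * w $ k = 0" using dom[of k] ge[of k] by simp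
  then have "w $ k = 0" using ck by simp
  moreover have "w $ i = w $ k"
    by (rule irreducible_kernel[OF gen irr _ nn]) (simp add: vec_eq_iff Gw)
  ultimately show ?thesis by (simp add: w_def)
qed

text \<open>No \<open>s \<ge> 0\<close> is an eigenvalue of \<open>\<Gamma>\<^sub>p\<close>: for positive \<open>max \<alpha>\<close> by the definition of \<open>p\<^sup>*\<close>, and for
\<open>\<alpha> \<le> 0\<close> because \<open>\<Gamma>\<close> perturbed by a nonpositive, nonzero potential has trivial kernel.\<close>

lemma exists_lyapunov_weights:
  fixes \<Gamma> :: "real ^ 's::finite ^ 's"
  assumes gen: "generator_matrix \<Gamma>" and irr: "irreducible_stationary \<Gamma> \<pi>"
    and neg: "(\<Sum>i\<in>UNIV. \<pi> $ i * \<alpha> $ i) < 0"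
    and pstar: "is_p_star \<Gamma> \<alpha> pstar" and p: "0 < p" "ereal p < pstar"
  shows "\<exists>\<xi>. (\<forall>i. 0 < \<xi> $ i) \<and> (\<forall>i. (\<Gamma> *v \<xi>) $ i + p / 2 * \<alpha> $ i * \<xi> $ i < 0)"
proof -
  let ?A = "\<Gamma>\<^sub>p \<Gamma> p \<alpha>"
  have Av: "(?A *v v) $ i = (\<Gamma> *v v) $ i + p / 2 * \<alpha> $ i * v $ i" for v i
    unfolding \<Gamma>\<^sub>p_def matrix_vector_mult_add_rdistrib scaleR_matrix_vector_assoc[symmetric]
    by (simp add: matrix_vector_mult_def if_distrib if_distribR cong: if_cong)
  have off: "0 \<le> \<Gamma> $ i $ j" if "i \<noteq> j" for i j using gen that unfolding generator_matrix_def by blast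
  have pos: "0 < \<pi> $ i" for i using irr unfolding irreducible_stationary_def by blast
  have "\<exists>\<xi>. (\<forall>i. 0 < \<xi> $ i) \<and> (\<forall>i. (?A *v \<xi>) $ i < 0)"
  proof (rule metzler_strict_subsolution)
    fix i j :: 's assume "i \<noteq> j"
    then show "0 \<le> ?A $ i $ j" using off by (simp add: \<Gamma>\<^sub>p_def)
  next
    fix s :: real and v assume s: "0 \<le> s" and v: "?A *v v = s *\<^sub>R v"
    show "v = 0"
    proof (cases "Max (range (\<lambda>i. \<alpha> $ i)) \<le> 0")
      case False
      then have "0 < eta \<Gamma> p \<alpha>" using pstar p unfolding is_p_star_def by auto
      show "v = 0"
      proof (rule ccontr)
        assume "v \<noteq> 0"
        then have "Re (complex_of_real s) \<le> Max (Re ` cspec ?A)"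
          using real_eigenvalue_in_cspec[OF v] by (intro Max_ge imageI finite_imageI finite_cspec)
        then show False using \<open>0 < eta \<Gamma> p \<alpha>\<close> s unfolding eta_def by simp
      qed
    next
      case True
      then have \<alpha>: "\<alpha> $ i \<le> 0" for i by simp
      have "\<exists>k. \<alpha> $ k < 0"
      proof (rule ccontr)
        assume "\<nexists>k. \<alpha> $ k < 0"
        then have "0 \<le> (\<Sum>i\<in>UNIV. \<pi> $ i * \<alpha> $ i)"
          by (intro sum_nonneg mult_nonneg_nonneg less_imp_le[OF pos]) (auto simp: not_less)
        then show False using neg by simp
      qed
      then obtain k where k: "\<alpha> $ k < 0" by auto
      define c where "c i = p / 2 * \<alpha> $ i - s" for i
      have c: "c i \<le> 0" for i using \<alpha>[of i] s p mult_nonneg_nonpos[of "p/2" "\<alpha> $ i"] by (simp add: c_def)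
      have ck: "c k < 0" using k s p mult_pos_neg[of "p/2" "\<alpha> $ k"] by (simp add: c_def)
      have e: "(\<Gamma> *v v) $ i + c i * v $ i = 0" for i
        using arg_cong[OF v, of "\<lambda>x. x $ i"] unfolding Av by (simp add: c_def algebra_simps)
      have e': "(\<Gamma> *v (- v)) $ i + c i * (- v) $ i = 0" for i
        using e[of i] matrix_vector_mult_diff_distrib[of \<Gamma> 0 v] by simp
      have "v $ i = 0" for i
        using nonpos_potential_kernel[OF gen irr c ck e, of i]
          nonpos_potential_kernel[OF gen irr c ck e', of i] by simp
      then show "v = 0" by (simp add: vec_eq_iff)
    qed
  qed
  then show ?thesis unfolding Av .
qed

section \<open>Third-order expansion of a power, symmetrised\<close>

lemma quartic_dominates:
  fixes x :: real assumes "1/2 \<le> \<bar>x\<bar>" 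
  shows "\<bar>x\<bar> \<le> 8 * x ^ 4" "x\<^sup>2 \<le> 4 * x ^ 4" "\<bar>x ^ 3\<bar> \<le> 2 * x ^ 4"
proof -
  define t where "t = \<bar>x\<bar>"
  have 1: "1 \<le> (2 * t) ^ k" for k using assms by (intro one_le_power) (simp add: t_def)
  have "t ^ k * 1 \<le> t ^ k * (2 * t) ^ (4 - k)" for k by (intro mult_left_mono 1) (auto simp: t_def)
  from this[of 1] this[of 2] this[of 3]
  have "t \<le> 8 * t ^ 4" "t\<^sup>2 \<le> 4 * t ^ 4" "t ^ 3 \<le> 2 * t ^ 4"
    by (simp_all add: eval_nat_numeral algebra_simps)
  then show "\<bar>x\<bar> \<le> 8 * x ^ 4" "x\<^sup>2 \<le> 4 * x ^ 4" "\<bar>x ^ 3\<bar> \<le> 2 * x ^ 4"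
    unfolding power_abs by (simp_all add: t_def)
qed

text \<open>Near \<open>0\<close> this is Taylor's formula of order four. Elsewhere the quartic part of the remainder dominates the negative
part of the cubic polynomial, and a power of even degree at least \<open>q\<close> dominates \<open>(1 + x)\<^sup>q\<close>. Even
degrees are chosen so that the remainder has a sign and can be averaged over reflections.\<close>

lemma powr_taylor_bound:
  fixes q :: real assumes q: "0 < q"
  shows "\<exists>C\<ge>0. \<exists>N. \<forall>x\<ge>-1. (1 + x) powr q
     \<le> 1 + q * x + q * (q - 1) / 2 * x\<^sup>2 + q * (q - 1) * (q - 2) / 6 * x ^ 3 + C * (x ^ 4 + x ^ (2 * N + 4))"
proof -
  define a2 a3 a4 where "a2 = q * (q - 1)" and "a3 = q * (q - 1) * (q - 2)"
    and "a4 = q * (q - 1) * (q - 2) * (q - 3)"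
  define T where "T x = 1 + q * x + a2 / 2 * x\<^sup>2 + a3 / 6 * x ^ 3" for x
  define N where "N = nat \<lceil>q\<rceil>"
  define C1 where "C1 = \<bar>a4\<bar> / 24 * 2 powr \<bar>q - 4\<bar>"
  define C2 where "C2 = 8 * q + 2 * \<bar>a2\<bar> + \<bar>a3\<bar> / 3"
  define C3 where "C3 = 3 powr q * 2 ^ (2 * N + 4)"
  have C: "0 \<le> C1" "0 \<le> C2" "0 \<le> C3" using q by (auto simp: C1_def C2_def C3_def)
  have near: "(1 + x) powr q \<le> T x + C1 * x ^ 4" if x: "\<bar>x\<bar> \<le> 1/2" for x
  proof (cases "x = 0")
    case True then show ?thesis by (simp add: T_def)
  next
    case False
    define D where "D m t = (\<Prod>j<m. q - real j) * (1 + t) powr (q - real m)" for m t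
    have "\<exists>t. (if x < 0 then x < t \<and> t < 0 else 0 < t \<and> t < x) \<and>
        (1 + x) powr q = (\<Sum>m<4. D m 0 / fact m * (x - 0) ^ m) + D 4 t / fact 4 * (x - 0) ^ 4"
    proof (rule Taylor[of 4 D _ "-1/2" "1/2"])
      show "D 0 = (\<lambda>t. (1 + t) powr q)" by (simp add: D_def fun_eq_iff)
      show "\<forall>m t. m < 4 \<and> - 1 / 2 \<le> t \<and> t \<le> 1 / 2 \<longrightarrow> (D m has_real_derivative D (Suc m) t) (at t)"
        unfolding D_def by (auto intro!: derivative_eq_intros simp: algebra_simps)
    qed (use x False in auto)
    then obtain t where t': "if x < 0 then x < t \<and> t < 0 else 0 < t \<and> t < x"
        and eq: "(1 + x) powr q = (\<Sum>m<4. D m 0 / fact m * x ^ m) + D 4 t / fact 4 * x ^ 4"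
      by auto
    have t: "\<bar>t\<bar> \<le> 1/2" using t' x by (auto split: if_splits)
    have "(\<Sum>m<4. D m 0 / fact m * x ^ m) = T x"
      by (simp add: D_def T_def a2_def a3_def eval_nat_numeral fact_numeral)
    moreover have "D 4 t / fact 4 * x ^ 4 \<le> C1 * x ^ 4"
    proof (rule mult_right_mono)
      have D4: "D 4 t = a4 * (1 + t) powr (q - 4)"
        by (simp add: D_def a4_def eval_nat_numeral)
      have "(1 + t) powr (q - 4) \<le> 2 powr \<bar>q - 4\<bar>"
      proof -
        have "- ln 2 \<le> ln (1 + t)"
          using t ln_mono[of "1/2" "1 + t"] by (simp add: ln_div)
        moreover have "ln (1 + t) \<le> ln 2" using t by simp
        ultimately have "\<bar>ln (1 + t)\<bar> \<le> ln 2" by simp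
        then have "\<bar>q - 4\<bar> * \<bar>ln (1 + t)\<bar> \<le> \<bar>q - 4\<bar> * ln 2" by (intro mult_left_mono) auto
        then have "(q - 4) * ln (1 + t) \<le> \<bar>q - 4\<bar> * ln 2"
          by (metis abs_ge_self abs_mult order_trans)
        then show ?thesis using t by (simp add: powr_def)
      qed
      then have "\<bar>a4\<bar> * (1 + t) powr (q - 4) \<le> \<bar>a4\<bar> * 2 powr \<bar>q - 4\<bar>" by (intro mult_left_mono) auto
      moreover have "a4 * (1 + t) powr (q - 4) \<le> \<bar>a4\<bar> * (1 + t) powr (q - 4)" by (intro mult_right_mono) auto
      ultimately show "D 4 t / fact 4 \<le> C1" unfolding D4 C1_def by (simp add: fact_numeral)
    qed simp
    ultimately show ?thesis unfolding eq by simp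
  qed
  have far: "(1 + x) powr q \<le> T x + C2 * x ^ 4 + C3 * x ^ (2 * N + 4)" if x: "-1 \<le> x" "1/2 < \<bar>x\<bar>" for x
  proof -
    note Q = quartic_dominates[of x]
    have "- \<bar>q * x\<bar> \<le> q * x" "- \<bar>a2 / 2 * x\<^sup>2\<bar> \<le> a2 / 2 * x\<^sup>2" "- \<bar>a3 / 6 * x ^ 3\<bar> \<le> a3 / 6 * x ^ 3" by auto
    moreover have "q * \<bar>x\<bar> \<le> q * (8 * x ^ 4)" "\<bar>a2\<bar> / 2 * x\<^sup>2 \<le> \<bar>a2\<bar> / 2 * (4 * x ^ 4)"
      "\<bar>a3\<bar> / 6 * \<bar>x ^ 3\<bar> \<le> \<bar>a3\<bar> / 6 * (2 * x ^ 4)"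
      by (intro mult_left_mono Q; use x q in simp)+
    then have "\<bar>q * x\<bar> \<le> q * (8 * x ^ 4)" "\<bar>a2 / 2 * x\<^sup>2\<bar> \<le> \<bar>a2\<bar> / 2 * (4 * x ^ 4)"
      "\<bar>a3 / 6 * x ^ 3\<bar> \<le> \<bar>a3\<bar> / 6 * (2 * x ^ 4)"
      using q by (simp_all add: abs_mult)
    ultimately have 1: "0 \<le> T x + C2 * x ^ 4"
      unfolding T_def C2_def distrib_right by (simp add: algebra_simps)
    have "(1 + x) powr q \<le> (3 * \<bar>x\<bar>) powr q"
      using x q by (intro powr_mono2) auto
    also have "\<dots> \<le> 3 powr q * (2 * \<bar>x\<bar>) powr q"
      using q by (subst powr_mult) (auto intro!: mult_left_mono powr_mono2)
    also have "\<dots> \<le> 3 powr q * (2 * \<bar>x\<bar>) powr real (2 * N + 4)"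
      using x q by (intro mult_left_mono powr_mono) (auto simp: N_def, linarith)
    also have "\<dots> = 3 powr q * (2 * \<bar>x\<bar>) ^ (2 * N + 4)" 
      using x by (subst powr_realpow) auto
    also have "\<dots> = C3 * x ^ (2 * N + 4)" unfolding C3_def power_mult_distrib
      by (simp add: power_even_abs)
    finally show ?thesis using 1 by simp
  qed
  have "(1 + x) powr q \<le> T x + (C1 + C2 + C3) * (x ^ 4 + x ^ (2 * N + 4))" if "-1 \<le> x" for x
  proof -
    have nn: "0 \<le> x ^ 4" "0 \<le> x ^ (2 * N + 4)" by (simp_all add: zero_le_even_power)
    have "0 \<le> C1 * x ^ 4" "0 \<le> C2 * x ^ 4" "0 \<le> C3 * x ^ 4"
      "0 \<le> C1 * x ^ (2 * N + 4)" "0 \<le> C2 * x ^ (2 * N + 4)" "0 \<le> C3 * x ^ (2 * N + 4)"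
      using C nn by (simp_all only: mult_nonneg_nonneg)
    then show ?thesis using near[of x] far[of x] that
      by (cases "\<bar>x\<bar> \<le> 1/2") (auto simp: algebra_simps)
  qed
  then show ?thesis unfolding T_def a2_def a3_def using C by (intro exI[of _ "C1 + C2 + C3"] conjI exI[of _ N]) auto
qed

text \<open>Here \<open>e\<close> and \<open>w\<close> stand for the parts of the relative increment that are even and odd in the noise, and \<open>s\<close>
for their common scale: \<open>e\<close> has size \<open>s\<close> and \<open>w\<close> only \<open>s\<^sup>1\<^sup>/\<^sup>2\<close>. In the average over \<open>\<plusminus>w\<close> the cubic term becomes
\<open>e\<^sup>3 + 3ew\<^sup>2\<close>, of size \<open>s\<^sup>2\<close>, although \<open>w\<^sup>3\<close> alone has size \<open>s\<^sup>3\<^sup>/\<^sup>2\<close>.\<close>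

lemma symmetrised_powr_bound:
  fixes q c :: real assumes q: "0 < q" and c: "1 \<le> c"
  shows "\<exists>C\<ge>0. \<exists>N. \<forall>e w s. 0 \<le> s \<longrightarrow> \<bar>e\<bar> \<le> c * s \<longrightarrow> w\<^sup>2 \<le> c * s \<longrightarrow> -1 \<le> e + w \<longrightarrow> -1 \<le> e - w \<longrightarrow>
     ((1 + (e + w)) powr q + (1 + (e - w)) powr q) / 2
       \<le> 1 + q * e + q * (q - 1) / 2 * w\<^sup>2 + C * (s\<^sup>2 * (1 + s) ^ N)"
proof -
  obtain C N where C: "0 \<le> C" and *: "\<And>x. -1 \<le> x \<Longrightarrow> (1 + x) powr q
     \<le> 1 + q * x + q * (q - 1) / 2 * x\<^sup>2 + q * (q - 1) * (q - 2) / 6 * x ^ 3 + C * (x ^ 4 + x ^ (2 * N + 4))"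
    using powr_taylor_bound[OF q] by metis
  define a2 a3 where "a2 = q * (q - 1) / 2" and "a3 = q * (q - 1) * (q - 2) / 6"
  define L where "L = 2 * N + 4"
  define C' where "C' = \<bar>a2\<bar> * c\<^sup>2 + 4 * \<bar>a3\<bar> * c ^ 3 + C * (16 * c ^ 4 + (2 * c) ^ L)"
  have "((1 + (e + w)) powr q + (1 + (e - w)) powr q) / 2
       \<le> 1 + q * e + a2 * w\<^sup>2 + C' * (s\<^sup>2 * (1 + s) ^ L)"
    if s: "0 \<le> s" and e: "\<bar>e\<bar> \<le> c * s" and w: "w\<^sup>2 \<le> c * s" and lo: "-1 \<le> e + w" "-1 \<le> e - w" for e w s
  proof -
    define P where "P = s\<^sup>2 * (1 + s) ^ L"
    have L: "L \<ge> 4" by (simp add: L_def)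
    have P: "s ^ k \<le> P" if "2 \<le> k" "k \<le> L + 2" for k
    proof -
      have "s ^ k = s ^ (2 + (k - 2))" using that by (simp only: le_add_diff_inverse)
      also have "\<dots> = s\<^sup>2 * s ^ (k - 2)" by (rule power_add)
      also have "\<dots> \<le> s\<^sup>2 * (1 + s) ^ L"
        using that s by (intro mult_left_mono order_trans[OF power_mono power_increasing]) auto
      finally show ?thesis by (simp add: P_def)
    qed
    have cs: "0 \<le> c * s" using c s by simp
    have e2: "e\<^sup>2 \<le> c\<^sup>2 * P"
    proof -
      have "e\<^sup>2 \<le> (c * s)\<^sup>2" using power_mono[OF e, of 2] by simp
      also have "\<dots> \<le> c\<^sup>2 * P" unfolding power_mult_distrib using P[of 2] by (intro mult_left_mono) auto
      finally show ?thesis .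
    qed
    have e3: "\<bar>e ^ 3 + 3 * e * w\<^sup>2\<bar> \<le> 4 * c ^ 3 * P"
    proof -
      have "\<bar>e ^ 3\<bar> \<le> (c * s) ^ 3" using power_mono[OF e, of 3] by (simp add: power_abs)
      also have "\<dots> \<le> c ^ 3 * P" unfolding power_mult_distrib using P[of 3] c L by (intro mult_left_mono) auto
      finally have 1: "\<bar>e ^ 3\<bar> \<le> c ^ 3 * P" .
      have "\<bar>e * w\<^sup>2\<bar> \<le> (c * s) * (c * s)" unfolding abs_mult using e w cs by (intro mult_mono) auto
      also have "\<dots> = c\<^sup>2 * s\<^sup>2" by (simp add: power2_eq_square)
      also have "\<dots> \<le> c ^ 3 * P" using P[of 2] c by (intro mult_mono power_increasing) auto
      finally show ?thesis using 1 by simp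
    qed
    have even: "(e + w) ^ (2 * k) + (e - w) ^ (2 * k) \<le> 2 * ((2 * c) ^ (2 * k) * P)" if k: "2 \<le> k" "2 * k \<le> L" for k
    proof -
      have sq: "x ^ (2 * k) \<le> (2 * c) ^ (2 * k) * P" if x: "x\<^sup>2 \<le> 2 * e\<^sup>2 + 2 * w\<^sup>2" for x
      proof -
        have "e\<^sup>2 \<le> c\<^sup>2 * s\<^sup>2" using power_mono[OF e, of 2] by (simp add: power_mult_distrib)
        moreover have "c * s \<le> c\<^sup>2 * s"
          using c s by (intro mult_right_mono) (auto simp: power2_eq_square)
        moreover have "0 \<le> c\<^sup>2 * s" "0 \<le> c\<^sup>2 * s\<^sup>2" using s by auto
        moreover have "(2 * c)\<^sup>2 * (s * (1 + s)) = 4 * (c\<^sup>2 * s) + 4 * (c\<^sup>2 * s\<^sup>2)"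
          by (simp add: power2_eq_square algebra_simps)
        ultimately have "x\<^sup>2 \<le> (2 * c)\<^sup>2 * (s * (1 + s))" using x w by linarith
        then have "(x\<^sup>2) ^ k \<le> ((2 * c)\<^sup>2 * (s * (1 + s))) ^ k" by (intro power_mono) auto
        also have "\<dots> = (2 * c) ^ (2 * k) * (s ^ k * (1 + s) ^ k)"
          by (simp add: power_mult_distrib power_mult)
        also have "s ^ k = s ^ (2 + (k - 2))" using k by (simp only: le_add_diff_inverse)
        also have "s ^ (2 + (k - 2)) * (1 + s) ^ k = s\<^sup>2 * (s ^ (k - 2) * (1 + s) ^ k)"
          unfolding power_add by (simp only: mult.assoc)
        also have "(2 * c) ^ (2 * k) * \<dots> \<le> (2 * c) ^ (2 * k) * P"
        proof -
          have "s ^ (k - 2) * (1 + s) ^ k \<le> (1 + s) ^ (k - 2) * (1 + s) ^ k"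
            using s by (intro mult_right_mono power_mono) auto
          also have "\<dots> \<le> (1 + s) ^ L"
            unfolding power_add[symmetric] using s k by (intro power_increasing) auto
          finally show ?thesis unfolding P_def using c by (intro mult_left_mono) auto
        qed
        finally show ?thesis by (simp add: power_mult)
      qed
      have "(e + w)\<^sup>2 \<le> 2 * e\<^sup>2 + 2 * w\<^sup>2" "(e - w)\<^sup>2 \<le> 2 * e\<^sup>2 + 2 * w\<^sup>2"
        using sum_squares_bound[of e w] sum_squares_bound[of e "-w"] by (simp_all add: power2_sum power2_diff)
      from sq[OF this(1)] sq[OF this(2)] show ?thesis by simp
    qed
    have e4: "(e + w) ^ 4 + (e - w) ^ 4 \<le> 2 * (16 * c ^ 4 * P)"
      using even[of 2] L by (simp add: power_mult_distrib)
    have eL: "(e + w) ^ L + (e - w) ^ L \<le> 2 * ((2 * c) ^ L * P)"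
    proof -
      have "2 * (N + 2) = L" by (simp add: L_def)
      then show ?thesis using even[of "N + 2"] by simp
    qed
    have "((1 + (e + w)) powr q + (1 + (e - w)) powr q) / 2 \<le>
       1 + q * e + a2 * (e\<^sup>2 + w\<^sup>2) + a3 * (e ^ 3 + 3 * e * w\<^sup>2) +
       C * (((e + w) ^ 4 + (e - w) ^ 4) + ((e + w) ^ L + (e - w) ^ L)) / 2"
    proof -
      have avg: "(A + B) / 2 \<le> 1 + z1 + z2 + z3 + z4"
        if "x1 + y1 = 2 * z1" "x2 + y2 = 2 * z2" "x3 + y3 = 2 * z3" "z4 = (x4 + y4) / 2"
          "A \<le> 1 + x1 + x2 + x3 + x4" "B \<le> 1 + y1 + y2 + y3 + y4"
        for A B x1 x2 x3 x4 y1 y2 y3 y4 z1 z2 z3 z4 :: real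
        using that by simp
      have "q * (e + w) + q * (e - w) = 2 * (q * e)" by (simp add: algebra_simps)
      moreover have "a2 * (e + w)\<^sup>2 + a2 * (e - w)\<^sup>2 = 2 * (a2 * (e\<^sup>2 + w\<^sup>2))"
        by (simp add: power2_eq_square algebra_simps)
      moreover have "a3 * (e + w) ^ 3 + a3 * (e - w) ^ 3 = 2 * (a3 * (e ^ 3 + 3 * e * w\<^sup>2))"
        by (simp add: power2_eq_square power3_eq_cube algebra_simps)
      moreover have "C * (((e + w) ^ 4 + (e - w) ^ 4) + ((e + w) ^ L + (e - w) ^ L)) / 2
          = (C * ((e + w) ^ 4 + (e + w) ^ L) + C * ((e - w) ^ 4 + (e - w) ^ L)) / 2"
        by (simp add: algebra_simps)
      ultimately show ?thesis
        using *[OF lo(1)] *[OF lo(2)] unfolding a2_def[symmetric] a3_def[symmetric] L_def[symmetric]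
        by (rule avg)
    qed
    also have "\<dots> \<le> 1 + q * e + a2 * w\<^sup>2 + C' * P"
    proof -
      have "a2 * e\<^sup>2 \<le> \<bar>a2\<bar> * e\<^sup>2" by (intro mult_right_mono) auto
      also have "\<dots> \<le> \<bar>a2\<bar> * (c\<^sup>2 * P)" using e2 by (intro mult_left_mono) auto
      finally have 1: "a2 * e\<^sup>2 \<le> \<bar>a2\<bar> * (c\<^sup>2 * P)" .
      have "a3 * (e ^ 3 + 3 * e * w\<^sup>2) \<le> \<bar>a3\<bar> * \<bar>e ^ 3 + 3 * e * w\<^sup>2\<bar>"
        by (metis abs_ge_self abs_mult)
      also have "\<dots> \<le> \<bar>a3\<bar> * (4 * c ^ 3 * P)" using e3 by (intro mult_left_mono) auto
      finally have 2: "a3 * (e ^ 3 + 3 * e * w\<^sup>2) \<le> \<bar>a3\<bar> * (4 * c ^ 3 * P)" .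
      have half: "(x + y) / 2 \<le> a + b" if "x \<le> 2 * a" "y \<le> 2 * b" for x y a b :: real
        using that by simp
      have "(((e + w) ^ 4 + (e - w) ^ 4) + ((e + w) ^ L + (e - w) ^ L)) / 2 \<le> 16 * c ^ 4 * P + (2 * c) ^ L * P"
        by (rule half[OF e4 eL])
      from mult_left_mono[OF this C]
      have 3: "C * (((e + w) ^ 4 + (e - w) ^ 4) + ((e + w) ^ L + (e - w) ^ L)) / 2
        \<le> C * (16 * c ^ 4 * P + (2 * c) ^ L * P)" by simp
      have "C' * P = \<bar>a2\<bar> * (c\<^sup>2 * P) + \<bar>a3\<bar> * (4 * c ^ 3 * P) + C * (16 * c ^ 4 * P + (2 * c) ^ L * P)"
        by (simp add: C'_def algebra_simps)
      moreover have "b + (x + y) + z + v \<le> b + y + (x' + z' + v')"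
        if "x \<le> x'" "z \<le> z'" "v \<le> v'" for b x y z v x' z' v' :: real using that by simp
      note this[OF 1 2 3]
      ultimately show ?thesis by (simp only: distrib_left)
    qed
    finally show ?thesis unfolding P_def .
  qed
  moreover have "0 \<le> C'" unfolding C'_def using C c by (intro add_nonneg_nonneg mult_nonneg_nonneg) auto
  ultimately show ?thesis unfolding a2_def by blast
qed

section \<open>One Euler step, pointwise in the noise\<close>

lemma norm_matrix_vector_le: "norm (A *v x) \<le> norm A * norm x"
  for A :: "real ^ 'd ^ 'n"
proof -
  have "norm (A *v x) \<le> L2_set (\<lambda>i. norm (A $ i) * norm x) UNIV"
    unfolding norm_vec_def[of "A *v x"]
    by (rule L2_set_mono) (auto simp: matrix_vector_mul_component Cauchy_Schwarz_ineq2)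
  also have "\<dots> = norm A * norm x"
    unfolding norm_vec_def[of A] by (simp add: L2_set_left_distrib)
  finally show ?thesis .
qed

abbreviation quad_form :: "real ^ 'n ^ 'n \<Rightarrow> real ^ 'n \<Rightarrow> real"
  where "quad_form Q x \<equiv> x \<bullet> (Q *v x)"

lemma sym_pos_def_commute:
  assumes "sym_pos_def Q"
  shows "x \<bullet> (Q *v y) = y \<bullet> (Q *v x)"
  using assms unfolding sym_pos_def_def
  by (metis dot_lmul_matrix inner_commute transpose_matrix_vector)

lemma sym_pos_def_nonneg: "sym_pos_def Q \<Longrightarrow> 0 \<le> quad_form Q x"
  unfolding sym_pos_def_def by (cases "x = 0") (auto intro: less_imp_le)

lemma quad_form_scaleR: "quad_form Q (c *\<^sub>R x) = c\<^sup>2 * quad_form Q x"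
  by (simp add: matrix_vector_mult_scaleR power2_eq_square)

lemma bilinear_matrix_bound:
  fixes Q :: "real ^ 'n ^ 'n"
  shows "\<bar>x \<bullet> (Q *v y)\<bar> \<le> norm Q * norm x * norm y"
proof -
  have "\<bar>x \<bullet> (Q *v y)\<bar> \<le> norm x * norm (Q *v y)" by (rule Cauchy_Schwarz_ineq2)
  also have "\<dots> \<le> norm x * (norm Q * norm y)" by (intro mult_left_mono norm_matrix_vector_le) simp
  finally show ?thesis by (simp add: ac_simps)
qed

lemma sym_pos_def_coercive:
  fixes Q :: "real ^ 'n ^ 'n"
  assumes Q: "sym_pos_def Q"
  shows "\<exists>c>0. \<forall>x. c * (norm x)\<^sup>2 \<le> quad_form Q x"
proof -
  have "continuous_on (sphere 0 1) (quad_form Q)"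
    by (intro continuous_intros linear_continuous_on matrix_vector_mul_bounded_linear)
  moreover have "axis undefined 1 \<in> sphere (0 :: real ^ 'n) 1" by (simp add: norm_axis_1)
  ultimately obtain x0 where x0: "norm x0 = 1" "\<And>x. norm x = 1 \<Longrightarrow> quad_form Q x0 \<le> quad_form Q x"
    using continuous_attains_inf[of "sphere 0 1" "quad_form Q"] by auto
  have "quad_form Q x0 * (norm x)\<^sup>2 \<le> quad_form Q x" for x
  proof (cases "x = 0")
    case False
    have "quad_form Q x = (norm x)\<^sup>2 * quad_form Q (sgn x)"
      using False quad_form_scaleR[of "norm x" "sgn x" Q] by (simp add: sgn_div_norm)
    then show ?thesis using x0(2)[of "sgn x"] False by (simp add: norm_sgn mult.commute mult_left_mono)
  qed simp
  moreover have "0 < quad_form Q x0" using Q x0(1) unfolding sym_pos_def_def by (metis norm_zero zero_neq_one)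
  ultimately show ?thesis by blast
qed

text \<open>The increment of \<open>1 + x\<^sup>TQx\<close> relative to its value at \<open>y\<close> splits into the even part \<open>e0 + e1\<close> and the
odd part \<open>w0 + w1\<close>. Only \<open>e0\<close> and \<open>w0\<close> contribute to order \<open>\<Delta>\<close>; \<open>e1\<close>, \<open>w0 w1\<close> and \<open>w1\<^sup>2\<close> are quadratic in the
scale \<open>s = h(\<Delta> + |z|\<^sup>2)\<close>, which is why this \<open>s\<close> is the right unit.\<close>

lemma symmetrised_step_bound:
  fixes Q :: "real ^ 'n ^ 'n"
  assumes Q: "sym_pos_def Q" and q: "0 < q" and K: "0 \<le> K"
  shows "\<exists>C\<ge>0. \<exists>N. \<forall>(a :: real ^ 'n) (b :: real ^ 'd ^ 'n) y z h \<Delta>.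
     0 \<le> h \<longrightarrow> 0 \<le> \<Delta> \<longrightarrow> h * \<Delta> \<le> K \<longrightarrow> norm a \<le> h * (1 + norm y) \<longrightarrow> (norm b)\<^sup>2 \<le> h * (1 + norm y)\<^sup>2 \<longrightarrow>
     ((1 + quad_form Q (y + \<Delta> *\<^sub>R a + b *v z)) powr q + (1 + quad_form Q (y + \<Delta> *\<^sub>R a - b *v z)) powr q) / 2
     \<le> (1 + quad_form Q y) powr q *
       (1 + q * (2 * \<Delta> * (y \<bullet> (Q *v a)) + quad_form Q (b *v z)) / (1 + quad_form Q y)
          + 2 * q * (q - 1) * (y \<bullet> (Q *v (b *v z)))\<^sup>2 / (1 + quad_form Q y)\<^sup>2
          + C * ((h * (\<Delta> + (norm z)\<^sup>2))\<^sup>2 * (1 + h * (\<Delta> + (norm z)\<^sup>2)) ^ N))"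
proof -
  obtain c1 where c1: "0 < c1" "\<And>x. c1 * (norm x)\<^sup>2 \<le> quad_form Q x"
    using sym_pos_def_coercive[OF Q] by blast
  define c2 where "c2 = norm Q"
  have c2: "0 \<le> c2" by (simp add: c2_def)
  note bil = bilinear_matrix_bound[of _ Q, folded c2_def]
  define \<kappa> where "\<kappa> = 2 * (1 + 1 / c1)"
  have \<kappa>: "0 \<le> \<kappa>" using c1 by (simp add: \<kappa>_def)
  define k where "k = c2 * \<kappa>"
  have k: "0 \<le> k" using c2 \<kappa> by (simp add: k_def)
  define c where "c = 1 + k * (2 + K) + 8 * k\<^sup>2 * (1 + K\<^sup>2)"
  have c: "1 \<le> c" unfolding c_def using k K by simp
  obtain C N where C: "0 \<le> C" and *: "\<And>e w s. 0 \<le> s \<Longrightarrow> \<bar>e\<bar> \<le> c * s \<Longrightarrow> w\<^sup>2 \<le> c * s \<Longrightarrow>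
       -1 \<le> e + w \<Longrightarrow> -1 \<le> e - w \<Longrightarrow>
     ((1 + (e + w)) powr q + (1 + (e - w)) powr q) / 2
       \<le> 1 + q * e + q * (q - 1) / 2 * w\<^sup>2 + C * (s\<^sup>2 * (1 + s) ^ N)"
    using symmetrised_powr_bound[OF q c] by metis
  define C' where "C' = C + q * k + \<bar>q * (q - 1) / 2\<bar> * (8 * k\<^sup>2 + 4 * k\<^sup>2 * K)"
  have C': "0 \<le> C'" unfolding C'_def using C q k K by (intro add_nonneg_nonneg mult_nonneg_nonneg) auto
  have "((1 + quad_form Q (y + \<Delta> *\<^sub>R a + b *v z)) powr q + (1 + quad_form Q (y + \<Delta> *\<^sub>R a - b *v z)) powr q) / 2
     \<le> (1 + quad_form Q y) powr q *
       (1 + q * (2 * \<Delta> * (y \<bullet> (Q *v a)) + quad_form Q (b *v z)) / (1 + quad_form Q y)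
          + 2 * q * (q - 1) * (y \<bullet> (Q *v (b *v z)))\<^sup>2 / (1 + quad_form Q y)\<^sup>2
          + C' * ((h * (\<Delta> + (norm z)\<^sup>2))\<^sup>2 * (1 + h * (\<Delta> + (norm z)\<^sup>2)) ^ N))"
    if h: "0 \<le> h" and \<Delta>: "0 \<le> \<Delta>" and hK: "h * \<Delta> \<le> K" and a: "norm a \<le> h * (1 + norm y)"
      and b: "(norm b)\<^sup>2 \<le> h * (1 + norm y)\<^sup>2" for a and b :: "real ^ 'd ^ 'n" and y z h \<Delta>
  proof -
    define u where "u = 1 + quad_form Q y"
    define s where "s = h * (\<Delta> + (norm z)\<^sup>2)"
    define m where "m = 1 + norm y"
    define t where "t = h * (norm z)\<^sup>2"
    define d where "d = h * \<Delta>"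
    have u: "1 \<le> u" using sym_pos_def_nonneg[OF Q, of y] by (simp add: u_def)
    have t: "0 \<le> t" and d: "0 \<le> d" "d \<le> K" using h \<Delta> hK by (auto simp: t_def d_def)
    have s: "s = d + t" by (simp add: s_def d_def t_def algebra_simps)
    have m: "1 \<le> m" "norm y \<le> m" by (auto simp: m_def)
    \<comment> \<open>All growth bounds are in terms of \<open>m = 1 + |y|\<close>; dividing by \<open>u\<close> trades \<open>m\<^sup>2\<close> for the constant \<open>\<kappa>\<close>.\<close>
    have m2: "m\<^sup>2 \<le> \<kappa> * u"
    proof -
      have "m\<^sup>2 \<le> 2 * (1 + (norm y)\<^sup>2)" using sum_squares_bound[of 1 "norm y"] by (simp add: m_def power2_sum)
      also have "(norm y)\<^sup>2 \<le> quad_form Q y / c1" using c1(2)[of y] c1(1) by (simp add: field_simps)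
      also have "2 * (1 + quad_form Q y / c1) \<le> \<kappa> * u"
        using c1(1) sym_pos_def_nonneg[OF Q, of y] by (simp add: \<kappa>_def u_def field_simps)
      finally show ?thesis by simp
    qed
    have a: "norm a \<le> h * m" using a by (simp add: m_def)
    have bz: "(norm (b *v z))\<^sup>2 \<le> t * m\<^sup>2"
    proof -
      have "(norm (b *v z))\<^sup>2 \<le> (norm b * norm z)\<^sup>2" by (intro power_mono norm_matrix_vector_le) auto
      also have "\<dots> = (norm b)\<^sup>2 * (norm z)\<^sup>2" by (simp add: power_mult_distrib)
      also have "\<dots> \<le> (h * m\<^sup>2) * (norm z)\<^sup>2" using b by (intro mult_right_mono) (auto simp: m_def)
      finally show ?thesis by (simp add: t_def ac_simps)
    qed
    define X Z A W V where "X = y \<bullet> (Q *v a)" and "Z = quad_form Q (b *v z)" and "A = quad_form Q a"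
      and "W = y \<bullet> (Q *v (b *v z))" and "V = a \<bullet> (Q *v (b *v z))"
    have mh: "0 \<le> h * m" using h m by simp
    have X: "\<Delta> * \<bar>X\<bar> \<le> c2 * d * m\<^sup>2"
    proof -
      have "\<bar>X\<bar> \<le> c2 * norm y * norm a" unfolding X_def by (rule bil)
      also have "\<dots> \<le> c2 * m * (h * m)" using a m mh c2 by (intro mult_mono mult_nonneg_nonneg) auto
      finally have "\<Delta> * \<bar>X\<bar> \<le> \<Delta> * (c2 * m * (h * m))" using \<Delta> by (rule mult_left_mono)
      then show ?thesis by (simp add: d_def power2_eq_square ac_simps)
    qed
    have Z: "\<bar>Z\<bar> \<le> c2 * t * m\<^sup>2"
    proof -
      have "\<bar>Z\<bar> \<le> c2 * (norm (b *v z))\<^sup>2" unfolding Z_def using bil[of "b *v z" "b *v z"]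
        by (simp add: power2_eq_square ac_simps)
      also have "\<dots> \<le> c2 * (t * m\<^sup>2)" using bz c2 by (rule mult_left_mono)
      finally show ?thesis by (simp add: ac_simps)
    qed
    have A: "\<Delta>\<^sup>2 * A \<le> c2 * d\<^sup>2 * m\<^sup>2"
    proof -
      have "A \<le> c2 * norm a * norm a" unfolding A_def using bil[of a a] by simp
      also have "\<dots> \<le> c2 * (h * m) * (h * m)" using a mh h m c2 by (intro mult_mono mult_nonneg_nonneg) auto
      finally have "\<Delta>\<^sup>2 * A \<le> \<Delta>\<^sup>2 * (c2 * (h * m) * (h * m))" by (rule mult_left_mono) simp
      then show ?thesis by (simp add: d_def power2_eq_square ac_simps)
    qed
    have A0: "0 \<le> \<Delta>\<^sup>2 * A" unfolding A_def using sym_pos_def_nonneg[OF Q] by simp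
    have W: "\<bar>W\<bar> \<le> c2 * m * norm (b *v z)"
      unfolding W_def by (rule order_trans[OF bil]) (intro mult_right_mono mult_left_mono m c2 norm_ge_zero)
    have V: "\<Delta> * \<bar>V\<bar> \<le> c2 * (d * m) * norm (b *v z)"
    proof -
      have "\<bar>V\<bar> \<le> c2 * (h * m) * norm (b *v z)"
        unfolding V_def by (rule order_trans[OF bil]) (intro mult_right_mono mult_left_mono a c2 norm_ge_zero)
      from mult_left_mono[OF this \<Delta>] show ?thesis by (simp add: d_def ac_simps)
    qed
    have prod: "\<bar>x * x'\<bar> \<le> c2\<^sup>2 * (r * r') * t * (m\<^sup>2)\<^sup>2"
      if x: "\<bar>x\<bar> \<le> c2 * (r * m) * norm (b *v z)" "\<bar>x'\<bar> \<le> c2 * (r' * m) * norm (b *v z)"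
        and r: "0 \<le> r" "0 \<le> r'" for x x' r r'
    proof -
      have "\<bar>x * x'\<bar> \<le> (c2 * (r * m) * norm (b *v z)) * (c2 * (r' * m) * norm (b *v z))"
        unfolding abs_mult using x r c2 m by (intro mult_mono mult_nonneg_nonneg) auto
      also have "\<dots> = c2\<^sup>2 * (r * r') * m\<^sup>2 * (norm (b *v z))\<^sup>2" by (simp add: power2_eq_square ac_simps)
      also have "\<dots> \<le> c2\<^sup>2 * (r * r') * m\<^sup>2 * (t * m\<^sup>2)" using r by (intro mult_left_mono bz) auto
      finally show ?thesis by (simp add: power2_eq_square ac_simps)
    qed
    have W1: "\<bar>W\<bar> \<le> c2 * (1 * m) * norm (b *v z)" using W by simp
    have V1: "\<bar>\<Delta> * V\<bar> \<le> c2 * (d * m) * norm (b *v z)" using V \<Delta> by (simp add: abs_mult)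
    have one: "(0::real) \<le> 1" by simp
    have div: "x / u \<le> k * r" if "x \<le> c2 * r * m\<^sup>2" "0 \<le> r" for x r
    proof -
      have "x \<le> c2 * r * (\<kappa> * u)" using that m2 c2 by (meson mult_left_mono mult_nonneg_nonneg order_trans)
      then show ?thesis using u by (simp add: k_def field_simps)
    qed
    have div2: "x / u\<^sup>2 \<le> k\<^sup>2 * r" if "x \<le> c2\<^sup>2 * r * (m\<^sup>2)\<^sup>2" "0 \<le> r" for x r
    proof -
      have "(m\<^sup>2)\<^sup>2 \<le> (\<kappa> * u)\<^sup>2" using m2 by (intro power_mono) auto
      then have "x \<le> c2\<^sup>2 * r * (\<kappa> * u)\<^sup>2" using that
        by (meson mult_left_mono mult_nonneg_nonneg order_trans zero_le_power2)
      then show ?thesis using u by (simp add: k_def field_simps power_mult_distrib)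
    qed
    define e0 e1 w0 w1 where "e0 = (2 * \<Delta> * X + Z) / u" and "e1 = \<Delta>\<^sup>2 * A / u"
      and "w0 = 2 * W / u" and "w1 = 2 * (\<Delta> * V) / u"
    have e0: "\<bar>e0\<bar> \<le> k * (2 * d + t)"
    proof -
      have "\<bar>e0\<bar> = \<bar>2 * \<Delta> * X + Z\<bar> / u" using u by (simp add: e0_def)
      also have "\<dots> \<le> k * (2 * d + t)"
      proof (rule div)
        have "\<bar>2 * \<Delta> * X\<bar> = 2 * (\<Delta> * \<bar>X\<bar>)" using \<Delta> by (simp add: abs_mult)
        then show "\<bar>2 * \<Delta> * X + Z\<bar> \<le> c2 * (2 * d + t) * m\<^sup>2"
          using X Z abs_triangle_ineq[of "2 * \<Delta> * X" Z] by (simp add: algebra_simps)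
      qed (use d t in auto)
      finally show ?thesis .
    qed
    have e1: "0 \<le> e1" "e1 \<le> k * d\<^sup>2"
      unfolding e1_def using A0 u div[OF A] by auto
    have w00: "w0\<^sup>2 \<le> 4 * (k\<^sup>2 * t)"
      using div2[of "\<bar>W * W\<bar>" t] prod[OF W1 W1 one one] t by (simp add: w0_def power_divide power2_eq_square)
    have w11: "w1\<^sup>2 \<le> 4 * (k\<^sup>2 * (d\<^sup>2 * t))"
    proof -
      have "(\<Delta> * V)\<^sup>2 \<le> c2\<^sup>2 * (d\<^sup>2 * t) * (m\<^sup>2)\<^sup>2"
        using prod[OF V1 V1 d(1) d(1)] by (simp only: abs_mult_self_eq abs_mult power2_eq_square[of d] power2_eq_square[of "\<Delta> * V"] mult.assoc)
      then have "(\<Delta> * V)\<^sup>2 / u\<^sup>2 \<le> k\<^sup>2 * (d\<^sup>2 * t)" using t d by (intro div2) auto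
      moreover have "w1\<^sup>2 = 4 * ((\<Delta> * V)\<^sup>2 / u\<^sup>2)" by (simp add: w1_def power_divide power_mult_distrib)
      ultimately show ?thesis by simp
    qed
    have w01: "\<bar>w0 * w1\<bar> \<le> 4 * (k\<^sup>2 * (d * t))"
    proof -
      have "\<bar>W * (\<Delta> * V)\<bar> \<le> c2\<^sup>2 * (d * t) * (m\<^sup>2)\<^sup>2"
        using prod[OF W1 V1 one d(1)] by (simp only: mult_1_left mult.assoc)
      then have "\<bar>W * (\<Delta> * V)\<bar> / u\<^sup>2 \<le> k\<^sup>2 * (d * t)" using t d by (intro div2) auto
      moreover have "\<bar>w0 * w1\<bar> = 4 * (\<bar>W * (\<Delta> * V)\<bar> / u\<^sup>2)"
        using u by (simp add: w0_def w1_def abs_mult power2_eq_square)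
      ultimately show ?thesis by simp
    qed
    have d2: "d\<^sup>2 \<le> K * d" "d\<^sup>2 \<le> K\<^sup>2" using d by (auto simp: power2_eq_square intro!: mult_mono)
    have s0: "0 \<le> s" using s d t by simp
    have dt: "d * t \<le> s\<^sup>2" "d\<^sup>2 \<le> s\<^sup>2" using d t by (auto simp: s power2_eq_square algebra_simps)
    have eb: "\<bar>e0 + e1\<bar> \<le> c * s"
    proof -
      have "\<bar>e0 + e1\<bar> \<le> k * (2 * d + t) + k * (K * d)"
        using e0 e1 mult_left_mono[OF d2(1) k] by linarith
      also have "\<dots> \<le> k * (2 + K) * s"
      proof -
        have "0 \<le> k * t" "0 \<le> k * (K * t)" using k t K by auto
        then show ?thesis by (simp add: s algebra_simps)
      qed
      also have "\<dots> \<le> c * s" unfolding c_def using s0 k K by (intro mult_right_mono) auto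
      finally show ?thesis .
    qed
    have d2t: "d\<^sup>2 * t \<le> K\<^sup>2 * t" using d2 t by (intro mult_right_mono)
    have wb: "(w0 + w1)\<^sup>2 \<le> c * s"
    proof -
      have "(w0 + w1)\<^sup>2 \<le> 2 * w0\<^sup>2 + 2 * w1\<^sup>2"
        using sum_squares_bound[of w0 w1] by (simp add: power2_sum)
      also have "\<dots> \<le> 8 * k\<^sup>2 * (1 + K\<^sup>2) * t"
        using w00 w11 mult_left_mono[OF d2t, of "k\<^sup>2"] by (simp add: algebra_simps)
      also have "\<dots> \<le> c * s" unfolding c_def using t d k K by (intro mult_mono) (auto simp: s)
      finally show ?thesis .
    qed
    have ex: "1 + quad_form Q (y + \<Delta> *\<^sub>R a + b *v z) = u * (1 + ((e0 + e1) + (w0 + w1)))"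
      "1 + quad_form Q (y + \<Delta> *\<^sub>R a - b *v z) = u * (1 + ((e0 + e1) - (w0 + w1)))"
    proof -
      have sy: "a \<bullet> (Q *v y) = X" "(b *v z) \<bullet> (Q *v y) = W" "(b *v z) \<bullet> (Q *v a) = V"
        unfolding X_def W_def V_def by (rule sym_pos_def_commute[OF Q])+
      have uu: "u * (x / u) = x" for x using u by simp
      have "1 + quad_form Q (y + \<Delta> *\<^sub>R a + b *v z) = u + (2 * \<Delta> * X + Z) + \<Delta>\<^sup>2 * A + 2 * W + 2 * (\<Delta> * V)"
        using sy by (simp add: matrix_vector_right_distrib matrix_vector_mult_scaleR inner_simps u_def X_def Z_def A_def W_def V_def
          power2_eq_square algebra_simps)
      then show "1 + quad_form Q (y + \<Delta> *\<^sub>R a + b *v z) = u * (1 + ((e0 + e1) + (w0 + w1)))"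
        unfolding e0_def e1_def w0_def w1_def distrib_left uu by simp
      have "1 + quad_form Q (y + \<Delta> *\<^sub>R a - b *v z) = u + (2 * \<Delta> * X + Z) + \<Delta>\<^sup>2 * A - 2 * W - 2 * (\<Delta> * V)"
        using sy by (simp add: matrix_vector_right_distrib matrix_vector_mult_diff_distrib matrix_vector_mult_scaleR inner_simps u_def X_def Z_def A_def W_def V_def
          power2_eq_square algebra_simps)
      then show "1 + quad_form Q (y + \<Delta> *\<^sub>R a - b *v z) = u * (1 + ((e0 + e1) - (w0 + w1)))"
        unfolding e0_def e1_def w0_def w1_def distrib_left right_diff_distrib uu by simp
    qed
    have lo: "-1 \<le> x" if "1 + quad_form Q v = u * (1 + x)" for v x
    proof -
      have "0 \<le> u * (1 + x)" using sym_pos_def_nonneg[OF Q, of v] that by simp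
      then show ?thesis using u by (simp add: zero_le_mult_iff)
    qed
    note los = lo[OF ex(1)] lo[OF ex(2)]
    define P where "P = s\<^sup>2 * (1 + s) ^ N"
    have P: "s\<^sup>2 \<le> P" unfolding P_def using s0 by (simp add: mult_le_cancel_left1 one_le_power)
    have "((1 + quad_form Q (y + \<Delta> *\<^sub>R a + b *v z)) powr q + (1 + quad_form Q (y + \<Delta> *\<^sub>R a - b *v z)) powr q) / 2
      = u powr q * (((1 + ((e0 + e1) + (w0 + w1))) powr q + (1 + ((e0 + e1) - (w0 + w1))) powr q) / 2)"
    proof -
      have "(u * x) powr q = u powr q * x powr q" if "0 \<le> x" for x
        using that u by (simp add: powr_mult)
      from this[of "1 + ((e0 + e1) + (w0 + w1))"] this[of "1 + ((e0 + e1) - (w0 + w1))"]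
      show ?thesis unfolding ex using los by (simp add: distrib_left add_divide_distrib)
    qed
    also have "\<dots> \<le> u powr q * (1 + q * e0 + q * (q - 1) / 2 * w0\<^sup>2 + C' * P)"
    proof (rule mult_left_mono)
      have "q * e1 \<le> q * k * P"
        using e1(2) mult_left_mono[OF dt(2) k] mult_left_mono[OF P k] q
          mult_left_mono[of e1 "k * P" q] by simp
      moreover have "q * (q - 1) / 2 * (w0 + w1)\<^sup>2 - q * (q - 1) / 2 * w0\<^sup>2 \<le> \<bar>q * (q - 1) / 2\<bar> * (8 * k\<^sup>2 + 4 * k\<^sup>2 * K) * P"
      proof -
        have dd: "d\<^sup>2 * t \<le> K * P"
        proof -
          have "d\<^sup>2 * t \<le> K * d * t" using d2(1) t by (intro mult_right_mono)
          also have "\<dots> \<le> K * P" using dt(1) P K by (simp add: mult.assoc mult_left_mono)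
          finally show ?thesis .
        qed
        have "\<bar>(w0 + w1)\<^sup>2 - w0\<^sup>2\<bar> = \<bar>2 * (w0 * w1) + w1\<^sup>2\<bar>" by (simp add: power2_sum)
        also have "\<dots> \<le> 2 * \<bar>w0 * w1\<bar> + w1\<^sup>2" using abs_triangle_ineq[of "2 * (w0 * w1)" "w1\<^sup>2"] by (simp add: abs_mult)
        also have "\<dots> \<le> 8 * (k\<^sup>2 * P) + 4 * (k\<^sup>2 * (K * P))"
          using w01 w11 mult_left_mono[OF order_trans[OF dt(1) P], of "k\<^sup>2"] mult_left_mono[OF dd, of "k\<^sup>2"]
          by simp
        finally have "\<bar>(w0 + w1)\<^sup>2 - w0\<^sup>2\<bar> \<le> (8 * k\<^sup>2 + 4 * k\<^sup>2 * K) * P" by (simp add: algebra_simps)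
        then have "\<bar>q * (q - 1) / 2\<bar> * \<bar>(w0 + w1)\<^sup>2 - w0\<^sup>2\<bar> \<le> \<bar>q * (q - 1) / 2\<bar> * ((8 * k\<^sup>2 + 4 * k\<^sup>2 * K) * P)"
          by (intro mult_left_mono) auto
        moreover have "q * (q - 1) / 2 * ((w0 + w1)\<^sup>2 - w0\<^sup>2) \<le> \<bar>q * (q - 1) / 2\<bar> * \<bar>(w0 + w1)\<^sup>2 - w0\<^sup>2\<bar>"
          by (metis abs_ge_self abs_mult)
        ultimately show ?thesis unfolding right_diff_distrib mult.assoc by linarith
      qed
      ultimately show "((1 + ((e0 + e1) + (w0 + w1))) powr q + (1 + ((e0 + e1) - (w0 + w1))) powr q) / 2
          \<le> 1 + q * e0 + q * (q - 1) / 2 * w0\<^sup>2 + C' * P"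
        using *[OF s0 eb wb los] unfolding P_def[symmetric] C'_def distrib_left distrib_right by linarith
    qed simp
    also have "q * (q - 1) / 2 * w0\<^sup>2 = 2 * q * (q - 1) * W\<^sup>2 / u\<^sup>2" by (simp add: w0_def power_divide power_mult_distrib)
    finally show ?thesis unfolding e0_def X_def Z_def W_def P_def u_def s_def by simp
  qed
  with C' show ?thesis by blast
qed

section \<open>Gaussian increments\<close>

text \<open>The law of a Brownian increment over a time span \<open>\<Delta>\<close>: independent centred normal components of
variance \<open>\<Delta>\<close>.\<close>

definition (in prob_space) gaussian_increment :: "real \<Rightarrow> ('a \<Rightarrow> real ^ 'd) \<Rightarrow> bool" where
  "gaussian_increment \<Delta> Z \<longleftrightarrow> 0 < \<Delta> \<and> indep_vars (\<lambda>_. borel) (\<lambda>l \<omega>. Z \<omega> $ l) UNIV \<and>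
     (\<forall>l. distributed M lborel (\<lambda>\<omega>. Z \<omega> $ l) (\<lambda>x. ennreal (normal_density 0 (sqrt \<Delta>) x)))"

lemma borel_measurable_vec:
  fixes X :: "'a \<Rightarrow> real ^ 'd"
  assumes "\<And>l. (\<lambda>\<omega>. X \<omega> $ l) \<in> borel_measurable N"
  shows "X \<in> borel_measurable N"
  by (rule borel_measurable_euclidean_space[THEN iffD2]) (auto simp: Basis_vec_def inner_axis assms)

lemma borel_measurable_matrix_vector_mult [measurable (raw)]:
  fixes A :: "'a \<Rightarrow> real ^ 'd ^ 'n"
  assumes [measurable]: "A \<in> borel_measurable N" "v \<in> borel_measurable N"
  shows "(\<lambda>\<omega>. A \<omega> *v v \<omega>) \<in> borel_measurable N"
proof (rule borel_measurable_vec)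
  fix i
  have [measurable]: "(\<lambda>A :: real ^ 'd ^ 'n. A $ i) \<in> borel_measurable borel"
    by (intro borel_measurable_continuous_onI continuous_intros)
  show "(\<lambda>\<omega>. (A \<omega> *v v \<omega>) $ i) \<in> borel_measurable N"
    by (simp add: matrix_vector_mul_component)
qed

context prob_space begin

lemma gaussian_increment_component_measurable:
  "gaussian_increment \<Delta> Z \<Longrightarrow> (\<lambda>\<omega>. Z \<omega> $ l) \<in> borel_measurable M"
  unfolding gaussian_increment_def indep_vars_def by auto

lemma gaussian_increment_measurable:
  fixes Z :: "'a \<Rightarrow> real ^ 'd"
  assumes "gaussian_increment \<Delta> Z"
  shows "Z \<in> borel_measurable M"
  using gaussian_increment_component_measurable[OF assms] by (rule borel_measurable_vec)

text \<open>The law of a vector with independent components is the image of the product of the marginals, and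
each marginal is symmetric.\<close>

lemma gaussian_increment_symmetric:
  fixes Z :: "'a \<Rightarrow> real ^ 'd"
  assumes Z: "gaussian_increment \<Delta> Z"
  shows "distr M borel (\<lambda>\<omega>. - Z \<omega>) = distr M borel Z"
proof -
  define law where "law X = distr M (\<Pi>\<^sub>M l\<in>UNIV. borel) (\<lambda>\<omega>. \<lambda>l\<in>UNIV. X l \<omega>)" for X :: "'d \<Rightarrow> 'a \<Rightarrow> real"
  note Zl = gaussian_increment_component_measurable[OF Z]
  have I: "indep_vars (\<lambda>_. borel) (\<lambda>l \<omega>. Z \<omega> $ l) UNIV" using Z unfolding gaussian_increment_def by auto
  have I': "indep_vars (\<lambda>_. borel) (\<lambda>l \<omega>. - (Z \<omega> $ l)) UNIV"
    using indep_vars_compose2[OF I, of "\<lambda>_ x. - x" "\<lambda>_. borel"] by simp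
  have neg: "distr M borel (\<lambda>\<omega>. - (Z \<omega> $ l)) = distr M borel (\<lambda>\<omega>. Z \<omega> $ l)" for l
  proof -
    have D: "distributed M lborel (\<lambda>\<omega>. Z \<omega> $ l) (\<lambda>x. ennreal (normal_density 0 (sqrt \<Delta>) x))" and s: "0 < sqrt \<Delta>"
      using Z unfolding gaussian_increment_def by auto
    have D': "distributed M lborel (\<lambda>\<omega>. - (Z \<omega> $ l)) (\<lambda>x. ennreal (normal_density 0 (sqrt \<Delta>) x))"
      using normal_density_affine[OF D s, of "-1" 0] by simp
    have "distr M borel (\<lambda>\<omega>. - (Z \<omega> $ l)) = distr M lborel (\<lambda>\<omega>. - (Z \<omega> $ l))"
      by (rule distr_cong) auto
    also have "\<dots> = distr M lborel (\<lambda>\<omega>. Z \<omega> $ l)"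
      unfolding distributed_distr_eq_density[OF D] distributed_distr_eq_density[OF D'] ..
    also have "\<dots> = distr M borel (\<lambda>\<omega>. Z \<omega> $ l)" by (rule distr_cong) auto
    finally show ?thesis .
  qed
  have eq: "law (\<lambda>l \<omega>. - (Z \<omega> $ l)) = law (\<lambda>l \<omega>. Z \<omega> $ l)"
    unfolding law_def
    using I I' Zl by (subst (asm) (1 2) indep_vars_iff_distr_eq_PiM) (auto simp: neg)
  have law: "distr M borel (\<lambda>\<omega>. \<chi> l. X l \<omega>) = distr (law X) borel (\<lambda>x. \<chi> l. x l)"
    if [measurable]: "\<And>l. X l \<in> borel_measurable M" for X :: "'d \<Rightarrow> 'a \<Rightarrow> real"
  proof -
    have [measurable]: "(\<lambda>x. \<chi> l. x l) \<in> borel_measurable (\<Pi>\<^sub>M l\<in>(UNIV :: 'd set). (borel :: real measure))"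
      by (rule borel_measurable_vec) simp
    have m: "(\<lambda>\<omega>. \<lambda>l\<in>UNIV. X l \<omega>) \<in> M \<rightarrow>\<^sub>M (\<Pi>\<^sub>M l\<in>(UNIV :: 'd set). (borel :: real measure))"
      by (rule measurable_restrict) simp
    show ?thesis unfolding law_def by (subst distr_distr[OF _ m]) (auto simp: comp_def restrict_UNIV)
  qed
  have "distr M borel (\<lambda>\<omega>. \<chi> l. - (Z \<omega> $ l)) = distr M borel (\<lambda>\<omega>. \<chi> l. Z \<omega> $ l)"
    using Zl by (subst (1 2) law) (auto simp: eq)
  moreover have "(\<lambda>\<omega>. \<chi> l. - (Z \<omega> $ l)) = (\<lambda>\<omega>. - Z \<omega>)" by (auto simp: vec_eq_iff)
  ultimately show ?thesis by simp
qed

lemma gaussian_increment_second_moments: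
  fixes Z :: "'a \<Rightarrow> real ^ 'd"
  assumes Z: "gaussian_increment \<Delta> Z"
  shows "has_bochner_integral M (\<lambda>\<omega>. Z \<omega> $ l * Z \<omega> $ m) (if l = m then \<Delta> else 0)"
proof -
  note Zl = gaussian_increment_component_measurable[OF Z]
  have I: "indep_vars (\<lambda>_. borel) (\<lambda>l \<omega>. Z \<omega> $ l) UNIV" and d: "0 < \<Delta>"
   and D: "\<And>l. distributed M lborel (\<lambda>\<omega>. Z \<omega> $ l) (\<lambda>x. ennreal (normal_density 0 (sqrt \<Delta>) x))"
    using Z unfolding gaussian_increment_def by auto
  have s: "0 < sqrt \<Delta>" using d by simp
  have i1: "integrable M (\<lambda>\<omega>. Z \<omega> $ l)" for l
    using integrable_normal_moment_nz_1[OF s, of 0] distributed_integrable[OF D, of "\<lambda>x. x" l]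
    by simp
  have e1: "expectation (\<lambda>\<omega>. Z \<omega> $ l) = 0" for l
    using normal_distributed_expectation[OF s D] .
  show ?thesis
  proof (cases "l = m")
    case False
    have i: "indep_vars (\<lambda>_. borel) (\<lambda>l \<omega>. Z \<omega> $ l) {l, m}"
      by (rule indep_vars_subset[OF I]) auto
    show ?thesis using False indep_vars_lebesgue_integral[OF _ i i1] indep_vars_integrable[OF _ i i1]
      by (simp add: has_bochner_integral_iff e1)
  next
    case True
    have m: "has_bochner_integral lborel (\<lambda>x. normal_density 0 (sqrt \<Delta>) x * x\<^sup>2) \<Delta>"
      using normal_moment_even[OF s, of 0 1] d by (simp add: fact_numeral)
    show ?thesis
      using m True distributed_integrable[OF D, of "\<lambda>x. x\<^sup>2" m] distributed_integral[OF D, of "\<lambda>x. x\<^sup>2" m]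
      by (simp add: has_bochner_integral_iff power2_eq_square)
  qed
qed

lemma gaussian_increment_quadratic_form:
  fixes Z :: "'a \<Rightarrow> real ^ 'd" and A :: "real ^ 'd ^ 'd"
  assumes Z: "gaussian_increment \<Delta> Z"
  shows "has_bochner_integral M (\<lambda>\<omega>. Z \<omega> \<bullet> (A *v Z \<omega>)) (\<Delta> * trace A)"
proof -
  have "has_bochner_integral M (\<lambda>\<omega>. \<Sum>l\<in>UNIV. \<Sum>m\<in>UNIV. A $ l $ m * (Z \<omega> $ l * Z \<omega> $ m))
      (\<Sum>l\<in>UNIV. \<Sum>m\<in>UNIV. A $ l $ m * (if l = m then \<Delta> else 0))"
    by (intro has_bochner_integral_sum has_bochner_integral_mult_right gaussian_increment_second_moments[OF Z])
  moreover have "(\<lambda>\<omega>. \<Sum>l\<in>UNIV. \<Sum>m\<in>UNIV. A $ l $ m * (Z \<omega> $ l * Z \<omega> $ m)) = (\<lambda>\<omega>. Z \<omega> \<bullet> (A *v Z \<omega>))"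
    by (simp add: inner_vec_def matrix_vector_mult_def sum_distrib_left ac_simps)
  moreover have "(\<Sum>l\<in>UNIV. \<Sum>m\<in>UNIV. A $ l $ m * (if l = m then \<Delta> else 0)) = \<Delta> * trace A"
    by (simp add: trace_def sum_distrib_left ac_simps if_distrib cong: if_cong)
  ultimately show ?thesis by simp
qed

lemma gaussian_increment_linear_form:
  fixes Z :: "'a \<Rightarrow> real ^ 'd"
  assumes Z: "gaussian_increment \<Delta> Z"
  shows "has_bochner_integral M (\<lambda>\<omega>. (w \<bullet> Z \<omega>)\<^sup>2) (\<Delta> * (norm w)\<^sup>2)"
proof -
  have "has_bochner_integral M (\<lambda>\<omega>. Z \<omega> \<bullet> ((\<chi> l m. w $ l * w $ m) *v Z \<omega>)) (\<Delta> * trace (\<chi> l m. w $ l * w $ m))"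
    by (rule gaussian_increment_quadratic_form[OF Z])
  moreover have "z \<bullet> ((\<chi> l m. w $ l * w $ m) *v z) = (w \<bullet> z)\<^sup>2" for z :: "real ^ 'd"
    by (simp add: inner_vec_def matrix_vector_mult_def power2_eq_square sum_distrib_left sum_distrib_right ac_simps)
  moreover have "trace (\<chi> l m. w $ l * w $ m) = (norm w)\<^sup>2"
    by (simp add: trace_def power2_norm_eq_inner inner_vec_def)
  ultimately show ?thesis by simp
qed

text \<open>The constant has to be uniform in \<open>\<Delta>\<close>. After scaling by \<open>\<Delta>\<^sup>1\<^sup>/\<^sup>2\<close> the components are standard normal, and
\<open>1 + |Z|\<^sup>2/\<Delta>\<close> is at most the dimension times the largest \<open>1 + W\<^sub>l\<^sup>2\<close>.\<close>

lemma gaussian_increment_higher_moments: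
  "\<exists>C\<ge>0. \<forall>\<Delta> (Z :: 'a \<Rightarrow> real ^ 'd). gaussian_increment \<Delta> Z \<longrightarrow>
     integrable M (\<lambda>\<omega>. (1 + (norm (Z \<omega>))\<^sup>2 / \<Delta>) ^ n) \<and> expectation (\<lambda>\<omega>. (1 + (norm (Z \<omega>))\<^sup>2 / \<Delta>) ^ n) \<le> C"
proof -
  define c where "c = real CARD('d)"
  have c: "1 \<le> c" unfolding c_def by (simp add: Suc_leI)
  define I where "I = (\<integral>x. std_normal_density x * (c ^ n * (1 + x\<^sup>2) ^ n) \<partial>lborel)"
  have int: "integrable lborel (\<lambda>x. std_normal_density x * (c ^ n * (1 + x\<^sup>2) ^ n))"
  proof -
    have bin: "(1 + x\<^sup>2) ^ n = (\<Sum>k\<le>n. real (n choose k) * x ^ (2 * k))" for x :: real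
      using binomial_ring[of "x\<^sup>2" 1 n] by (simp only: add.commute[of "x\<^sup>2"] power_one mult_1_right power_mult)
    have "integrable lborel (\<lambda>x. c ^ n * (\<Sum>k\<le>n. real (n choose k) * (std_normal_density x * x ^ (2 * k))))"
      by (intro integrable_mult_right Bochner_Integration.integrable_sum integrable_std_normal_moment)
    also have "(\<lambda>x. c ^ n * (\<Sum>k\<le>n. real (n choose k) * (std_normal_density x * x ^ (2 * k))))
      = (\<lambda>x. std_normal_density x * (c ^ n * (1 + x\<^sup>2) ^ n))"
      by (simp add: bin sum_distrib_left ac_simps)
    finally show ?thesis .
  qed
  have "integrable M (\<lambda>\<omega>. (1 + (norm (Z \<omega>))\<^sup>2 / \<Delta>) ^ n) \<and> expectation (\<lambda>\<omega>. (1 + (norm (Z \<omega>))\<^sup>2 / \<Delta>) ^ n) \<le> c * I"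
    if Z: "gaussian_increment \<Delta> Z" for \<Delta> and Z :: "'a \<Rightarrow> real ^ 'd"
  proof -
    have d: "0 < \<Delta>" and D: "\<And>l. distributed M lborel (\<lambda>\<omega>. Z \<omega> $ l) (\<lambda>x. ennreal (normal_density 0 (sqrt \<Delta>) x))"
      using Z unfolding gaussian_increment_def by auto
    define W where "W l \<omega> = Z \<omega> $ l / sqrt \<Delta>" for l \<omega>
    have W: "distributed M lborel (W l) std_normal_density" for l
      using normal_standard_normal_convert[of "sqrt \<Delta>" "\<lambda>\<omega>. Z \<omega> $ l" 0] D[of l] d by (simp add: W_def[abs_def])
    define S where "S \<omega> = (\<Sum>l\<in>UNIV. c ^ n * (1 + (W l \<omega>)\<^sup>2) ^ n)" for \<omega>
    have Wi: "integrable M (\<lambda>\<omega>. c ^ n * (1 + (W l \<omega>)\<^sup>2) ^ n)" for l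
      using int distributed_integrable[OF W[of l], of "\<lambda>x. c ^ n * (1 + x\<^sup>2) ^ n"] by simp
    have WI: "expectation (\<lambda>\<omega>. c ^ n * (1 + (W l \<omega>)\<^sup>2) ^ n) = I" for l
      unfolding I_def using distributed_integral[OF W[of l], of "\<lambda>x. c ^ n * (1 + x\<^sup>2) ^ n"] by simp
    have Si: "integrable M S" unfolding S_def[abs_def] by (intro Bochner_Integration.integrable_sum Wi)
    have SI: "expectation S = c * I"
      unfolding S_def[abs_def] by (subst Bochner_Integration.integral_sum[OF Wi]) (simp only: WI sum_constant, simp add: c_def)
    have le: "(1 + (norm (Z \<omega>))\<^sup>2 / \<Delta>) ^ n \<le> S \<omega>" for \<omega>
    proof -
      define m where "m = Max (range (\<lambda>l. (W l \<omega>)\<^sup>2))"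
      have "m \<in> range (\<lambda>l. (W l \<omega>)\<^sup>2)" unfolding m_def by (rule Max_in) auto
      then obtain k where k: "m = (W k \<omega>)\<^sup>2" by auto
      have "(norm (Z \<omega>))\<^sup>2 / \<Delta> = (\<Sum>l\<in>UNIV. (W l \<omega>)\<^sup>2)"
      proof -
        have "(norm (Z \<omega>))\<^sup>2 = (\<Sum>l\<in>UNIV. (Z \<omega> $ l)\<^sup>2)"
          unfolding power2_norm_eq_inner by (simp add: inner_vec_def power2_eq_square)
        then show ?thesis using d by (simp add: W_def power_divide sum_divide_distrib)
      qed
      also have "\<dots> \<le> c * m" unfolding c_def by (rule sum_bounded_above) (simp add: m_def)
      finally have "1 + (norm (Z \<omega>))\<^sup>2 / \<Delta> \<le> c * (1 + (W k \<omega>)\<^sup>2)" using c by (simp add: k algebra_simps)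
      then have "(1 + (norm (Z \<omega>))\<^sup>2 / \<Delta>) ^ n \<le> (c * (1 + (W k \<omega>)\<^sup>2)) ^ n"
        using d by (intro power_mono) auto
      also have "\<dots> = c ^ n * (1 + (W k \<omega>)\<^sup>2) ^ n" by (simp add: power_mult_distrib)
      also have "\<dots> \<le> S \<omega>" unfolding S_def
        using c by (intro member_le_sum[of k UNIV "\<lambda>l. c ^ n * (1 + (W l \<omega>)\<^sup>2) ^ n"]) auto
      finally show ?thesis .
    qed
    note [measurable] = gaussian_increment_measurable[OF Z]
    have "integrable M (\<lambda>\<omega>. (1 + (norm (Z \<omega>))\<^sup>2 / \<Delta>) ^ n)"
      by (rule Bochner_Integration.integrable_bound[OF Si]) (use le d in \<open>auto intro!: AE_I2 order_trans[OF le]\<close>)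
    moreover from this have "expectation (\<lambda>\<omega>. (1 + (norm (Z \<omega>))\<^sup>2 / \<Delta>) ^ n) \<le> expectation S"
      using Si le by (intro integral_mono) auto
    ultimately show ?thesis using SI by simp
  qed
  moreover have "0 \<le> c * I" unfolding I_def using c by (intro mult_nonneg_nonneg integral_nonneg_AE AE_I2) auto
  ultimately show ?thesis by blast
qed

end

section \<open>One Euler step, in the mean\<close>

context prob_space begin

text \<open>Integrating the symmetrised bound against the symmetric law of \<open>Z\<close>. The quadratic terms integrate
exactly to the trace and the squared norm of the generator, and the error integrates to
\<open>(h\<Delta>)\<^sup>2\<close> times a moment of \<open>Z/\<Delta>\<^sup>1\<^sup>/\<^sup>2\<close>.\<close>

lemma gaussian_step_bound:
  fixes Q :: "real ^ 'n ^ 'n"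
  assumes Q: "sym_pos_def Q" and q: "0 < q" and K: "0 \<le> K"
  shows "\<exists>C\<ge>0. \<forall>(a :: real ^ 'n) (b :: real ^ 'd ^ 'n) y h \<Delta> (Z :: 'a \<Rightarrow> real ^ 'd).
     gaussian_increment \<Delta> Z \<longrightarrow> 0 \<le> h \<longrightarrow> h * \<Delta> \<le> K \<longrightarrow>
     norm a \<le> h * (1 + norm y) \<longrightarrow> (norm b)\<^sup>2 \<le> h * (1 + norm y)\<^sup>2 \<longrightarrow>
     (\<integral>\<^sup>+ \<omega>. ennreal ((1 + quad_form Q (y + \<Delta> *\<^sub>R a + b *v Z \<omega>)) powr q) \<partial>M)
     \<le> ennreal ((1 + quad_form Q y) powr q *
         (1 + q * \<Delta> * ((2 * (y \<bullet> (Q *v a)) + trace (transpose b ** Q ** b)) / (1 + quad_form Q y)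
                + 2 * (q - 1) * (norm ((y v* Q) v* b))\<^sup>2 / (1 + quad_form Q y)\<^sup>2)
            + C * (h * \<Delta>)\<^sup>2))"
proof -
  obtain C N where C: "0 \<le> C" and *: "\<And>(a :: real ^ 'n) (b :: real ^ 'd ^ 'n) y z h \<Delta>.
     0 \<le> h \<Longrightarrow> 0 \<le> \<Delta> \<Longrightarrow> h * \<Delta> \<le> K \<Longrightarrow> norm a \<le> h * (1 + norm y) \<Longrightarrow> (norm b)\<^sup>2 \<le> h * (1 + norm y)\<^sup>2 \<Longrightarrow>
     ((1 + quad_form Q (y + \<Delta> *\<^sub>R a + b *v z)) powr q + (1 + quad_form Q (y + \<Delta> *\<^sub>R a - b *v z)) powr q) / 2
     \<le> (1 + quad_form Q y) powr q *
       (1 + q * (2 * \<Delta> * (y \<bullet> (Q *v a)) + quad_form Q (b *v z)) / (1 + quad_form Q y)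
          + 2 * q * (q - 1) * (y \<bullet> (Q *v (b *v z)))\<^sup>2 / (1 + quad_form Q y)\<^sup>2
          + C * ((h * (\<Delta> + (norm z)\<^sup>2))\<^sup>2 * (1 + h * (\<Delta> + (norm z)\<^sup>2)) ^ N))"
    using symmetrised_step_bound[OF Q q K] by metis
  obtain C2 where C2: "0 \<le> C2" and mom: "\<And>\<Delta> (Z :: 'a \<Rightarrow> real ^ 'd). gaussian_increment \<Delta> Z \<Longrightarrow>
     integrable M (\<lambda>\<omega>. (1 + (norm (Z \<omega>))\<^sup>2 / \<Delta>) ^ (N + 2)) \<and> expectation (\<lambda>\<omega>. (1 + (norm (Z \<omega>))\<^sup>2 / \<Delta>) ^ (N + 2)) \<le> C2"
    using gaussian_increment_higher_moments[where 'd = 'd and n = "N + 2"] by metis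
  define C' where "C' = C * (1 + K) ^ N * C2"
  have C': "0 \<le> C'" unfolding C'_def using C C2 K by simp
  have "(\<integral>\<^sup>+ \<omega>. ennreal ((1 + quad_form Q (y + \<Delta> *\<^sub>R a + b *v Z \<omega>)) powr q) \<partial>M)
     \<le> ennreal ((1 + quad_form Q y) powr q *
         (1 + q * \<Delta> * ((2 * (y \<bullet> (Q *v a)) + trace (transpose b ** Q ** b)) / (1 + quad_form Q y)
                + 2 * (q - 1) * (norm ((y v* Q) v* b))\<^sup>2 / (1 + quad_form Q y)\<^sup>2)
            + C' * (h * \<Delta>)\<^sup>2))"
    if Z: "gaussian_increment \<Delta> Z" and h: "0 \<le> h" and hK: "h * \<Delta> \<le> K" and a: "norm a \<le> h * (1 + norm y)"
      and b: "(norm b)\<^sup>2 \<le> h * (1 + norm y)\<^sup>2" for a and b :: "real ^ 'd ^ 'n" and y h \<Delta> and Z :: "'a \<Rightarrow> real ^ 'd"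
  proof -
    have \<Delta>: "0 < \<Delta>" using Z unfolding gaussian_increment_def by auto
    note [measurable] = gaussian_increment_measurable[OF Z]
    define u where "u = 1 + quad_form Q y"
    have u: "1 \<le> u" using sym_pos_def_nonneg[OF Q, of y] by (simp add: u_def)
    define w where "w = (y v* Q) v* b"
    define T where "T = transpose b ** Q ** b"
    define G where "G z = (1 + quad_form Q (y + \<Delta> *\<^sub>R a + b *v z)) powr q" for z
    have G0: "0 \<le> G z" for z by (simp add: G_def)
    have [measurable]: "G \<in> borel_measurable borel"
      unfolding G_def[abs_def] by measurable
    define R where "R z = u powr q * (1 + q * (2 * \<Delta> * (y \<bullet> (Q *v a)) + z \<bullet> (T *v z)) / u
      + 2 * q * (q - 1) * (w \<bullet> z)\<^sup>2 / u\<^sup>2 + C * ((h * \<Delta>)\<^sup>2 * (1 + K) ^ N * (1 + (norm z)\<^sup>2 / \<Delta>) ^ (N + 2)))" for z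
    have GR: "(G z + G (- z)) / 2 \<le> R z" for z
    proof -
      have e1: "quad_form Q (b *v z) = z \<bullet> (T *v z)"
      proof -
        have "T *v z = (Q *v (b *v z)) v* b"
          unfolding T_def by (simp add: matrix_vector_mul_assoc[symmetric])
        then show ?thesis by (metis dot_lmul_matrix inner_commute)
      qed
      have e2: "y \<bullet> (Q *v (b *v z)) = w \<bullet> z"
        unfolding w_def by (simp only: dot_lmul_matrix)
      have e3: "(h * (\<Delta> + (norm z)\<^sup>2))\<^sup>2 * (1 + h * (\<Delta> + (norm z)\<^sup>2)) ^ N
        \<le> (h * \<Delta>)\<^sup>2 * (1 + K) ^ N * (1 + (norm z)\<^sup>2 / \<Delta>) ^ (N + 2)"
      proof -
        define v where "v = 1 + (norm z)\<^sup>2 / \<Delta>"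
        have v: "1 \<le> v" using \<Delta> by (simp add: v_def)
        have hv: "h * (\<Delta> + (norm z)\<^sup>2) = h * \<Delta> * v" using \<Delta> by (simp add: v_def field_simps)
        have "h * \<Delta> * v \<le> K * v" using hK v by (intro mult_right_mono) auto
        then have "1 + h * \<Delta> * v \<le> (1 + K) * v" using v unfolding distrib_right by linarith
        then have "(1 + h * \<Delta> * v) ^ N \<le> ((1 + K) * v) ^ N" using h \<Delta> v by (intro power_mono) auto
        then have "(h * \<Delta> * v)\<^sup>2 * (1 + h * \<Delta> * v) ^ N \<le> (h * \<Delta> * v)\<^sup>2 * ((1 + K) * v) ^ N" by (intro mult_left_mono) auto
        then show ?thesis unfolding hv v_def[symmetric] by (simp add: power_mult_distrib power_add power2_eq_square ac_simps)
      qed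
      have "(G z + G (- z)) / 2 \<le> u powr q *
       (1 + q * (2 * \<Delta> * (y \<bullet> (Q *v a)) + z \<bullet> (T *v z)) / u
          + 2 * q * (q - 1) * (w \<bullet> z)\<^sup>2 / u\<^sup>2
          + C * ((h * (\<Delta> + (norm z)\<^sup>2))\<^sup>2 * (1 + h * (\<Delta> + (norm z)\<^sup>2)) ^ N))"
        using *[OF h less_imp_le[OF \<Delta>] hK a b, of z] matrix_vector_mult_diff_distrib[of b 0 z]
        unfolding G_def u_def e1 e2 by simp
      also have "\<dots> \<le> R z"
        unfolding R_def using mult_left_mono[OF e3 C] by (intro mult_left_mono) auto
      finally show ?thesis .
    qed
    define E2 where "E2 = expectation (\<lambda>\<omega>. (1 + (norm (Z \<omega>))\<^sup>2 / \<Delta>) ^ (N + 2))"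
    have hb: "has_bochner_integral M (\<lambda>\<omega>. R (Z \<omega>))
       (u powr q * (1 + q * (2 * \<Delta> * (y \<bullet> (Q *v a)) + \<Delta> * trace T) / u
      + 2 * q * (q - 1) * (\<Delta> * (norm w)\<^sup>2) / u\<^sup>2 + C * ((h * \<Delta>)\<^sup>2 * (1 + K) ^ N * E2)))"
    proof -
      have cst: "has_bochner_integral M (\<lambda>\<omega>. c) c" for c :: real
        by (simp add: has_bochner_integral_iff prob_space)
      have m: "has_bochner_integral M (\<lambda>\<omega>. (1 + (norm (Z \<omega>))\<^sup>2 / \<Delta>) ^ (N + 2)) E2"
        using mom[OF Z] by (simp add: has_bochner_integral_iff E2_def)
      show ?thesis unfolding R_def
        by (intro has_bochner_integral_mult_right has_bochner_integral_add has_bochner_integral_divide cst m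
           gaussian_increment_quadratic_form[OF Z] gaussian_increment_linear_form[OF Z])
    qed
    have swap: "(\<integral>\<^sup>+ \<omega>. ennreal (G (- Z \<omega>) / 2) \<partial>M) = (\<integral>\<^sup>+ \<omega>. ennreal (G (Z \<omega>) / 2) \<partial>M)"
    proof -
      have "(\<integral>\<^sup>+ \<omega>. ennreal (G (- Z \<omega>) / 2) \<partial>M) = (\<integral>\<^sup>+ z. ennreal (G z / 2) \<partial>distr M borel (\<lambda>\<omega>. - Z \<omega>))"
        by (subst nn_integral_distr) auto
      also have "\<dots> = (\<integral>\<^sup>+ \<omega>. ennreal (G (Z \<omega>) / 2) \<partial>M)"
        unfolding gaussian_increment_symmetric[OF Z] by (subst nn_integral_distr) auto
      finally show ?thesis .
    qed
    have "(\<integral>\<^sup>+ \<omega>. ennreal (G (Z \<omega>)) \<partial>M) = (\<integral>\<^sup>+ \<omega>. ennreal (G (Z \<omega>) / 2) + ennreal (G (Z \<omega>) / 2) \<partial>M)"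
      by (intro nn_integral_cong) (simp add: G0 flip: ennreal_plus)
    also have "\<dots> = (\<integral>\<^sup>+ \<omega>. ennreal (G (Z \<omega>) / 2) \<partial>M) + (\<integral>\<^sup>+ \<omega>. ennreal (G (- Z \<omega>) / 2) \<partial>M)"
      unfolding swap by (intro nn_integral_add) auto
    also have "\<dots> = (\<integral>\<^sup>+ \<omega>. ennreal (G (Z \<omega>) / 2) + ennreal (G (- Z \<omega>) / 2) \<partial>M)"
      by (intro nn_integral_add[symmetric]) auto
    also have "\<dots> \<le> (\<integral>\<^sup>+ \<omega>. ennreal (R (Z \<omega>)) \<partial>M)"
    proof (rule nn_integral_mono)
      fix \<omega>
      have "G (Z \<omega>) / 2 + G (- Z \<omega>) / 2 \<le> R (Z \<omega>)" using GR[of "Z \<omega>"] by (simp add: add_divide_distrib)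
      then show "ennreal (G (Z \<omega>) / 2) + ennreal (G (- Z \<omega>) / 2) \<le> ennreal (R (Z \<omega>))"
        by (simp add: G0 ennreal_leI flip: ennreal_plus)
    qed
    also have "\<dots> = ennreal (u powr q * (1 + q * (2 * \<Delta> * (y \<bullet> (Q *v a)) + \<Delta> * trace T) / u
      + 2 * q * (q - 1) * (\<Delta> * (norm w)\<^sup>2) / u\<^sup>2 + C * ((h * \<Delta>)\<^sup>2 * (1 + K) ^ N * E2)))"
    proof -
      have "0 \<le> (G z + G (- z)) / 2" for z using G0 by simp
      then have "0 \<le> R z" for z using GR order_trans by blast
      then show ?thesis using hb by (subst nn_integral_eq_integral) (auto simp: has_bochner_integral_iff)
    qed
    also have "\<dots> \<le> ennreal (u powr q * (1 + q * \<Delta> * ((2 * (y \<bullet> (Q *v a)) + trace T) / u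
                + 2 * (q - 1) * (norm w)\<^sup>2 / u\<^sup>2) + C' * (h * \<Delta>)\<^sup>2))"
    proof (intro ennreal_leI mult_left_mono)
      have "C * ((h * \<Delta>)\<^sup>2 * (1 + K) ^ N * E2) \<le> C * ((h * \<Delta>)\<^sup>2 * (1 + K) ^ N * C2)"
        using mom[OF Z] C K unfolding E2_def by (intro mult_left_mono mult_nonneg_nonneg) auto
      then show "1 + q * (2 * \<Delta> * (y \<bullet> (Q *v a)) + \<Delta> * trace T) / u
      + 2 * q * (q - 1) * (\<Delta> * (norm w)\<^sup>2) / u\<^sup>2 + C * ((h * \<Delta>)\<^sup>2 * (1 + K) ^ N * E2)
        \<le> 1 + q * \<Delta> * ((2 * (y \<bullet> (Q *v a)) + trace T) / u
                + 2 * (q - 1) * (norm w)\<^sup>2 / u\<^sup>2) + C' * (h * \<Delta>)\<^sup>2"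
        by (simp add: C'_def algebra_simps add_divide_distrib diff_divide_distrib)
    qed simp
    finally show ?thesis unfolding G_def u_def w_def T_def .
  qed
  with C' show ?thesis by blast
qed

end

section \<open>Freezing the noise and the Markov property\<close>

context prob_space begin

lemma indep_set_commute:
  assumes "indep_set A C"
  shows "indep_set C A"
proof (rule indep_setI)
  show "C \<subseteq> events" "A \<subseteq> events"
    using assms unfolding indep_set_def indep_sets_def by (auto split: bool.splits)
  fix c a assume "c \<in> C" "a \<in> A"
  then show "prob (c \<inter> a) = prob c * prob a"
    using indep_setD[OF assms, of a c] by (simp add: Int_commute mult.commute)
qed

text \<open>Stated for \<open>\<sigma>\<close>-algebras: this admits variables with values in different types, and it is the form in which
both the filtration and the path spaces deliver independence.\<close>

lemma nn_integral_indep_set: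
  assumes ind: "indep_set (sets V1) (sets V2)" and sp: "space V1 = space M" "space V2 = space M"
    and X: "X \<in> V1 \<rightarrow>\<^sub>M A" and Y: "Y \<in> V2 \<rightarrow>\<^sub>M C"
    and H: "case_prod H \<in> borel_measurable (A \<Otimes>\<^sub>M C)"
  shows "(\<integral>\<^sup>+ \<omega>. H (X \<omega>) (Y \<omega>) \<partial>M) = (\<integral>\<^sup>+ \<omega>. \<integral>\<^sup>+ \<omega>'. H (X \<omega>) (Y \<omega>') \<partial>M \<partial>M)"
proof -
  have sub: "sets V1 \<subseteq> events" "sets V2 \<subseteq> events"
    using ind unfolding indep_set_def indep_sets_def by (auto split: bool.splits)
  have [measurable]: "X \<in> M \<rightarrow>\<^sub>M A" "Y \<in> M \<rightarrow>\<^sub>M C"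
    using measurable_from_subalg[OF _ X, of M] measurable_from_subalg[OF _ Y, of M] sub sp
    by (auto simp: subalgebra_def)
  note [measurable] = H
  interpret DX: prob_space "distr M A X" by (rule prob_space_distr) fact
  interpret DY: prob_space "distr M C Y" by (rule prob_space_distr) fact
  have D: "distr M A X \<Otimes>\<^sub>M distr M C Y = distr M (A \<Otimes>\<^sub>M C) (\<lambda>x. (X x, Y x))"
  proof (rule pair_measure_eqI)
    fix S T assume "S \<in> sets (distr M A X)" "T \<in> sets (distr M C Y)"
    then have [measurable]: "S \<in> sets A" "T \<in> sets C" by auto
    have "X -` S \<inter> space M \<in> sets V1" "Y -` T \<inter> space M \<in> sets V2"
      using measurable_sets[OF X, of S] measurable_sets[OF Y, of T] sp by auto
    then have "prob ((X -` S \<inter> space M) \<inter> (Y -` T \<inter> space M)) = prob (X -` S \<inter> space M) * prob (Y -` T \<inter> space M)"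
      by (rule indep_setD[OF ind])
    moreover have "(X -` S \<inter> space M) \<inter> (Y -` T \<inter> space M) = (\<lambda>x. (X x, Y x)) -` (S \<times> T) \<inter> space M" by auto
    ultimately show "emeasure (distr M A X) S * emeasure (distr M C Y) T
        = emeasure (distr M (A \<Otimes>\<^sub>M C) (\<lambda>x. (X x, Y x))) (S \<times> T)"
      by (simp add: emeasure_distr emeasure_eq_measure ennreal_mult)
  qed (auto intro: DX.sigma_finite_measure_axioms DY.sigma_finite_measure_axioms cong: sets_pair_measure_cong)
  have "(\<integral>\<^sup>+ \<omega>. H (X \<omega>) (Y \<omega>) \<partial>M) = (\<integral>\<^sup>+ p. case_prod H p \<partial>distr M (A \<Otimes>\<^sub>M C) (\<lambda>x. (X x, Y x)))"
    by (subst nn_integral_distr) auto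
  also have "\<dots> = (\<integral>\<^sup>+ x. \<integral>\<^sup>+ y. case_prod H (x, y) \<partial>distr M C Y \<partial>distr M A X)"
    unfolding D[symmetric] by (subst DY.nn_integral_fst[symmetric]) auto
  also have "\<dots> = (\<integral>\<^sup>+ \<omega>. \<integral>\<^sup>+ y. case_prod H (X \<omega>, y) \<partial>distr M C Y \<partial>M)"
    by (subst nn_integral_distr) auto
  also have "\<dots> = (\<integral>\<^sup>+ \<omega>. \<integral>\<^sup>+ \<omega>'. H (X \<omega>) (Y \<omega>') \<partial>M \<partial>M)"
  proof (rule nn_integral_cong)
    fix \<omega> assume "\<omega> \<in> space M"
    then have [measurable]: "X \<omega> \<in> space A" using measurable_space[of X M A] by auto
    show "(\<integral>\<^sup>+ y. case_prod H (X \<omega>, y) \<partial>distr M C Y) = (\<integral>\<^sup>+ \<omega>'. H (X \<omega>) (Y \<omega>') \<partial>M)"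
      by (subst nn_integral_distr) auto
  qed
  finally show ?thesis .
qed

text \<open>Pairwise information suffices: \<open>Z\<close> is independent of \<open>U\<close>, and \<open>R\<close> of the pair \<open>(U, Z)\<close>. Freezing \<open>R\<close>
first, then \<open>Z\<close>, and finally releasing \<open>R\<close> again shows that \<open>Z\<close> may be replaced by an independent copy.\<close>

lemma nn_integral_freeze:
  assumes UZ: "indep_set (sets VU) (sets VZ)" and WR: "indep_set (sets VW) (sets VR)"
    and sp: "space VU = space M" "space VZ = space M" "space VW = space M" "space VR = space M"
    and m: "U \<in> VU \<rightarrow>\<^sub>M A" "Z \<in> VZ \<rightarrow>\<^sub>M C" "U \<in> VW \<rightarrow>\<^sub>M A" "Z \<in> VW \<rightarrow>\<^sub>M C" "R \<in> VR \<rightarrow>\<^sub>M D"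
    and H[measurable]: "(\<lambda>(u, z, \<rho>). H u \<rho> z) \<in> borel_measurable (A \<Otimes>\<^sub>M C \<Otimes>\<^sub>M D)"
  shows "(\<integral>\<^sup>+ \<omega>. H (U \<omega>) (R \<omega>) (Z \<omega>) \<partial>M) = (\<integral>\<^sup>+ \<omega>. \<integral>\<^sup>+ \<omega>'. H (U \<omega>) (R \<omega>) (Z \<omega>') \<partial>M \<partial>M)"
proof -
  have RW: "indep_set (sets VR) (sets VW)" by (rule indep_set_commute[OF WR])
  have sub: "sets VW \<subseteq> events" "sets VR \<subseteq> events"
    using WR unfolding indep_set_def indep_sets_def by (auto split: bool.splits)
  have [measurable]: "U \<in> M \<rightarrow>\<^sub>M A" "Z \<in> M \<rightarrow>\<^sub>M C" "R \<in> M \<rightarrow>\<^sub>M D"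
    using measurable_from_subalg[OF _ m(3), of M] measurable_from_subalg[OF _ m(4), of M]
      measurable_from_subalg[OF _ m(5), of M] sub sp by (auto simp: subalgebra_def)
  note H' [measurable (raw)] = measurable_compose[OF measurable_Pair[OF _ measurable_Pair] H, simplified]
  have "(\<lambda>(\<rho>, u, z). H u \<rho> z) \<in> borel_measurable (D \<Otimes>\<^sub>M A \<Otimes>\<^sub>M C)"
    unfolding case_prod_beta' by (rule H') measurable
  then have "(\<integral>\<^sup>+ \<omega>. H (U \<omega>) (R \<omega>) (Z \<omega>) \<partial>M)
      = (\<integral>\<^sup>+ \<omega>. \<integral>\<^sup>+ \<omega>'. H (U \<omega>') (R \<omega>) (Z \<omega>') \<partial>M \<partial>M)"
    using nn_integral_indep_set[OF RW sp(4,3) m(5) measurable_Pair[OF m(3,4)], of "\<lambda>\<rho> (u, z). H u \<rho> z"]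
    by (simp add: case_prod_beta)
  also have "\<dots> = (\<integral>\<^sup>+ \<omega>. \<integral>\<^sup>+ \<omega>'. \<integral>\<^sup>+ \<omega>''. H (U \<omega>') (R \<omega>) (Z \<omega>'') \<partial>M \<partial>M \<partial>M)"
  proof (rule nn_integral_cong)
    fix \<omega> assume "\<omega> \<in> space M"
    then have [measurable]: "R \<omega> \<in> space D" using measurable_space[of R M D] by auto
    show "(\<integral>\<^sup>+ \<omega>'. H (U \<omega>') (R \<omega>) (Z \<omega>') \<partial>M) = (\<integral>\<^sup>+ \<omega>'. \<integral>\<^sup>+ \<omega>''. H (U \<omega>') (R \<omega>) (Z \<omega>'') \<partial>M \<partial>M)"
      by (rule nn_integral_indep_set[OF UZ sp(1,2) m(1,2), of "\<lambda>u z. H u (R \<omega>) z"])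
        (unfold case_prod_beta', rule H', measurable)
  qed
  also have "\<dots> = (\<integral>\<^sup>+ \<omega>. \<integral>\<^sup>+ \<omega>''. H (U \<omega>) (R \<omega>) (Z \<omega>'') \<partial>M \<partial>M)"
    by (rule nn_integral_indep_set[OF RW sp(4,3) m(5,3), of "\<lambda>\<rho> u. \<integral>\<^sup>+ \<omega>''. H u \<rho> (Z \<omega>'') \<partial>M", symmetric]) measurable
  finally show ?thesis .
qed

end

lemma tem_pre_measurable:
  assumes f: "\<And>i. continuous_on UNIV (\<lambda>x. f x i)" and g: "\<And>i. continuous_on UNIV (\<lambda>x. g x i)"
    and "\<And>j. j \<le> k \<Longrightarrow> B (real j * \<Delta>) \<in> borel_measurable N"
    and "\<And>j. j \<le> k \<Longrightarrow> r (real j * \<Delta>) \<in> N \<rightarrow>\<^sub>M count_space (UNIV :: 's::finite set)"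
  shows "tem_pre f g \<phi>inv h B r x0 \<Delta> k \<in> borel_measurable N"
  using assms(3,4)
proof (induction k)
  case 0
  then show ?case by simp
next
  case (Suc k)
  have [measurable]: "tem_pre f g \<phi>inv h B r x0 \<Delta> k \<in> borel_measurable N" using Suc by auto
  have [measurable]: "B (real k * \<Delta>) \<in> borel_measurable N" "B (real (Suc k) * \<Delta>) \<in> borel_measurable N"
    "r (real k * \<Delta>) \<in> N \<rightarrow>\<^sub>M count_space UNIV"
    using Suc.prems(1)[of k] Suc.prems(1)[of "Suc k"] Suc.prems(2)[of k] by auto
  have fm: "(\<lambda>\<omega>. f (y \<omega>) i) \<in> borel_measurable N" and gm: "(\<lambda>\<omega>. g (y \<omega>) i) \<in> borel_measurable N"
    if "y \<in> borel_measurable N" for y i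
    using measurable_compose[OF that borel_measurable_continuous_onI[OF f]]
      measurable_compose[OF that borel_measurable_continuous_onI[OF g]] by auto
  define S where "S i x d = (let y = trunc \<phi>inv h \<Delta> i x in y + \<Delta> *\<^sub>R f y i + g y i *v d)" for i x d
  have [measurable]: "(\<lambda>\<omega>. trunc \<phi>inv h \<Delta> i (tem_pre f g \<phi>inv h B r x0 \<Delta> k \<omega>)) \<in> borel_measurable N" for i
    unfolding trunc_def sgn_div_norm by measurable
  note [measurable] = fm[OF this] gm[OF this]
  have "(\<lambda>\<omega>. S i (tem_pre f g \<phi>inv h B r x0 \<Delta> k \<omega>) (B (real (Suc k) * \<Delta>) \<omega> - B (real k * \<Delta>) \<omega>)) \<in> borel_measurable N" for i
    unfolding S_def Let_def by measurable
  then have "(\<lambda>\<omega>. S (r (real k * \<Delta>) \<omega>) (tem_pre f g \<phi>inv h B r x0 \<Delta> k \<omega>)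
      (B (real (Suc k) * \<Delta>) \<omega> - B (real k * \<Delta>) \<omega>)) \<in> borel_measurable N"
    by (rule measurable_compose_countable'[where I = UNIV]) (auto intro: countable_finite)
  then show ?case by (simp add: S_def Let_def cong: measurable_cong)
qed

text \<open>The scheme depends on the noise only through the paths at grid times. As \<open>tem_pre\<close> is polymorphic in the sample space, it can
therefore be run on the path space itself, which exhibits \<open>tem_pre\<close> as a measurable function of
the two paths.\<close>

lemma tem_pre_cong_path:
  assumes "\<And>j. j \<le> k \<Longrightarrow> B (real j * \<Delta>) \<omega> = B' (real j * \<Delta>) \<omega>'"
    and "\<And>j. j < k \<Longrightarrow> r (real j * \<Delta>) \<omega> = r' (real j * \<Delta>) \<omega>'"
  shows "tem_pre f g \<phi>inv h B r x0 \<Delta> k \<omega> = tem_pre f g \<phi>inv h B' r' x0 \<Delta> k \<omega>'"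
  using assms
proof (induction k)
  case (Suc k)
  have "tem_pre f g \<phi>inv h B r x0 \<Delta> k \<omega> = tem_pre f g \<phi>inv h B' r' x0 \<Delta> k \<omega>'"
    using Suc by auto
  then show ?case using Suc.prems(1)[of k] Suc.prems(1)[of "Suc k"] Suc.prems(2)[of k] by simp
qed simp

lemma measurable_select_state:
  fixes H :: "'x::topological_space \<Rightarrow> 's::finite \<Rightarrow> 'z::topological_space \<Rightarrow> ennreal"
  assumes H: "\<And>i. (\<lambda>(x, z). H x i z) \<in> borel_measurable (borel \<Otimes>\<^sub>M borel)"
    and X: "X \<in> borel_measurable N" and I: "I \<in> N \<rightarrow>\<^sub>M count_space UNIV" and Z: "Z \<in> borel_measurable N"
  shows "(\<lambda>\<omega>. H (X \<omega>) (I \<omega>) (Z \<omega>)) \<in> borel_measurable N"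
proof (rule measurable_compose_countable'[where I = UNIV and g = I and f = "\<lambda>i \<omega>. H (X \<omega>) i (Z \<omega>)"])
  fix i
  show "(\<lambda>\<omega>. H (X \<omega>) i (Z \<omega>)) \<in> borel_measurable N"
    using measurable_compose[OF measurable_Pair[OF X Z] H[of i]] by simp
qed (use I in \<open>auto intro: countable_finite\<close>)

context prob_space begin

text \<open>The conditional probability is known only as a real conditional expectation; for an indicator it agrees
almost surely with the nonnegative one, which may be paired with any nonnegative factor.\<close>

lemma nn_integral_cond_prob:
  assumes sub: "subalgebra M N" and A[measurable]: "A \<in> events"
    and c: "AE \<omega> in M. real_cond_exp M N (indicator A) \<omega> = c \<omega>"
    and G: "G \<in> borel_measurable N"
  shows "(\<integral>\<^sup>+ \<omega>. G \<omega> * indicator A \<omega> \<partial>M) = (\<integral>\<^sup>+ \<omega>. G \<omega> * ennreal (c \<omega>) \<partial>M)"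
proof -
  interpret sub: finite_measure_subalgebra M N by unfold_locales (rule sub)
  define n where "n = nn_cond_exp M N (\<lambda>\<omega>. ennreal (indicator A \<omega>))"
  have "AE \<omega> in M. n \<omega> \<le> nn_cond_exp M N (\<lambda>_. 1) \<omega>"
    unfolding n_def by (rule sub.nn_cond_exp_mono) (auto simp: indicator_def)
  moreover have "AE \<omega> in M. 1 = nn_cond_exp M N (\<lambda>_. 1) \<omega>"
    by (rule sub.nn_cond_exp_F_meas) auto
  moreover have "AE \<omega> in M. 0 = nn_cond_exp M N (\<lambda>_. 0) \<omega>"
    by (rule sub.nn_cond_exp_F_meas) auto
  ultimately have n: "AE \<omega> in M. n \<omega> = ennreal (c \<omega>)"
    using c
  proof eventually_elim
    case (elim \<omega>)
    have "(\<lambda>x. ennreal (- indicator A x)) = (\<lambda>_. 0 :: ennreal)"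
      by (auto simp: indicator_def fun_eq_iff ennreal_neg)
    then have "real_cond_exp M N (indicator A) \<omega> = enn2real (n \<omega>)"
      using elim(3) unfolding real_cond_exp_def n_def by simp
    moreover have "n \<omega> < top" using elim(1,2) by (metis ennreal_one_less_top order_le_less_trans)
    ultimately show ?case using elim(4) by simp
  qed
  have "(\<integral>\<^sup>+ \<omega>. G \<omega> * indicator A \<omega> \<partial>M) = (\<integral>\<^sup>+ \<omega>. G \<omega> * n \<omega> \<partial>M)"
    unfolding n_def by (subst sub.nn_cond_exp_intg[OF G]) (auto simp: ennreal_indicator)
  also have "\<dots> = (\<integral>\<^sup>+ \<omega>. G \<omega> * ennreal (c \<omega>) \<partial>M)"
    by (rule nn_integral_cong_AE) (use n in auto)
  finally show ?thesis .
qed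

end

context switching_noise begin

text \<open>The new state \<open>r t\<close> and the increment \<open>B t - B s\<close> cannot be handled by conditioning on \<open>F s\<close> alone: given \<open>F s\<close>,
they need not be independent of each other for a general filtration. So the increment is removed first, using the
independence of the two whole paths, and \<open>F s\<close> is used only for the chain.\<close>

lemma scheme_transition:
  fixes H :: "real ^ 'n \<Rightarrow> 's \<Rightarrow> real ^ 'd \<Rightarrow> ennreal"
    and \<phi>inv :: "'s \<Rightarrow> real \<Rightarrow> ereal" and h :: "real \<Rightarrow> real" and x0 :: "real ^ 'n" and k :: nat and \<Delta> :: real
    and f :: "real ^ 'n \<Rightarrow> 's \<Rightarrow> real ^ 'n" and g :: "real ^ 'n \<Rightarrow> 's \<Rightarrow> real ^ 'd ^ 'n"
  assumes f: "\<And>i. continuous_on UNIV (\<lambda>x. f x i)" and g: "\<And>i. continuous_on UNIV (\<lambda>x. g x i)"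
    and P: "transition_semigroup \<Gamma> P"
    and cond: "\<And>s t j. 0 \<le> s \<Longrightarrow> 0 \<le> t \<Longrightarrow> AE \<omega> in M.
           real_cond_exp M (F s) (indicator {\<omega>\<in>space M. r (s + t) \<omega> = j}) \<omega> = P t $ r s \<omega> $ j"
    and \<Delta>: "0 < \<Delta>" and \<xi>: "\<And>i. 0 \<le> \<xi> $ i"
    and H: "\<And>i. (\<lambda>(x, z). H x i z) \<in> borel_measurable (borel \<Otimes>\<^sub>M borel)"
  defines "X \<equiv> tem_pre f g \<phi>inv h B r x0 \<Delta> k" and "s \<equiv> real k * \<Delta>" and "t \<equiv> real (Suc k) * \<Delta>"
  shows "(\<integral>\<^sup>+ \<omega>. ennreal (\<xi> $ r t \<omega>) * H (X \<omega>) (r s \<omega>) (B t \<omega> - B s \<omega>) \<partial>M)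
    = (\<integral>\<^sup>+ \<omega>. ennreal (\<Sum>j\<in>UNIV. P \<Delta> $ r s \<omega> $ j * \<xi> $ j)
          * (\<integral>\<^sup>+ \<omega>'. H (X \<omega>) (r s \<omega>) (B t \<omega>' - B s \<omega>') \<partial>M) \<partial>M)"
proof -
  have s: "0 \<le> s" and st: "s < t" and ts: "t = s + \<Delta>" using \<Delta> by (auto simp: s_def t_def algebra_simps)
  have sub: "subalgebra M (F a)" if "0 \<le> a" for a using usual that unfolding usual_filtration_def by blast
  have mono: "sets (F a) \<subseteq> sets (F b)" if "0 \<le> a" "a \<le> b" for a b
    using usual that unfolding usual_filtration_def by blast
  have spF: "space (F a) = space M" if "0 \<le> a" for a using sub[OF that] unfolding subalgebra_def by auto
  have BF: "B a \<in> borel_measurable (F b)" if "0 \<le> a" "a \<le> b" for a b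
  proof -
    have "B a \<in> borel_measurable (F a)" using brownian that unfolding brownian_motion_def by auto
    then show ?thesis using mono[OF that] spF that
      by (intro measurable_from_subalg[of "F b" "F a"]) (auto simp: subalgebra_def)
  qed
  have rF: "r a \<in> F b \<rightarrow>\<^sub>M count_space UNIV" if "0 \<le> a" "a \<le> b" for a b
  proof -
    have "r a \<in> F a \<rightarrow>\<^sub>M count_space UNIV" using markov that unfolding markov_chain_def by auto
    then show ?thesis using mono[OF that] spF that
      by (intro measurable_from_subalg[of "F b" "F a"]) (auto simp: subalgebra_def)
  qed
  have BM [measurable]: "B s \<in> borel_measurable M" "B t \<in> borel_measurable M"
    using measurable_from_subalg[OF sub BF, of s s] measurable_from_subalg[OF sub BF, of t t] s st by auto
  have rM [measurable]: "r s \<in> M \<rightarrow>\<^sub>M count_space UNIV" "r t \<in> M \<rightarrow>\<^sub>M count_space UNIV"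
    using measurable_from_subalg[OF sub rF, of s s] measurable_from_subalg[OF sub rF, of t t] s st by auto
  have step: "0 \<le> real j * \<Delta>" "j \<le> k \<Longrightarrow> real j * \<Delta> \<le> s" for j
    using \<Delta> by (auto simp: s_def intro: mult_right_mono)
  have XF: "X \<in> borel_measurable (F s)"
    unfolding X_def by (rule tem_pre_measurable[OF f g]) (auto intro!: BF rF step)
  have [measurable]: "X \<in> borel_measurable M" by (rule measurable_from_subalg[OF sub[OF s] XF])
  define Z where "Z \<omega> = B t \<omega> - B s \<omega>" for \<omega>
  have [measurable]: "Z \<in> borel_measurable M" unfolding Z_def by measurable
  define A where "A = (\<Pi>\<^sub>M a\<in>{0..s}. (borel :: (real ^ 'd) measure))"
  define D where "D = (\<Pi>\<^sub>M a\<in>{0::real..}. count_space (UNIV :: 's set))"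
  define VW where "VW = vimage_algebra (space M) (\<lambda>\<omega>. \<lambda>t\<in>{0..}. B t \<omega>) (\<Pi>\<^sub>M t\<in>{0..}. borel)"
  define VR where "VR = vimage_algebra (space M) (\<lambda>\<omega>. \<lambda>t\<in>{0..}. r t \<omega>) D"
  define VZ where "VZ = vimage_algebra (space M) Z borel"
  define U where "U \<omega> = (\<lambda>a\<in>{0..s}. B a \<omega>)" for \<omega>
  define R where "R \<omega> = (\<lambda>a\<in>{0..}. r a \<omega>)" for \<omega>
  have i1: "indep_set (sets (F s)) (sets VZ)"
    using brownian s st unfolding brownian_motion_def VZ_def Z_def[abs_def] by blast
  have i2: "indep_set (sets VW) (sets VR)" using indep_noise unfolding VW_def VR_def D_def .
  have sp: "space (F s) = space M" "space VZ = space M" "space VW = space M" "space VR = space M"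
    by (simp_all add: spF[OF s] VZ_def VW_def VR_def)
  have VWB: "B a \<in> borel_measurable VW" if "0 \<le> a" for a
  proof -
    have "(\<lambda>\<omega>. \<lambda>t\<in>{0..}. B t \<omega>) \<in> VW \<rightarrow>\<^sub>M (\<Pi>\<^sub>M t\<in>{0..}. borel)"
      unfolding VW_def by (rule measurable_vimage_algebra1) (auto simp: space_PiM)
    from measurable_compose[OF this measurable_component_singleton[of a "{0..}"]] that show ?thesis by simp
  qed
  have m1: "U \<in> F s \<rightarrow>\<^sub>M A" unfolding U_def A_def by (rule measurable_restrict) (auto intro: BF)
  have m2: "Z \<in> borel_measurable VZ" unfolding VZ_def by (rule measurable_vimage_algebra1) auto
  have m3: "U \<in> VW \<rightarrow>\<^sub>M A" unfolding U_def A_def by (rule measurable_restrict) (auto intro: VWB)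
  have m4: "Z \<in> borel_measurable VW" unfolding Z_def[abs_def] using VWB s st by (intro borel_measurable_diff) auto
  have m5: "R \<in> VR \<rightarrow>\<^sub>M D"
    unfolding VR_def R_def[abs_def] by (rule measurable_vimage_algebra1) (auto simp: D_def space_PiM)
  define Y where "Y u \<rho> = tem_pre f g \<phi>inv h (\<lambda>a p. fst p a) (\<lambda>a p. snd p a) x0 \<Delta> k (u, \<rho>)"
    for u :: "real \<Rightarrow> real ^ 'd" and \<rho> :: "real \<Rightarrow> 's"
  have XY: "X \<omega> = Y (U \<omega>) (R \<omega>)" for \<omega>
    unfolding X_def Y_def by (rule tem_pre_cong_path) (auto simp: U_def R_def step)
  have Rr: "R \<omega> a = r a \<omega>" if "0 \<le> a" for a \<omega> using that by (simp add: R_def)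
  have Ym: "(\<lambda>p. Y (fst p) (snd (snd p))) \<in> borel_measurable (A \<Otimes>\<^sub>M borel \<Otimes>\<^sub>M D)"
  proof -
    have "(\<lambda>q. Y (fst q) (snd q)) \<in> borel_measurable (A \<Otimes>\<^sub>M D)"
      unfolding Y_def prod.collapse
    proof (rule tem_pre_measurable[OF f g])
      fix j assume "j \<le> k"
      then have j: "real j * \<Delta> \<in> {0..s}" "real j * \<Delta> \<in> {0..}" using step by auto
      show "(\<lambda>p. fst p (real j * \<Delta>)) \<in> borel_measurable (A \<Otimes>\<^sub>M D)"
        unfolding A_def by (rule measurable_compose[OF measurable_fst measurable_component_singleton[OF j(1)]])
      show "(\<lambda>p. snd p (real j * \<Delta>)) \<in> A \<Otimes>\<^sub>M D \<rightarrow>\<^sub>M count_space UNIV"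
        unfolding D_def by (rule measurable_compose[OF measurable_snd measurable_component_singleton[OF j(2)]])
    qed
    from measurable_compose[OF _ this, of "\<lambda>p. (fst p, snd (snd p))" "A \<Otimes>\<^sub>M borel \<Otimes>\<^sub>M D"]
    show ?thesis by simp
  qed
  have Dm [measurable]: "(\<lambda>p. snd (snd p) a) \<in> A \<Otimes>\<^sub>M borel \<Otimes>\<^sub>M D \<rightarrow>\<^sub>M count_space UNIV" if "0 \<le> a" for a
    unfolding D_def
    by (rule measurable_compose[OF _ measurable_component_singleton[of a "{0..}"]]) (use that in auto)
  have Hm: "(\<lambda>(u, z, \<rho>). ennreal (\<xi> $ \<rho> t) * H (Y u \<rho>) (\<rho> s) z) \<in> borel_measurable (A \<Otimes>\<^sub>M borel \<Otimes>\<^sub>M D)"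
    unfolding case_prod_beta'
  proof (rule borel_measurable_times_ennreal)
    show "(\<lambda>p. ennreal (\<xi> $ snd (snd p) t)) \<in> borel_measurable (A \<Otimes>\<^sub>M borel \<Otimes>\<^sub>M D)"
      by (rule measurable_compose[OF Dm]) (use s st in auto)
    show "(\<lambda>p. H (Y (fst p) (snd (snd p))) (snd (snd p) s) (fst (snd p))) \<in> borel_measurable (A \<Otimes>\<^sub>M borel \<Otimes>\<^sub>M D)"
      by (rule measurable_select_state[OF H Ym Dm[OF s]]) measurable
  qed
  \<comment> \<open>\<open>U\<close> is the Brownian path up to \<open>s\<close>; \<open>R\<close> is the whole path of the chain and so includes the state at time \<open>t\<close>.\<close>
  have freeze: "(\<integral>\<^sup>+ \<omega>. ennreal (\<xi> $ r t \<omega>) * H (X \<omega>) (r s \<omega>) (Z \<omega>) \<partial>M)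
    = (\<integral>\<^sup>+ \<omega>. \<integral>\<^sup>+ \<omega>'. ennreal (\<xi> $ r t \<omega>) * H (X \<omega>) (r s \<omega>) (Z \<omega>') \<partial>M \<partial>M)"
    using nn_integral_freeze[OF i1 i2 sp m1 m2 m3 m4 m5, where H = "\<lambda>u \<rho> z. ennreal (\<xi> $ \<rho> t) * H (Y u \<rho>) (\<rho> s) z"] Hm s st
    by (simp add: XY[symmetric] Rr)
  define G where "G \<omega> = (\<integral>\<^sup>+ \<omega>'. H (X \<omega>) (r s \<omega>) (Z \<omega>') \<partial>M)" for \<omega>
  have Gs: "(\<lambda>x. \<integral>\<^sup>+ \<omega>'. H x i (Z \<omega>') \<partial>M) \<in> borel_measurable borel" for i
  proof (rule borel_measurable_nn_integral)
    show "(\<lambda>(x, \<omega>'). H x i (Z \<omega>')) \<in> borel_measurable (borel \<Otimes>\<^sub>M M)"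
    proof -
      have "(\<lambda>p. (fst p, Z (snd p))) \<in> borel \<Otimes>\<^sub>M M \<rightarrow>\<^sub>M borel \<Otimes>\<^sub>M borel" by measurable
      from measurable_compose[OF this H[of i]] show ?thesis by (simp add: case_prod_beta')
    qed
  qed
  have GF: "G \<in> borel_measurable (F s)"
    unfolding G_def
    by (rule measurable_compose_countable'[where I = UNIV and g = "r s" and f = "\<lambda>i \<omega>. \<integral>\<^sup>+ \<omega>'. H (X \<omega>) i (Z \<omega>') \<partial>M"])
      (auto intro!: measurable_compose[OF XF Gs] rF s countable_finite)
  note [measurable] = measurable_from_subalg[OF sub[OF s] GF]
  have ev: "{\<omega> \<in> space M. r t \<omega> = j} \<in> events" for j by measurable
  have "(\<integral>\<^sup>+ \<omega>. ennreal (\<xi> $ r t \<omega>) * H (X \<omega>) (r s \<omega>) (Z \<omega>) \<partial>M) = (\<integral>\<^sup>+ \<omega>. ennreal (\<xi> $ r t \<omega>) * G \<omega> \<partial>M)"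
  proof -
    have "(\<integral>\<^sup>+ \<omega>'. ennreal (\<xi> $ r t \<omega>) * H (X \<omega>) (r s \<omega>) (Z \<omega>') \<partial>M) = ennreal (\<xi> $ r t \<omega>) * G \<omega>" for \<omega>
      unfolding G_def by (rule nn_integral_cmult, rule measurable_select_state[OF H]) auto
    then show ?thesis unfolding freeze by simp
  qed
  also have "\<dots> = (\<integral>\<^sup>+ \<omega>. (\<Sum>j\<in>UNIV. ennreal (\<xi> $ j) * (G \<omega> * indicator {\<omega>\<in>space M. r t \<omega> = j} \<omega>)) \<partial>M)"
  proof (rule nn_integral_cong)
    fix \<omega> assume "\<omega> \<in> space M"
    then have "(\<Sum>j\<in>UNIV. ennreal (\<xi> $ j) * (G \<omega> * indicator {\<omega>\<in>space M. r t \<omega> = j} \<omega>))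
       = (\<Sum>j\<in>UNIV. if j = r t \<omega> then ennreal (\<xi> $ j) * G \<omega> else 0)"
      by (intro sum.cong) (auto simp: indicator_def)
    then show "ennreal (\<xi> $ r t \<omega>) * G \<omega> = (\<Sum>j\<in>UNIV. ennreal (\<xi> $ j) * (G \<omega> * indicator {\<omega>\<in>space M. r t \<omega> = j} \<omega>))"
      by simp
  qed
  also have "\<dots> = (\<Sum>j\<in>UNIV. ennreal (\<xi> $ j) * (\<integral>\<^sup>+ \<omega>. G \<omega> * indicator {\<omega>\<in>space M. r t \<omega> = j} \<omega> \<partial>M))"
    using ev by (subst nn_integral_sum) (auto simp: nn_integral_cmult)
  also have "\<dots> = (\<Sum>j\<in>UNIV. ennreal (\<xi> $ j) * (\<integral>\<^sup>+ \<omega>. G \<omega> * ennreal (P \<Delta> $ r s \<omega> $ j) \<partial>M))"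
    by (intro sum.cong refl arg_cong2[where f = "(*)"] nn_integral_cond_prob[OF sub[OF s] ev _ GF])
      (use cond[OF s less_imp_le[OF \<Delta>]] in \<open>simp add: ts\<close>)
  also have "\<dots> = (\<integral>\<^sup>+ \<omega>. (\<Sum>j\<in>UNIV. ennreal (\<xi> $ j) * (G \<omega> * ennreal (P \<Delta> $ r s \<omega> $ j))) \<partial>M)"
  proof -
    have [measurable]: "(\<lambda>\<omega>. ennreal (P \<Delta> $ r s \<omega> $ j)) \<in> borel_measurable M" for j
      by (rule measurable_compose[OF rM(1)]) auto
    show ?thesis by (subst nn_integral_sum) (auto simp: nn_integral_cmult)
  qed
  also have "\<dots> = (\<integral>\<^sup>+ \<omega>. ennreal (\<Sum>j\<in>UNIV. P \<Delta> $ r s \<omega> $ j * \<xi> $ j) * G \<omega> \<partial>M)"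
  proof (rule nn_integral_cong)
    fix \<omega>
    have "0 \<le> P \<Delta> $ i $ j" for i j using P \<Delta> unfolding transition_semigroup_def by auto
    then show "(\<Sum>j\<in>UNIV. ennreal (\<xi> $ j) * (G \<omega> * ennreal (P \<Delta> $ r s \<omega> $ j)))
       = ennreal (\<Sum>j\<in>UNIV. P \<Delta> $ r s \<omega> $ j * \<xi> $ j) * G \<omega>"
      using \<xi> by (simp add: sum_distrib_left ennreal_mult ac_simps flip: sum_ennreal)
  qed
  finally show ?thesis unfolding Z_def G_def .
qed

end

section \<open>Coefficients, truncation and transition semigroup\<close>

text \<open>This is \<open>P(t) = I + t\<Gamma> + o(t)\<close> applied to \<open>\<xi>\<close>.\<close>

lemma semigroup_drift:
  fixes \<xi> :: "real ^ 's::finite"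
  assumes P: "transition_semigroup \<Gamma> P" and \<epsilon>: "0 < \<epsilon>"
  shows "\<forall>\<^sub>F t in at_right 0. \<forall>i. (\<Sum>j\<in>UNIV. P t $ i $ j * \<xi> $ j) \<le> \<xi> $ i + t * ((\<Gamma> *v \<xi>) $ i + \<epsilon>)"
proof (rule eventually_all_finite)
  fix i
  have lin: "bounded_linear (\<lambda>A :: real ^ 's ^ 's. (A *v \<xi>) $ i)"
    unfolding matrix_vector_mult_def
    by (simp, intro bounded_linear_sum bounded_linear_compose[OF bounded_linear_mult_left]
       bounded_linear_compose[OF bounded_linear_vec_nth] bounded_linear_vec_nth)
  have "((\<lambda>t. (P t *v \<xi>) $ i) has_vector_derivative (\<Gamma> *v \<xi>) $ i) (at 0 within {0..})"
    using P unfolding transition_semigroup_def by (auto intro: bounded_linear.has_vector_derivative[OF lin])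
  then have "((\<lambda>t. (P t *v \<xi>) $ i) has_field_derivative (\<Gamma> *v \<xi>) $ i) (at 0 within {0..})"
    by (simp add: has_real_derivative_iff_has_vector_derivative)
  then have "((\<lambda>t. ((P t *v \<xi>) $ i - (P 0 *v \<xi>) $ i) / (t - 0)) \<longlongrightarrow> (\<Gamma> *v \<xi>) $ i) (at 0 within {0..})"
    unfolding has_field_derivative_iff .
  moreover have "P 0 = mat 1" using P unfolding transition_semigroup_def by auto
  ultimately have "((\<lambda>t. ((P t *v \<xi>) $ i - \<xi> $ i) / t) \<longlongrightarrow> (\<Gamma> *v \<xi>) $ i) (at 0 within {0..})"
    by simp
  then have "((\<lambda>t. ((P t *v \<xi>) $ i - \<xi> $ i) / t) \<longlongrightarrow> (\<Gamma> *v \<xi>) $ i) (at_right 0)"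
    by (rule tendsto_mono[rotated]) (rule at_le, auto)
  then have "\<forall>\<^sub>F t in at_right 0. ((P t *v \<xi>) $ i - \<xi> $ i) / t < (\<Gamma> *v \<xi>) $ i + \<epsilon>"
    by (rule order_tendstoD) (use \<epsilon> in simp)
  moreover have "\<forall>\<^sub>F t in at_right 0. (0 :: real) < t" by (rule eventually_at_right_less)
  ultimately show "\<forall>\<^sub>F t in at_right 0. (\<Sum>j\<in>UNIV. P t $ i $ j * \<xi> $ j) \<le> \<xi> $ i + t * ((\<Gamma> *v \<xi>) $ i + \<epsilon>)"
    by eventually_elim (simp add: matrix_vector_mult_def field_simps)
qed

lemma locally_lipschitz_continuous:
  fixes F :: "real ^ 'n \<Rightarrow> 'b::metric_space"
  assumes "locally_lipschitz F"
  shows "continuous_on UNIV F"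
proof (rule continuous_at_imp_continuous_on, rule ballI)
  fix x :: "real ^ 'n"
  obtain L where "L-lipschitz_on (cball 0 (norm x + 1)) F"
    using assms unfolding locally_lipschitz_def by (metis add_nonneg_pos norm_ge_zero zero_less_one)
  then have "continuous_on (cball 0 (norm x + 1)) F" by (rule lipschitz_on_continuous_on)
  moreover have "x \<in> interior (cball 0 (norm x + 1))" by simp
  ultimately show "isCont F x" by (rule continuous_on_interior)
qed

text \<open>The truncation scales \<open>x\<close> by a factor in \<open>[0,1]\<close>, which is all that the Lyapunov function sees of it.\<close>

lemma trunc_shrinks:
  assumes "0 \<le> \<phi>inv i (h \<Delta>)"
  shows "\<exists>c. 0 \<le> c \<and> c \<le> 1 \<and> trunc \<phi>inv h \<Delta> i x = c *\<^sub>R x" "ereal (norm (trunc \<phi>inv h \<Delta> i x)) \<le> \<phi>inv i (h \<Delta>)"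
proof -
  define m where "m = real_of_ereal (min (ereal (norm x)) (\<phi>inv i (h \<Delta>)))"
  have "ereal m = min (ereal (norm x)) (\<phi>inv i (h \<Delta>))"
    unfolding m_def using assms by (intro ereal_real') (cases "\<phi>inv i (h \<Delta>)"; auto simp: min_def)
  then have m: "0 \<le> m" "m \<le> norm x" "ereal m \<le> \<phi>inv i (h \<Delta>)"
    using assms by (metis ereal_less_eq(5) min.boundedI norm_ge_zero, metis ereal_less_eq(3) min.cobounded1, metis min.cobounded2)
  have t: "trunc \<phi>inv h \<Delta> i x = (m / norm x) *\<^sub>R x"
    by (simp add: trunc_def m_def sgn_div_norm divide_inverse)
  then show "\<exists>c. 0 \<le> c \<and> c \<le> 1 \<and> trunc \<phi>inv h \<Delta> i x = c *\<^sub>R x"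
    using m by (intro exI[of _ "m / norm x"]) (auto simp: divide_le_eq)
  have "norm (trunc \<phi>inv h \<Delta> i x) \<le> m" unfolding t using m by auto
  with m(3) show "ereal (norm (trunc \<phi>inv h \<Delta> i x)) \<le> \<phi>inv i (h \<Delta>)"
    by (metis ereal_less_eq(3) order_trans)
qed

text \<open>For a strictly increasing growth function \<open>h \<Delta>\<close> is a value \<open>\<phi>(u)\<close> by the intermediate value theorem, and the
truncated point lies in the ball of radius \<open>u\<close>. In the case of linear growth nothing is truncated and the bound holds
everywhere.\<close>

lemma truncated_growth:
  assumes gr: "growth_fun a b \<phi> (\<phi>inv i)" and v: "1 \<le> v" "\<phi> v \<le> h \<Delta>"
  shows "0 \<le> \<phi>inv i (h \<Delta>)"
    and "norm (a (trunc \<phi>inv h \<Delta> i x)) \<le> h \<Delta> * (1 + norm (trunc \<phi>inv h \<Delta> i x))"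
    and "(norm (b (trunc \<phi>inv h \<Delta> i x)))\<^sup>2 \<le> h \<Delta> * (1 + norm (trunc \<phi>inv h \<Delta> i x))\<^sup>2"
proof -
  let ?y = "trunc \<phi>inv h \<Delta> i x"
  have "0 \<le> \<phi>inv i (h \<Delta>) \<and> (0 \<le> \<phi>inv i (h \<Delta>) \<longrightarrow>
    norm (a ?y) \<le> h \<Delta> * (1 + norm ?y) \<and> (norm (b ?y))\<^sup>2 \<le> h \<Delta> * (1 + norm ?y)\<^sup>2)"
    using gr unfolding growth_fun_def
  proof (elim disjE conjE exE)
    assume cont: "continuous_on {1..} \<phi>" and lim: "filterlim \<phi> at_top at_top"
      and bd: "\<forall>u\<ge>1. \<forall>x. norm x \<le> u \<longrightarrow> max (norm (a x) / (1 + norm x)) ((norm (b x))\<^sup>2 / (1 + norm x)\<^sup>2) \<le> \<phi> u"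
      and inv: "\<forall>u\<ge>1. \<phi>inv i (\<phi> u) = ereal u"
    have "\<forall>\<^sub>F w in at_top. h \<Delta> \<le> \<phi> w" using lim unfolding filterlim_at_top by auto
    then have "\<forall>\<^sub>F w in at_top. h \<Delta> \<le> \<phi> w \<and> v \<le> w" using eventually_ge_at_top by (rule eventually_conj)
    then obtain w where w: "h \<Delta> \<le> \<phi> w" "v \<le> w" unfolding eventually_at_top_linorder by blast
    have "\<exists>u\<ge>v. u \<le> w \<and> \<phi> u = h \<Delta>"
      using v w by (intro IVT') (auto intro: continuous_on_subset[OF cont])
    then obtain u where "v \<le> u" "\<phi> u = h \<Delta>" by blast
    then have u: "1 \<le> u" "\<phi> u = h \<Delta>" using v by auto
    then have iu: "\<phi>inv i (h \<Delta>) = ereal u" using inv by metis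
    show ?thesis
    proof (intro conjI impI)
      show pos: "0 \<le> \<phi>inv i (h \<Delta>)" using u by (simp add: iu)
      have "norm ?y \<le> u" using trunc_shrinks(2)[where \<phi>inv = \<phi>inv and i = i and h = h and \<Delta> = \<Delta>, OF pos] by (simp add: iu)
      then have "norm (a ?y) / (1 + norm ?y) \<le> h \<Delta>" "(norm (b ?y))\<^sup>2 / (1 + norm ?y)\<^sup>2 \<le> h \<Delta>"
        using bd u by (metis max.bounded_iff)+
      moreover have "0 < 1 + norm ?y" by (simp add: add_pos_nonneg)
      ultimately show "norm (a ?y) \<le> h \<Delta> * (1 + norm ?y)" "(norm (b ?y))\<^sup>2 \<le> h \<Delta> * (1 + norm ?y)\<^sup>2"
        by (simp_all add: divide_le_eq)
    qed
  next
    fix C assume bd: "\<forall>x. norm (a x) \<le> C * (1 + norm x) \<and> (norm (b x))\<^sup>2 \<le> C * (1 + norm x)\<^sup>2"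
      and C: "\<forall>u\<ge>1. \<phi> u = C" and inv: "\<forall>v\<ge>C. \<phi>inv i v = \<infinity>"
    have Ch: "C \<le> h \<Delta>" using C v by auto
    have "norm (a ?y) \<le> C * (1 + norm ?y)" "(norm (b ?y))\<^sup>2 \<le> C * (1 + norm ?y)\<^sup>2" using bd by auto
    moreover have "C * (1 + norm ?y) \<le> h \<Delta> * (1 + norm ?y)" "C * (1 + norm ?y)\<^sup>2 \<le> h \<Delta> * (1 + norm ?y)\<^sup>2"
      using Ch by (auto intro: mult_right_mono)
    ultimately show ?thesis using inv Ch by auto
  qed
  then show "0 \<le> \<phi>inv i (h \<Delta>)" "norm (a ?y) \<le> h \<Delta> * (1 + norm ?y)" "(norm (b ?y))\<^sup>2 \<le> h \<Delta> * (1 + norm ?y)\<^sup>2"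
    by auto
qed

text \<open>Far out, the limsup hypothesis applies; replacing \<open>x\<^sup>TQx\<close> by \<open>1 + x\<^sup>TQx\<close> in the denominator changes the quotient by a factor
tending to \<open>1\<close>, and passing from \<open>pbar\<close> to \<open>p\<close> only decreases it. On the remaining ball everything is continuous,
hence bounded, and goes into \<open>C\<close>.\<close>

lemma khasminskii_drift_bound:
  fixes Q :: "real ^ 'n ^ 'n" and f :: "real ^ 'n \<Rightarrow> 's \<Rightarrow> real ^ 'n" and g :: "real ^ 'n \<Rightarrow> 's \<Rightarrow> real ^ 'd ^ 'n"
  assumes Q: "sym_pos_def Q" and f: "continuous_on UNIV (\<lambda>x. f x i)" and g: "continuous_on UNIV (\<lambda>x. g x i)"
    and limsup: "Limsup at_infinity (\<lambda>x. ereal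
          (((1 + quad_form Q x) * psi Q f g x i - (2 - pbar) * (norm ((x v* Q) v* g x i))\<^sup>2)
             / (quad_form Q x)\<^sup>2)) \<le> ereal \<alpha>"
    and p: "p \<le> pbar" and \<epsilon>: "0 < \<epsilon>"
  shows "\<exists>C\<ge>0. \<forall>y. (1 + quad_form Q y) powr q *
      (psi Q f g y i / (1 + quad_form Q y) - (2 - p) * (norm ((y v* Q) v* g y i))\<^sup>2 / (1 + quad_form Q y)\<^sup>2)
      \<le> (\<alpha> + \<epsilon>) * (1 + quad_form Q y) powr q + C"
proof -
  define u where "u y = 1 + quad_form Q y" for y
  define W where "W y = (norm ((y v* Q) v* g y i))\<^sup>2" for y
  define E where "E y = psi Q f g y i / u y - (2 - p) * W y / (u y)\<^sup>2" for y
  have u: "1 \<le> u y" for y using sym_pos_def_nonneg[OF Q, of y] by (simp add: u_def)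
  define \<alpha>' where "\<alpha>' = \<alpha> + \<epsilon> / 2"
  obtain c1 where c1: "0 < c1" "\<And>x. c1 * (norm x)\<^sup>2 \<le> quad_form Q x"
    using sym_pos_def_coercive[OF Q] by blast
  have "\<forall>\<^sub>F x in at_infinity. ereal (((1 + quad_form Q x) * psi Q f g x i - (2 - pbar) * W x)
             / (quad_form Q x)\<^sup>2) < ereal \<alpha>'"
    unfolding W_def by (rule Limsup_lessD, rule order_le_less_trans[OF limsup]) (use \<epsilon> in \<open>simp add: \<alpha>'_def\<close>)
  then obtain b where b: "\<And>x. b \<le> norm x \<Longrightarrow> (u x * psi Q f g x i - (2 - pbar) * W x) / (quad_form Q x)\<^sup>2 < \<alpha>'"
    unfolding eventually_at_infinity u_def by auto
  \<comment> \<open>Beyond this value of \<open>x\<^sup>TQx\<close> the change of denominator costs at most \<open>\<epsilon>/2\<close>.\<close>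
  define v0 where "v0 = 4 * \<bar>\<alpha>'\<bar> / \<epsilon>"
  define R where "R = \<bar>b\<bar> + 1 + v0 / c1"
  have v0: "0 \<le> v0" using \<epsilon> by (simp add: v0_def)
  have far: "E y \<le> \<alpha> + \<epsilon>" if y: "R \<le> norm y" for y
  proof -
    define v where "v = quad_form Q y"
    have uv: "u y = 1 + v" by (simp add: u_def v_def)
    have R: "1 \<le> R" "v0 / c1 \<le> R" "b \<le> R" using divide_nonneg_pos[OF v0 c1(1)] unfolding R_def by linarith+
    have "norm y * 1 \<le> norm y * norm y" using y R by (intro mult_left_mono) auto
    then have "R \<le> (norm y)\<^sup>2" using y by (simp add: power2_eq_square)
    then have "v0 / c1 \<le> (norm y)\<^sup>2" using R by simp
    then have "v0 \<le> c1 * (norm y)\<^sup>2" using c1 by (simp add: field_simps)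
    then have vv: "v0 \<le> v" using c1(2)[of y] by (simp add: v_def)
    have "0 < c1 * (norm y)\<^sup>2" using c1(1) y R by (intro mult_pos_pos zero_less_power) linarith+
    then have v: "0 < v" using c1(2)[of y] by (simp add: v_def)
    have N: "(u y * psi Q f g y i - (2 - pbar) * W y) / v\<^sup>2 < \<alpha>'" unfolding v_def using b y R by simp
    have "E y = (u y * psi Q f g y i - (2 - p) * W y) / (u y)\<^sup>2"
      unfolding E_def using u[of y] by (simp add: field_simps power2_eq_square)
    also have "\<dots> \<le> (u y * psi Q f g y i - (2 - pbar) * W y) / (u y)\<^sup>2"
      using p by (intro divide_right_mono diff_left_mono mult_right_mono) (auto simp: W_def)
    also have "\<dots> \<le> \<alpha>' * v\<^sup>2 / (u y)\<^sup>2"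
      using N v by (intro divide_right_mono) (auto simp: divide_less_eq)
    also have "\<dots> \<le> \<alpha>' + \<epsilon> / 2"
    proof -
      have "\<alpha>' * v\<^sup>2 - \<alpha>' * (u y)\<^sup>2 = - \<alpha>' * (2 * v + 1)" by (simp add: uv power2_eq_square algebra_simps)
      also have "\<dots> \<le> \<bar>\<alpha>'\<bar> * (2 * v + 1)" using v by (intro mult_right_mono) auto
      also have "\<dots> \<le> \<bar>\<alpha>'\<bar> * (2 * (1 + v))" by (intro mult_left_mono) auto
      also have "\<dots> = (v0 * \<epsilon> / 2) * (1 + v)" using \<epsilon> by (simp add: v0_def)
      also have "\<dots> \<le> ((1 + v) * \<epsilon> / 2) * (1 + v)" using vv v \<epsilon> by (intro mult_right_mono divide_right_mono) auto
      finally have "\<alpha>' * v\<^sup>2 \<le> (\<alpha>' + \<epsilon> / 2) * (u y)\<^sup>2" by (simp add: uv power2_eq_square algebra_simps)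
      then show ?thesis using u[of y] by (simp add: divide_le_eq)
    qed
    finally show ?thesis by (simp add: \<alpha>'_def)
  qed
  have fc: "continuous_on UNIV (\<lambda>y. f y i $ j)" and gc: "continuous_on UNIV (\<lambda>y. g y i $ j $ k)" for j k
    by (intro continuous_intros f, intro continuous_intros g)
  have uc: "continuous_on UNIV u"
    unfolding u_def by (intro continuous_intros linear_continuous_on matrix_vector_mul_bounded_linear)
  have Wc: "continuous_on UNIV W"
    unfolding W_def vector_matrix_mult_def
    by (intro continuous_intros continuous_on_vec_lambda g)
  have pc: "continuous_on UNIV (\<lambda>y. psi Q f g y i)"
    unfolding psi_def trace_def matrix_matrix_mult_def transpose_def matrix_vector_mult_def inner_vec_def
    by simp (intro continuous_intros gc fc)
  have "continuous_on UNIV (\<lambda>y. u y powr q * (E y - (\<alpha> + \<epsilon>)))"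
    unfolding E_def using u
    by (intro continuous_intros uc Wc pc) (auto simp: less_le_trans[OF zero_less_one] intro!: less_imp_neq[symmetric])
  then have "compact ((\<lambda>y. u y powr q * (E y - (\<alpha> + \<epsilon>))) ` cball 0 R)"
    by (intro compact_continuous_image) (auto intro: continuous_on_subset)
  then obtain C where "\<forall>y\<in>cball 0 R. \<bar>u y powr q * (E y - (\<alpha> + \<epsilon>))\<bar> \<le> C"
    by (auto dest!: compact_imp_bounded simp: bounded_iff)
  then have C: "norm y \<le> R \<Longrightarrow> \<bar>u y powr q * (E y - (\<alpha> + \<epsilon>))\<bar> \<le> C" for y by auto
  have "u y powr q * E y \<le> (\<alpha> + \<epsilon>) * u y powr q + \<bar>C\<bar>" for y
  proof (cases "norm y \<le> R")
    case True
    then show ?thesis using C[of y] by (simp add: algebra_simps)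
  next
    case False
    then have "u y powr q * E y \<le> u y powr q * (\<alpha> + \<epsilon>)" using far by (intro mult_left_mono) auto
    then show ?thesis by (simp add: mult.commute)
  qed
  then show ?thesis unfolding E_def W_def u_def by (intro exI[of _ "\<bar>C\<bar>"]) auto
qed

text \<open>The first-order coefficient \<open>A + \<xi>B\<close> is negative; half of it absorbs the second-order term for small \<open>t\<close>.\<close>

lemma contraction_rate:
  fixes \<xi> A B :: "'s::finite \<Rightarrow> real"
  assumes \<xi>: "\<And>i. 0 < \<xi> i" and neg: "\<And>i. A i + \<xi> i * B i < 0"
  shows "\<exists>c>0. \<forall>\<^sub>F t in at_right 0. \<forall>i. (\<xi> i + t * A i) * (1 + t * B i) \<le> (1 - c * t) * \<xi> i"
proof -
  define D where "D i = - (A i + \<xi> i * B i)" for i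
  have D: "0 < D i" for i using neg[of i] by (simp add: D_def)
  define c where "c = Min (range (\<lambda>i. D i / (2 * \<xi> i)))"
  have c: "0 < c" unfolding c_def using D \<xi> by (subst Min_gr_iff) auto
  have cD: "c * \<xi> i \<le> D i / 2" for i
  proof -
    have "c \<le> D i / (2 * \<xi> i)" unfolding c_def by (rule Min_le) auto
    then show ?thesis using \<xi>[of i] by (simp add: field_simps)
  qed
  have "\<forall>\<^sub>F t in at_right 0. \<forall>i. (\<xi> i + t * A i) * (1 + t * B i) \<le> (1 - c * t) * \<xi> i"
  proof (rule eventually_all_finite)
    fix i
    have "((\<lambda>t. t * (A i * B i)) \<longlongrightarrow> 0 * (A i * B i)) (at_right 0)" by (intro tendsto_intros)
    then have "\<forall>\<^sub>F t in at_right 0. t * (A i * B i) < D i / 2"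
      using D[of i] by (intro order_tendstoD) auto
    moreover have "\<forall>\<^sub>F t in at_right 0. (0 :: real) < t" by (rule eventually_at_right_less)
    ultimately show "\<forall>\<^sub>F t in at_right 0. (\<xi> i + t * A i) * (1 + t * B i) \<le> (1 - c * t) * \<xi> i"
    proof eventually_elim
      case (elim t)
      have "t * (t * (A i * B i) + c * \<xi> i) \<le> t * D i" using elim cD[of i] by (intro mult_left_mono) auto
      then show ?case by (simp add: D_def algebra_simps)
    qed
  qed
  with c show ?thesis by blast
qed

section \<open>The moment recursion\<close>

context switching_noise begin

lemma chain_measurable:
  assumes "0 \<le> a"
  shows "r a \<in> M \<rightarrow>\<^sub>M count_space UNIV"
proof (rule measurable_from_subalg)
  show "subalgebra M (F a)" using usual assms unfolding usual_filtration_def by blast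
  show "r a \<in> F a \<rightarrow>\<^sub>M count_space UNIV" using markov assms unfolding markov_chain_def by blast
qed

lemma brownian_measurable:
  assumes "0 \<le> a"
  shows "B a \<in> borel_measurable M"
proof (rule measurable_from_subalg)
  show "subalgebra M (F a)" using usual assms unfolding usual_filtration_def by blast
  show "B a \<in> borel_measurable (F a)" using brownian assms unfolding brownian_motion_def by blast
qed

lemma brownian_gaussian_increment:
  assumes "0 \<le> s" "s < t"
  shows "gaussian_increment (t - s) (\<lambda>\<omega>. B t \<omega> - B s \<omega>)"
  using brownian assms unfolding brownian_motion_def gaussian_increment_def by simp

text \<open>Integrated form of a one-step bound \<open>step\<close> that is uniform over the starting point and state. Since
truncation at the new point can only lower \<open>V\<close>, the untruncated iterate is estimated, and its
dependence on the new state reduces to the factor \<open>\<xi>\<close>.\<close>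

lemma lyapunov_recursion:
  fixes f :: "real ^ 'n \<Rightarrow> 's \<Rightarrow> real ^ 'n" and g :: "real ^ 'n \<Rightarrow> 's \<Rightarrow> real ^ 'd ^ 'n" and Q :: "real ^ 'n ^ 'n"
    and \<phi>inv :: "'s \<Rightarrow> real \<Rightarrow> ereal" and h :: "real \<Rightarrow> real" and x0 :: "real ^ 'n" and \<Delta> c C q :: real and \<xi> :: "real ^ 's"
  assumes f: "\<And>i. continuous_on UNIV (\<lambda>x. f x i)" and g: "\<And>i. continuous_on UNIV (\<lambda>x. g x i)"
    and P: "transition_semigroup \<Gamma> P"
    and cond: "\<And>s t j. 0 \<le> s \<Longrightarrow> 0 \<le> t \<Longrightarrow> AE \<omega> in M.
           real_cond_exp M (F s) (indicator {\<omega>\<in>space M. r (s + t) \<omega> = j}) \<omega> = P t $ r s \<omega> $ j"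
    and \<Delta>: "0 < \<Delta>" and \<xi>: "\<And>i. 0 \<le> \<xi> $ i" and Q: "sym_pos_def Q" and q: "0 < q"
    and inv: "\<And>i. 0 \<le> \<phi>inv i (h \<Delta>)" and c: "c * \<Delta> \<le> 1" and C: "0 \<le> C"
    and step: "\<And>k i x. ennreal (\<Sum>j\<in>UNIV. P \<Delta> $ i $ j * \<xi> $ j) * (\<integral>\<^sup>+ \<omega>. ennreal ((1 + quad_form Q
          (trunc \<phi>inv h \<Delta> i x + \<Delta> *\<^sub>R f (trunc \<phi>inv h \<Delta> i x) i
            + g (trunc \<phi>inv h \<Delta> i x) i *v (B (real (Suc k) * \<Delta>) \<omega> - B (real k * \<Delta>) \<omega>))) powr q) \<partial>M)
        \<le> ennreal ((1 - c * \<Delta>) * (\<xi> $ i * (1 + quad_form Q (trunc \<phi>inv h \<Delta> i x)) powr q) + C * \<Delta>)"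
  defines "V \<equiv> \<lambda>k \<omega>. \<xi> $ r (real k * \<Delta>) \<omega> * (1 + quad_form Q (tem f g \<phi>inv h B r x0 \<Delta> k \<omega>)) powr q"
  shows "V k \<in> borel_measurable M"
    and "(\<integral>\<^sup>+ \<omega>. ennreal (V (Suc k) \<omega>) \<partial>M) \<le> ennreal (1 - c * \<Delta>) * (\<integral>\<^sup>+ \<omega>. ennreal (V k \<omega>) \<partial>M) + ennreal (C * \<Delta>)"
proof -
  let ?T = "\<lambda>i. trunc \<phi>inv h \<Delta> i"
  let ?X = "\<lambda>k. tem_pre f g \<phi>inv h B r x0 \<Delta> k"
  have t0: "0 \<le> real k * \<Delta>" for k using \<Delta> by simp
  note [measurable] = chain_measurable[OF t0]
  have [measurable]: "?X k \<in> borel_measurable M" for k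
    by (rule tem_pre_measurable[OF f g]) (auto intro: brownian_measurable chain_measurable t0)
  have Tm [measurable]: "?T i \<in> borel_measurable borel" for i
    unfolding trunc_def sgn_div_norm by measurable
  have \<xi>m [measurable]: "(\<lambda>\<omega>. \<xi> $ r (real k * \<Delta>) \<omega>) \<in> borel_measurable M" for k
    by (rule measurable_compose[OF chain_measurable[OF t0]]) simp
  have Ym [measurable]: "tem f g \<phi>inv h B r x0 \<Delta> k \<in> borel_measurable M" for k
    unfolding tem_def[abs_def]
    by (rule measurable_compose_countable'[where I = UNIV and f = "\<lambda>i \<omega>. ?T i (?X k \<omega>)" and g = "r (real k * \<Delta>)"])
      (auto intro: countable_finite chain_measurable t0)
  show Vm: "V k \<in> borel_measurable M" for k unfolding V_def by measurable
  define H where "H x i z = ennreal ((1 + quad_form Q (?T i x + \<Delta> *\<^sub>R f (?T i x) i + g (?T i x) i *v z)) powr q)" for x i z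
  have Hm: "(\<lambda>(x, z). H x i z) \<in> borel_measurable (borel \<Otimes>\<^sub>M borel)" for i
  proof -
    have [measurable]: "(\<lambda>p :: (real ^ 'n) \<times> (real ^ 'd). ?T i (fst p)) \<in> borel_measurable (borel \<Otimes>\<^sub>M borel)" by measurable
    note [measurable] = measurable_compose[OF this borel_measurable_continuous_onI[OF f]]
      measurable_compose[OF this borel_measurable_continuous_onI[OF g]]
    show ?thesis unfolding H_def case_prod_beta' by measurable
  qed
  have mono: "V (Suc k) \<omega> \<le> \<xi> $ r (real (Suc k) * \<Delta>) \<omega> * (1 + quad_form Q (?X (Suc k) \<omega>)) powr q" for \<omega>
  proof -
    obtain a where a: "0 \<le> a" "a \<le> 1" "tem f g \<phi>inv h B r x0 \<Delta> (Suc k) \<omega> = a *\<^sub>R ?X (Suc k) \<omega>"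
      unfolding tem_def using trunc_shrinks(1)[where \<phi>inv = \<phi>inv and h = h and \<Delta> = \<Delta>, OF inv] by metis
    have "a\<^sup>2 * quad_form Q (?X (Suc k) \<omega>) \<le> 1 * quad_form Q (?X (Suc k) \<omega>)"
      using a by (intro mult_right_mono sym_pos_def_nonneg[OF Q] power_le_one)
    then have "quad_form Q (tem f g \<phi>inv h B r x0 \<Delta> (Suc k) \<omega>) \<le> quad_form Q (?X (Suc k) \<omega>)"
      unfolding a(3) quad_form_scaleR by simp
    then show ?thesis unfolding V_def
      using \<xi> q sym_pos_def_nonneg[OF Q] by (intro mult_left_mono powr_mono2) auto
  qed
  have "(\<integral>\<^sup>+ \<omega>. ennreal (V (Suc k) \<omega>) \<partial>M)
    \<le> (\<integral>\<^sup>+ \<omega>. ennreal (\<xi> $ r (real (Suc k) * \<Delta>) \<omega>) * H (?X k \<omega>) (r (real k * \<Delta>) \<omega>)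
          (B (real (Suc k) * \<Delta>) \<omega> - B (real k * \<Delta>) \<omega>) \<partial>M)"
  proof (rule nn_integral_mono)
    fix \<omega>
    have "ennreal (V (Suc k) \<omega>) \<le> ennreal (\<xi> $ r (real (Suc k) * \<Delta>) \<omega> * (1 + quad_form Q (?X (Suc k) \<omega>)) powr q)"
      by (rule ennreal_leI[OF mono])
    also have "\<dots> = ennreal (\<xi> $ r (real (Suc k) * \<Delta>) \<omega>) * H (?X k \<omega>) (r (real k * \<Delta>) \<omega>)
          (B (real (Suc k) * \<Delta>) \<omega> - B (real k * \<Delta>) \<omega>)"
      using \<xi> unfolding H_def tem_pre.simps Let_def by (simp add: ennreal_mult)
    finally show "ennreal (V (Suc k) \<omega>) \<le> ennreal (\<xi> $ r (real (Suc k) * \<Delta>) \<omega>) * H (?X k \<omega>) (r (real k * \<Delta>) \<omega>)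
          (B (real (Suc k) * \<Delta>) \<omega> - B (real k * \<Delta>) \<omega>)" .
  qed
  also have "\<dots> = (\<integral>\<^sup>+ \<omega>. ennreal (\<Sum>j\<in>UNIV. P \<Delta> $ r (real k * \<Delta>) \<omega> $ j * \<xi> $ j)
          * (\<integral>\<^sup>+ \<omega>'. H (?X k \<omega>) (r (real k * \<Delta>) \<omega>) (B (real (Suc k) * \<Delta>) \<omega>' - B (real k * \<Delta>) \<omega>') \<partial>M) \<partial>M)"
    by (rule scheme_transition[OF f g P cond \<Delta> \<xi> Hm])
  also have "\<dots> \<le> (\<integral>\<^sup>+ \<omega>. ennreal (1 - c * \<Delta>) * ennreal (V k \<omega>) + ennreal (C * \<Delta>) \<partial>M)"
  proof (rule nn_integral_mono)
    fix \<omega>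
    have "ennreal ((1 - c * \<Delta>) * V k \<omega> + C * \<Delta>) = ennreal (1 - c * \<Delta>) * ennreal (V k \<omega>) + ennreal (C * \<Delta>)"
      using c C \<Delta> \<xi> by (simp add: V_def ennreal_mult)
    then show "ennreal (\<Sum>j\<in>UNIV. P \<Delta> $ r (real k * \<Delta>) \<omega> $ j * \<xi> $ j)
          * (\<integral>\<^sup>+ \<omega>'. H (?X k \<omega>) (r (real k * \<Delta>) \<omega>) (B (real (Suc k) * \<Delta>) \<omega>' - B (real k * \<Delta>) \<omega>') \<partial>M)
       \<le> ennreal (1 - c * \<Delta>) * ennreal (V k \<omega>) + ennreal (C * \<Delta>)"
      using step[of "r (real k * \<Delta>) \<omega>" "?X k \<omega>" k] unfolding H_def V_def tem_def by simp
  qed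
  also have "\<dots> = ennreal (1 - c * \<Delta>) * (\<integral>\<^sup>+ \<omega>. ennreal (V k \<omega>) \<partial>M) + ennreal (C * \<Delta>)"
    using Vm by (simp add: nn_integral_add nn_integral_cmult emeasure_space_1)
  finally show "(\<integral>\<^sup>+ \<omega>. ennreal (V (Suc k) \<omega>) \<partial>M) \<le> ennreal (1 - c * \<Delta>) * (\<integral>\<^sup>+ \<omega>. ennreal (V k \<omega>) \<partial>M) + ennreal (C * \<Delta>)" .
qed

end

lemma contraction_recursion_bound:
  fixes v :: "nat \<Rightarrow> ennreal"
  assumes step: "\<And>k. v (Suc k) \<le> ennreal (1 - c * \<Delta>) * v k + ennreal (C * \<Delta>)"
    and "v 0 \<le> ennreal D" "0 < \<Delta>" "c * \<Delta> \<le> 1" "C \<le> c * D" "0 \<le> D" "0 \<le> C"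
  shows "v k \<le> ennreal D"
proof (induction k)
  case (Suc k)
  have "v (Suc k) \<le> ennreal (1 - c * \<Delta>) * ennreal D + ennreal (C * \<Delta>)"
    by (rule order_trans[OF step]) (intro add_right_mono mult_left_mono Suc zero_le)
  also have "\<dots> = ennreal ((1 - c * \<Delta>) * D + C * \<Delta>)"
    using assms by (simp add: ennreal_mult)
  also have "\<dots> \<le> ennreal D"
    using mult_right_mono[OF assms(5), of \<Delta>] assms(3) by (intro ennreal_leI) (simp add: algebra_simps)
  finally show ?case .
qed (use assms in simp)

lemma exists_slack:
  fixes D E :: "'s::finite \<Rightarrow> real"
  assumes "\<And>i. D i < 0"
  shows "\<exists>\<epsilon>>0. \<forall>i. D i + \<epsilon> * E i < 0"
proof -
  have "\<forall>\<^sub>F \<epsilon> in at_right 0. \<forall>i. D i + \<epsilon> * E i < 0"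
  proof (rule eventually_all_finite)
    fix i
    have "((\<lambda>\<epsilon>. D i + \<epsilon> * E i) \<longlongrightarrow> D i + 0 * E i) (at_right 0)" by (intro tendsto_intros)
    then show "\<forall>\<^sub>F \<epsilon> in at_right 0. D i + \<epsilon> * E i < 0" by (rule order_tendstoD) (simp add: assms)
  qed
  with eventually_at_right_less[of "0 :: real"] have "\<forall>\<^sub>F \<epsilon> in at_right 0. 0 < \<epsilon> \<and> (\<forall>i. D i + \<epsilon> * E i < 0)"
    by (rule eventually_conj)
  then have "\<exists>\<epsilon>. 0 < \<epsilon> \<and> (\<forall>i. D i + \<epsilon> * E i < 0)" by (rule eventually_happens'[rotated]) simp
  then show ?thesis by blast
qed

section \<open>Uniform moment bound\<close>

theorem theorem4p3:
  fixes M :: "'w measure" and F :: "real \<Rightarrow> 'w measure"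
    and B :: "real \<Rightarrow> 'w \<Rightarrow> real ^ 'd" and r :: "real \<Rightarrow> 'w \<Rightarrow> 's::finite"
    and \<Gamma> :: "real ^ 's ^ 's" and \<pi> :: "real ^ 's" and i0 :: 's
    and f :: "real ^ 'n \<Rightarrow> 's \<Rightarrow> real ^ 'n" and g :: "real ^ 'n \<Rightarrow> 's \<Rightarrow> real ^ 'd ^ 'n"
    and x0 :: "real ^ 'n"
    and \<phi> :: "'s \<Rightarrow> real \<Rightarrow> real" and \<phi>inv :: "'s \<Rightarrow> real \<Rightarrow> ereal"
    and h :: "real \<Rightarrow> real" and K \<theta> pbar p :: real
    and Q :: "real ^ 'n ^ 'n" and \<alpha> :: "real ^ 's" and pstar :: ereal
  assumes noise: "switching_noise M F B r \<Gamma> \<pi> i0"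
    and lip_f: "\<And>i. locally_lipschitz (\<lambda>x. f x i)"
    and lip_g: "\<And>i. locally_lipschitz (\<lambda>x. g x i)"
    and growth: "\<And>i. growth_fun (\<lambda>x. f x i) (\<lambda>x. g x i) (\<phi> i) (\<phi>inv i)"
    and step: "step_fun \<phi> x0 K h"
    and pbar: "0 < pbar"
    and Q: "sym_pos_def Q"
    and limsup: "\<And>i. Limsup at_infinity (\<lambda>x. ereal
          (((1 + x \<bullet> (Q *v x)) * psi Q f g x i - (2 - pbar) * (norm ((x v* Q) v* g x i))\<^sup>2)
             / (x \<bullet> (Q *v x))\<^sup>2)) \<le> ereal (\<alpha> $ i)"
    and neg: "(\<Sum>i\<in>UNIV. \<pi> $ i * \<alpha> $ i) < 0"
    and theta: "0 < \<theta>" "\<theta> < 1/2"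
    and step_theta: "\<And>\<Delta>. \<Delta> \<in> {0<..1} \<Longrightarrow> \<Delta> powr (1/2 - \<theta>) * h \<Delta> \<le> K"
    and pstar: "is_p_star \<Gamma> \<alpha> pstar"
    and p: "0 < p" "ereal p < pstar" "p \<le> pbar"
  shows "\<exists>\<Delta>star\<in>{0<..1}. \<exists>C::real.
           (SUP \<Delta>\<in>{0<..\<Delta>star}. SUP k. \<integral>\<^sup>+ \<omega>. ennreal (norm (tem f g \<phi>inv h B r x0 \<Delta> k \<omega>) powr p) \<partial>M)
             \<le> ennreal C"
proof -
  interpret N: switching_noise M F B r \<Gamma> \<pi> i0 by (rule noise)
  define q where "q = p / 2"
  have q: "0 < q" using p by (simp add: q_def)
  have fc: "continuous_on UNIV (\<lambda>x. f x i)" and gc: "continuous_on UNIV (\<lambda>x. g x i)" for i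
    using lip_f lip_g by (auto intro: locally_lipschitz_continuous)
  obtain P where P: "transition_semigroup \<Gamma> P" and cond: "\<And>s t j. 0 \<le> s \<Longrightarrow> 0 \<le> t \<Longrightarrow> AE \<omega> in M.
           real_cond_exp M (F s) (indicator {\<omega>\<in>space M. r (s + t) \<omega> = j}) \<omega> = P t $ r s \<omega> $ j"
    using N.markov unfolding N.markov_chain_def by blast
  obtain \<xi> where \<xi>: "\<And>i. 0 < \<xi> $ i" and \<xi>neg: "\<And>i. (\<Gamma> *v \<xi>) $ i + q * \<alpha> $ i * \<xi> $ i < 0"
    using exists_lyapunov_weights[OF N.generator N.irreducible neg pstar p(1,2)] unfolding q_def by blast
  \<comment> \<open>One \<open>\<epsilon>\<close> pays for the error of the semigroup, the limsup and the expansion of the power.\<close>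
  obtain \<epsilon> where \<epsilon>: "0 < \<epsilon>" and slack: "\<And>i. (\<Gamma> *v \<xi>) $ i + q * \<alpha> $ i * \<xi> $ i + \<epsilon> * (1 + (q + 1) * \<xi> $ i) < 0"
    using exists_slack[where D = "\<lambda>i. (\<Gamma> *v \<xi>) $ i + q * \<alpha> $ i * \<xi> $ i"
      and E = "\<lambda>i. 1 + (q + 1) * \<xi> $ i", OF \<xi>neg] by blast
  define A where "A i = (\<Gamma> *v \<xi>) $ i + \<epsilon>" for i
  define b where "b i = q * (\<alpha> $ i + \<epsilon>) + \<epsilon>" for i
  have "A i + \<xi> $ i * b i < 0" for i
    using slack[of i] by (simp add: A_def b_def algebra_simps)
  then obtain c where c: "0 < c"
    and contr: "\<forall>\<^sub>F t in at_right 0. \<forall>i. (\<xi> $ i + t * A i) * (1 + t * b i) \<le> (1 - c * t) * \<xi> $ i"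
    using contraction_rate[of "\<lambda>i. \<xi> $ i" A b, OF \<xi>] by blast

  define u where "u y = 1 + quad_form Q y" for y
  define E where "E i y = psi Q f g y i / u y - (2 - p) * (norm ((y v* Q) v* g y i))\<^sup>2 / (u y)\<^sup>2" for i y
  have "\<exists>C\<ge>0. \<forall>y. u y powr q * E i y \<le> (\<alpha> $ i + \<epsilon>) * u y powr q + C" for i
    unfolding u_def E_def by (rule khasminskii_drift_bound[OF Q fc gc limsup p(3) \<epsilon>])
  then obtain C1 where C1: "\<And>i. 0 \<le> C1 i" "\<And>i y. u y powr q * E i y \<le> (\<alpha> $ i + \<epsilon>) * u y powr q + C1 i"
    by metis
  have K: "0 < K" using step unfolding step_fun_def by auto
  obtain C where C: "0 \<le> C" and gauss: "\<And>(a :: real ^ 'n) (b :: real ^ 'd ^ 'n) y h \<Delta> (Z :: 'w \<Rightarrow> real ^ 'd).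
     N.gaussian_increment \<Delta> Z \<Longrightarrow> 0 \<le> h \<Longrightarrow> h * \<Delta> \<le> K \<Longrightarrow>
     norm a \<le> h * (1 + norm y) \<Longrightarrow> (norm b)\<^sup>2 \<le> h * (1 + norm y)\<^sup>2 \<Longrightarrow>
     (\<integral>\<^sup>+ \<omega>. ennreal ((1 + quad_form Q (y + \<Delta> *\<^sub>R a + b *v Z \<omega>)) powr q) \<partial>M)
     \<le> ennreal ((1 + quad_form Q y) powr q *
         (1 + q * \<Delta> * ((2 * (y \<bullet> (Q *v a)) + trace (transpose b ** Q ** b)) / (1 + quad_form Q y)
                + 2 * (q - 1) * (norm ((y v* Q) v* b))\<^sup>2 / (1 + quad_form Q y)\<^sup>2)
            + C * (h * \<Delta>)\<^sup>2))"
    using N.gaussian_step_bound[OF Q q less_imp_le[OF K], where 'd = 'd] by blast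
  define C2 where "C2 = (\<Sum>i\<in>UNIV. (\<xi> $ i + \<bar>A i\<bar>) * (q * C1 i))"
  have C2: "(\<xi> $ i + \<bar>A i\<bar>) * (q * C1 i) \<le> C2" for i
    unfolding C2_def using less_imp_le[OF \<xi>] C1 q
    by (intro member_le_sum[of i UNIV "\<lambda>i. (\<xi> $ i + \<bar>A i\<bar>) * (q * C1 i)"]) auto
  have C2': "0 \<le> C2" unfolding C2_def using less_imp_le[OF \<xi>] C1 q by (intro sum_nonneg) auto

  \<comment> \<open>So \<open>(h\<Delta>)\<^sup>2 = O(\<Delta>\<^sup>1\<^sup>+\<^sup>2\<^sup>\<theta>)\<close>, which makes the expansion error \<open>o(\<Delta>)\<close>.\<close>
  have hK: "h \<Delta> * \<Delta> \<le> K * \<Delta> powr (1 / 2 + \<theta>)" if \<Delta>: "\<Delta> \<in> {0<..1}" for \<Delta>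
  proof -
    have "\<Delta> = \<Delta> powr (1 / 2 - \<theta>) * \<Delta> powr (1 / 2 + \<theta>)" using \<Delta> by (simp flip: powr_add)
    then have "h \<Delta> * \<Delta> = (\<Delta> powr (1 / 2 - \<theta>) * h \<Delta>) * \<Delta> powr (1 / 2 + \<theta>)" by (metis mult.assoc mult.commute)
    also have "\<dots> \<le> K * \<Delta> powr (1 / 2 + \<theta>)" by (intro mult_right_mono step_theta \<Delta>) simp
    finally show ?thesis .
  qed
  have hK1: "h \<Delta> * \<Delta> \<le> K" if \<Delta>: "\<Delta> \<in> {0<..1}" for \<Delta>
  proof -
    have "\<Delta> powr (1 / 2 + \<theta>) \<le> 1" using \<Delta> theta powr_mono2[of "1 / 2 + \<theta>" \<Delta> 1] by simp
    then have "K * \<Delta> powr (1 / 2 + \<theta>) \<le> K * 1" using K by (intro mult_left_mono) auto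
    then show ?thesis using hK[OF \<Delta>] by simp
  qed

  define ok where "ok \<Delta> \<longleftrightarrow> \<Delta> powr (2 * \<theta>) * (C * K\<^sup>2) \<le> \<epsilon> \<and> 0 \<le> h \<Delta> \<and> (\<forall>i. 0 \<le> 1 + \<Delta> * b i) \<and> c * \<Delta> \<le> 1
     \<and> (\<forall>i. (\<xi> $ i + \<Delta> * A i) * (1 + \<Delta> * b i) \<le> (1 - c * \<Delta>) * \<xi> $ i)
     \<and> (\<forall>i. (\<Sum>j\<in>UNIV. P \<Delta> $ i $ j * \<xi> $ j) \<le> \<xi> $ i + \<Delta> * A i)" for \<Delta>
  have "\<forall>\<^sub>F \<Delta> in at_right 0. \<Delta> powr (2 * \<theta>) * (C * K\<^sup>2) \<le> \<epsilon>"
  proof -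
    have "((\<lambda>\<Delta>. \<Delta> powr (2 * \<theta>)) \<longlongrightarrow> 0) (at_right (0 :: real))"
      by (rule tendsto_zero_powrI[where b = "2 * \<theta>"])
        (use theta in \<open>auto intro!: tendsto_intros simp: eventually_at_right_less eventually_at_filter\<close>)
    from tendsto_mult_right[OF this, of "C * K\<^sup>2"] \<epsilon> have "\<forall>\<^sub>F \<Delta> in at_right 0. \<Delta> powr (2 * \<theta>) * (C * K\<^sup>2) < \<epsilon>"
      by (intro order_tendstoD) auto
    then show ?thesis by (rule eventually_mono) simp
  qed
  moreover have "\<forall>\<^sub>F \<Delta> in at_right 0. 0 \<le> h \<Delta>"
    using step unfolding step_fun_def filterlim_at_top by blast
  moreover have "\<forall>\<^sub>F \<Delta> in at_right 0. \<forall>i. 0 \<le> 1 + \<Delta> * b i"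
  proof (rule eventually_all_finite)
    fix i
    have "((\<lambda>\<Delta>. 1 + \<Delta> * b i) \<longlongrightarrow> 1 + 0 * b i) (at_right 0)" by (intro tendsto_intros)
    then have "\<forall>\<^sub>F \<Delta> in at_right 0. 0 < 1 + \<Delta> * b i" by (rule order_tendstoD) simp
    then show "\<forall>\<^sub>F \<Delta> in at_right 0. 0 \<le> 1 + \<Delta> * b i" by (rule eventually_mono) simp
  qed
  moreover have "\<forall>\<^sub>F \<Delta> in at_right 0. c * \<Delta> \<le> 1"
  proof -
    have "((\<lambda>\<Delta>. c * \<Delta>) \<longlongrightarrow> c * 0) (at_right 0)" by (intro tendsto_intros)
    then have "\<forall>\<^sub>F \<Delta> in at_right 0. c * \<Delta> < 1" by (rule order_tendstoD) simp
    then show ?thesis by (rule eventually_mono) simp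
  qed
  moreover have "\<forall>\<^sub>F \<Delta> in at_right 0. \<forall>i. (\<Sum>j\<in>UNIV. P \<Delta> $ i $ j * \<xi> $ j) \<le> \<xi> $ i + \<Delta> * A i"
    unfolding A_def by (rule semigroup_drift[OF P \<epsilon>])
  moreover note contr
  ultimately have "\<forall>\<^sub>F \<Delta> in at_right 0. ok \<Delta>"
  proof eventually_elim
    case (elim \<Delta>)
    then show ?case unfolding ok_def by blast
  qed
  then obtain d where d: "0 < d" and small: "\<And>\<Delta>. 0 < \<Delta> \<Longrightarrow> \<Delta> < d \<Longrightarrow> ok \<Delta>"
    unfolding eventually_at_right_field by blast
  define \<Delta>s where "\<Delta>s = min 1 (d / 2)"
  have \<Delta>s: "\<Delta>s \<in> {0<..1}" using d by (simp add: \<Delta>s_def)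

  define xmin where "xmin = Min (range (\<lambda>i. \<xi> $ i))"
  have xmin: "0 < xmin" "xmin \<le> \<xi> $ i" for i
    unfolding xmin_def using \<xi> by (auto simp: Min_gr_iff)
  define xmax where "xmax = Max (range (\<lambda>i. \<xi> $ i))"
  have xmax: "\<xi> $ i \<le> xmax" for i unfolding xmax_def by (rule Max_ge) auto
  \<comment> \<open>The first entry bounds the initial value of \<open>V\<close>, the second is the fixed point of the recursion.\<close>
  define D where "D = max (xmax * u x0 powr q) (C2 / c)"
  have D: "0 \<le> D" "C2 \<le> c * D" "xmax * u x0 powr q \<le> D"
    using c C2' by (auto simp: D_def le_max_iff_disj) (simp add: max_def field_simps)
  obtain c1 where c1: "0 < c1" "\<And>x. c1 * (norm x)\<^sup>2 \<le> quad_form Q x"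
    using sym_pos_def_coercive[OF Q] by blast
  define c3 where "c3 = 1 / (c1 powr q * xmin)"
  have c3: "0 \<le> c3" using c1 xmin by (simp add: c3_def)

  have main: "(\<integral>\<^sup>+ \<omega>. ennreal (norm (tem f g \<phi>inv h B r x0 \<Delta> k \<omega>) powr p) \<partial>M) \<le> ennreal (c3 * D)"
    if \<Delta>: "\<Delta> \<in> {0<..\<Delta>s}" for \<Delta> k
  proof -
    have \<Delta>0: "0 < \<Delta>" and \<Delta>1: "\<Delta> \<in> {0<..1}" and \<Delta>d: "\<Delta> < d" using \<Delta> d by (auto simp: \<Delta>s_def)
    note sm = small[OF \<Delta>0 \<Delta>d, unfolded ok_def]
    have "\<phi> i (max (norm x0) 1) \<le> Max (range (\<lambda>i. \<phi> i (max (norm x0) 1)))" for i by (rule Max_ge) auto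
    then have \<phi>h: "\<phi> i (max (norm x0) 1) \<le> h \<Delta>" for i
      using step \<Delta>1 unfolding step_fun_def by (meson order_trans)
    have one: "1 \<le> max (norm x0) 1" by simp
    note tg = truncated_growth[where \<phi>inv = \<phi>inv and h = h and \<Delta> = \<Delta>, OF growth one \<phi>h]
    have err: "C * (h \<Delta> * \<Delta>)\<^sup>2 \<le> \<epsilon> * \<Delta>"
    proof -
      have "(h \<Delta> * \<Delta>)\<^sup>2 \<le> (K * \<Delta> powr (1 / 2 + \<theta>))\<^sup>2" using sm \<Delta>0 by (intro power_mono hK \<Delta>1) auto
      also have "\<dots> = K\<^sup>2 * (\<Delta> powr (2 * \<theta>) * \<Delta>)"
      proof -
        have "(\<Delta> powr (1 / 2 + \<theta>))\<^sup>2 = \<Delta> powr (2 * \<theta> + 1)"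
          by (simp add: power2_eq_square algebra_simps flip: powr_add)
        also have "\<dots> = \<Delta> powr (2 * \<theta>) * \<Delta>" using \<Delta>0 by (simp add: powr_add)
        finally show ?thesis by (simp add: power_mult_distrib)
      qed
      finally have "C * (h \<Delta> * \<Delta>)\<^sup>2 \<le> C * (K\<^sup>2 * (\<Delta> powr (2 * \<theta>) * \<Delta>))" using C by (rule mult_left_mono)
      also have "\<dots> = (\<Delta> powr (2 * \<theta>) * (C * K\<^sup>2)) * \<Delta>" by simp
      also have "\<dots> \<le> \<epsilon> * \<Delta>" using sm \<Delta>0 by (intro mult_right_mono) auto
      finally show ?thesis .
    qed
    have one_step: "ennreal (\<Sum>j\<in>UNIV. P \<Delta> $ i $ j * \<xi> $ j) * (\<integral>\<^sup>+ \<omega>. ennreal ((1 + quad_form Q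
          (trunc \<phi>inv h \<Delta> i x + \<Delta> *\<^sub>R f (trunc \<phi>inv h \<Delta> i x) i
            + g (trunc \<phi>inv h \<Delta> i x) i *v (B (real (Suc k) * \<Delta>) \<omega> - B (real k * \<Delta>) \<omega>))) powr q) \<partial>M)
        \<le> ennreal ((1 - c * \<Delta>) * (\<xi> $ i * (1 + quad_form Q (trunc \<phi>inv h \<Delta> i x)) powr q) + C2 * \<Delta>)" for k i x
    proof -
      define y where "y = trunc \<phi>inv h \<Delta> i x"
      define U where "U = u y powr q"
      define Z where "Z \<omega> = B (real (Suc k) * \<Delta>) \<omega> - B (real k * \<Delta>) \<omega>" for \<omega>
      define S where "S = (\<Sum>j\<in>UNIV. P \<Delta> $ i $ j * \<xi> $ j)"
      have S: "0 \<le> S" "S \<le> \<xi> $ i + \<Delta> * A i"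
      proof -
        have "0 \<le> P \<Delta> $ i $ j" for j using P \<Delta>0 unfolding transition_semigroup_def by auto
        then show "0 \<le> S" unfolding S_def by (intro sum_nonneg mult_nonneg_nonneg less_imp_le[OF \<xi>])
        show "S \<le> \<xi> $ i + \<Delta> * A i" using sm unfolding S_def by blast
      qed
      have U: "0 \<le> U" by (simp add: U_def)
      have Z: "N.gaussian_increment \<Delta> Z"
        using N.brownian_gaussian_increment[of "real k * \<Delta>" "real (Suc k) * \<Delta>"] \<Delta>0
        unfolding Z_def by (simp add: algebra_simps)
      have "(\<integral>\<^sup>+ \<omega>. ennreal ((1 + quad_form Q (y + \<Delta> *\<^sub>R f y i + g y i *v Z \<omega>)) powr q) \<partial>M)
        \<le> ennreal (U * (1 + q * \<Delta> * (psi Q f g y i / u y + 2 * (q - 1) * (norm ((y v* Q) v* g y i))\<^sup>2 / (u y)\<^sup>2)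
            + C * (h \<Delta> * \<Delta>)\<^sup>2))"
        unfolding U_def u_def psi_def
        by (rule gauss[OF Z _ hK1[OF \<Delta>1]]) (use sm tg(2,3)[of i x] in \<open>auto simp: y_def\<close>)
      also have "\<dots> \<le> ennreal (U * (1 + \<Delta> * b i) + q * C1 i * \<Delta>)"
      proof (rule ennreal_leI)
        \<comment> \<open>Since \<open>2(q - 1) = -(2 - p)\<close>, the mean first-order growth is the quotient of the limsup hypothesis.\<close>
        have "psi Q f g y i / u y + 2 * (q - 1) * (norm ((y v* Q) v* g y i))\<^sup>2 / (u y)\<^sup>2 = E i y"
          by (simp add: E_def q_def algebra_simps diff_divide_distrib add_divide_distrib)
        then have "U * (1 + q * \<Delta> * (psi Q f g y i / u y + 2 * (q - 1) * (norm ((y v* Q) v* g y i))\<^sup>2 / (u y)\<^sup>2)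
            + C * (h \<Delta> * \<Delta>)\<^sup>2) = U + q * \<Delta> * (U * E i y) + U * (C * (h \<Delta> * \<Delta>)\<^sup>2)"
          by (simp add: algebra_simps)
        also have "\<dots> \<le> U + q * \<Delta> * ((\<alpha> $ i + \<epsilon>) * U + C1 i) + U * (\<epsilon> * \<Delta>)"
          using C1(2)[of y i] err U q \<Delta>0 unfolding U_def by (intro add_mono mult_left_mono) auto
        also have "\<dots> = U * (1 + \<Delta> * b i) + q * C1 i * \<Delta>" by (simp add: b_def algebra_simps)
        finally show "U * (1 + q * \<Delta> * (psi Q f g y i / u y + 2 * (q - 1) * (norm ((y v* Q) v* g y i))\<^sup>2 / (u y)\<^sup>2)
            + C * (h \<Delta> * \<Delta>)\<^sup>2) \<le> U * (1 + \<Delta> * b i) + q * C1 i * \<Delta>" .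
      qed
      finally have "ennreal S * (\<integral>\<^sup>+ \<omega>. ennreal ((1 + quad_form Q (y + \<Delta> *\<^sub>R f y i + g y i *v Z \<omega>)) powr q) \<partial>M)
        \<le> ennreal S * ennreal (U * (1 + \<Delta> * b i) + q * C1 i * \<Delta>)"
        by (rule mult_left_mono) simp
      also have "\<dots> = ennreal (S * (U * (1 + \<Delta> * b i) + q * C1 i * \<Delta>))"
        using S by (simp add: ennreal_mult')
      also have "\<dots> \<le> ennreal ((1 - c * \<Delta>) * (\<xi> $ i * U) + C2 * \<Delta>)"
      proof (rule ennreal_leI)
        have "0 \<le> U * (1 + \<Delta> * b i)" using U sm by (intro mult_nonneg_nonneg) blast+
        moreover have "0 \<le> q * C1 i * \<Delta>" using q C1(1)[of i] \<Delta>0 by simp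
        ultimately have "0 \<le> U * (1 + \<Delta> * b i) + q * C1 i * \<Delta>" by simp
        then have "S * (U * (1 + \<Delta> * b i) + q * C1 i * \<Delta>)
            \<le> (\<xi> $ i + \<Delta> * A i) * (U * (1 + \<Delta> * b i) + q * C1 i * \<Delta>)"
          using S by (intro mult_right_mono)
        also have "\<dots> = U * ((\<xi> $ i + \<Delta> * A i) * (1 + \<Delta> * b i)) + (\<xi> $ i + \<Delta> * A i) * (q * C1 i * \<Delta>)"
          by (simp add: algebra_simps)
        also have "\<dots> \<le> U * ((1 - c * \<Delta>) * \<xi> $ i) + (\<xi> $ i + \<bar>A i\<bar>) * (q * C1 i * \<Delta>)"
        proof (intro add_mono mult_left_mono mult_right_mono)
          have "\<Delta> * A i \<le> \<Delta> * \<bar>A i\<bar>" using \<Delta>0 by (intro mult_left_mono) auto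
          also have "\<dots> \<le> 1 * \<bar>A i\<bar>" using \<Delta>1 by (intro mult_right_mono) auto
          finally show "\<Delta> * A i \<le> \<bar>A i\<bar>" by simp
        qed (use sm U q C1(1)[of i] \<Delta>0 in auto)
        also have "\<dots> \<le> U * ((1 - c * \<Delta>) * \<xi> $ i) + C2 * \<Delta>"
          using mult_right_mono[OF C2[of i], of \<Delta>] \<Delta>0 by (simp add: mult.assoc)
        finally show "S * (U * (1 + \<Delta> * b i) + q * C1 i * \<Delta>) \<le> (1 - c * \<Delta>) * (\<xi> $ i * U) + C2 * \<Delta>"
          by (simp add: ac_simps)
      qed
      finally show ?thesis unfolding S_def U_def u_def Z_def y_def .
    qed
    define V where "V k \<omega> = \<xi> $ r (real k * \<Delta>) \<omega> * (1 + quad_form Q (tem f g \<phi>inv h B r x0 \<Delta> k \<omega>)) powr q" for k \<omega>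
    have c\<Delta>: "c * \<Delta> \<le> 1" using sm by blast
    note recursion = N.lyapunov_recursion[OF fc gc P cond \<Delta>0 less_imp_le[OF \<xi>] Q q tg(1) c\<Delta> C2' one_step]
    have Vm: "V k \<in> borel_measurable M" for k
      unfolding V_def by (rule recursion(1); assumption)
    have rec: "(\<integral>\<^sup>+ \<omega>. ennreal (V (Suc k) \<omega>) \<partial>M)
        \<le> ennreal (1 - c * \<Delta>) * (\<integral>\<^sup>+ \<omega>. ennreal (V k \<omega>) \<partial>M) + ennreal (C2 * \<Delta>)" for k
      unfolding V_def by (rule recursion(2); assumption)
    have "(\<integral>\<^sup>+ \<omega>. ennreal (V k \<omega>) \<partial>M) \<le> ennreal D"
    proof (rule contraction_recursion_bound[where v = "\<lambda>k. \<integral>\<^sup>+ \<omega>. ennreal (V k \<omega>) \<partial>M", OF rec])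
      have "V 0 \<omega> \<le> D" for \<omega>
      proof -
        let ?y = "trunc \<phi>inv h \<Delta> (r (real 0 * \<Delta>) \<omega>) x0"
        obtain a where a: "0 \<le> a" "a \<le> 1" "?y = a *\<^sub>R x0"
          using trunc_shrinks(1)[where \<phi>inv = \<phi>inv and h = h and \<Delta> = \<Delta>, OF tg(1)] by metis
        have "a\<^sup>2 * quad_form Q x0 \<le> 1 * quad_form Q x0"
          using a by (intro mult_right_mono sym_pos_def_nonneg[OF Q] power_le_one)
        then have "quad_form Q ?y \<le> quad_form Q x0" unfolding a(3) quad_form_scaleR by simp
        then have "V 0 \<omega> \<le> xmax * u x0 powr q"
          unfolding V_def tem_def u_def
          using q sym_pos_def_nonneg[OF Q] less_imp_le[OF less_le_trans[OF \<xi> xmax]]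
          by (intro mult_mono xmax powr_mono2) auto
        then show ?thesis using D by simp
      qed
      then have "(\<integral>\<^sup>+ \<omega>. ennreal (V 0 \<omega>) \<partial>M) \<le> (\<integral>\<^sup>+ \<omega>. ennreal D \<partial>M)"
        by (intro nn_integral_mono ennreal_leI)
      then show "(\<integral>\<^sup>+ \<omega>. ennreal (V 0 \<omega>) \<partial>M) \<le> ennreal D" by (simp add: N.emeasure_space_1)
    qed (use \<Delta>0 c\<Delta> D C2' in auto)
    have pw: "norm (tem f g \<phi>inv h B r x0 \<Delta> k \<omega>) powr p \<le> c3 * V k \<omega>" for \<omega>
    proof -
      let ?y = "tem f g \<phi>inv h B r x0 \<Delta> k \<omega>"
      have "norm ?y powr p = (norm ?y powr 2) powr q" unfolding powr_powr q_def by simp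
      also have "\<dots> = ((norm ?y)\<^sup>2) powr q" by (simp add: powr_numeral)
      also have "\<dots> \<le> (u ?y / c1) powr q"
        using c1(1) c1(2)[of ?y] q by (intro powr_mono2) (auto simp: u_def field_simps)
      also have "\<dots> = u ?y powr q / c1 powr q" by (rule powr_divide)
      also have "\<dots> = c3 * (xmin * u ?y powr q)" using xmin(1) by (simp add: c3_def)
      also have "\<dots> \<le> c3 * V k \<omega>"
        unfolding V_def u_def by (intro mult_left_mono mult_right_mono xmin c3) simp
      finally show ?thesis .
    qed
    have "(\<integral>\<^sup>+ \<omega>. ennreal (norm (tem f g \<phi>inv h B r x0 \<Delta> k \<omega>) powr p) \<partial>M)
      \<le> (\<integral>\<^sup>+ \<omega>. ennreal c3 * ennreal (V k \<omega>) \<partial>M)"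
      by (intro nn_integral_mono) (simp add: ennreal_mult'[OF c3, symmetric] ennreal_leI pw)
    also have "\<dots> = ennreal c3 * (\<integral>\<^sup>+ \<omega>. ennreal (V k \<omega>) \<partial>M)"
      using Vm[of k] by (simp add: nn_integral_cmult)
    also have "\<dots> \<le> ennreal c3 * ennreal D"
      by (rule mult_left_mono) (fact, simp)
    also have "\<dots> = ennreal (c3 * D)" using c3 by (simp add: ennreal_mult')
    finally show ?thesis .
  qed
  show ?thesis
    by (rule bexI[OF _ \<Delta>s], rule exI[of _ "c3 * D"]) (intro SUP_least main)
qed

end
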